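(* Let $q>1$ be an integer. The commutator subgroup $N_q'$ of the Neretin group $N_q$ is $9$-uniformly simple, and its commutator width is at most three. Moreover, for all natural numbers $q>r\geq 1$, the commutator subgroup $G_{q,r}'$ of the Higman--Thompson group $G_{q,r}$ is $9$-uniformly simple, and its commutator width is at most three.
   Context: A group $G$ is called $N$-uniformly simple if for every nontrivial $f\in G$ and every nontrivial conjugacy class $C\subset G$, the element $f$ is a product of at most $N$ elements of $C^{\pm1}=C\cup C^{-1}$. The commutator length of an element of $[G,G]$ is the minimal number of commutators of elements of $G$ whose product it is; the commutator width of $G$ is the maximum of the commutator lengths of the elements of $[G,G]$. Neretin group: for an integer $q>1$, $T_q$ denotes the regular tree all of whose vertices have degree $q+1$. A spheromorphism (almost automorphism) of a tree $T$ is a class of permutations of the vertex set of $T$ which preserve all but finitely many adjacency and nonadjacency relations, where two such permutations are equivalent if they differ only on a finite set of vertices. The spheromorphisms of $T$ form a group $\mathrm{AAut}(T)$, and $N_q=\mathrm{AAut}(T_q)$. Higman--Thompson group: for natural numbers $q>r\geq1$, the Jónsson--Tarski algebra $V_{q,r}$ is the free algebra on $r$ generators in the variety of algebras $V$ with one $q$-ary operation $\lambda\colon V^q\to V$ and $q$ unary operations $\alpha_1,\dots,\alpha_q\colon V\to V$ satisfying $\alpha_i(\lambda(x_1,\dots,x_q))=x_i$ for all $i$ and $\lambda(\alpha_1(x),\dots,\alpha_q(x))=x$. The group $G_{q,r}$ is the group of automorphisms of the algebra $V_{q,r}$. *)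

theory Defs
  imports "HOL-Algebra.Algebra" "HOL-Library.Extended_Nat"
begin

section \<open>Uniform simplicity and commutator width\<close>

definition conjugacy_class :: "('a, 'b) monoid_scheme \<Rightarrow> 'a \<Rightarrow> 'a set" where
  "conjugacy_class G h = {g \<otimes>\<^bsub>G\<^esub> h \<otimes>\<^bsub>G\<^esub> inv\<^bsub>G\<^esub> g |g. g \<in> carrier G}"

definition list_mult :: "('a, 'b) monoid_scheme \<Rightarrow> 'a list \<Rightarrow> 'a" where
  "list_mult G xs = foldr (\<lambda>x y. x \<otimes>\<^bsub>G\<^esub> y) xs \<one>\<^bsub>G\<^esub>"

definition uniformly_simple :: "nat \<Rightarrow> ('a, 'b) monoid_scheme \<Rightarrow> bool" where
  "uniformly_simple N G \<longleftrightarrow> group G \<and>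
     (\<forall>f \<in> carrier G - {\<one>\<^bsub>G\<^esub>}. \<forall>h \<in> carrier G - {\<one>\<^bsub>G\<^esub>}.
        let C = conjugacy_class G h in
        \<exists>xs. length xs \<le> N \<and> set xs \<subseteq> C \<union> m_inv G ` C \<and> f = list_mult G xs)"

definition commutator_subgroup :: "('a, 'b) monoid_scheme \<Rightarrow> ('a, 'b) monoid_scheme" where
  "commutator_subgroup G = G\<lparr>carrier := derived G (carrier G)\<rparr>"

text \<open>The library's \<open>derived_set G (carrier G)\<close> is the set of all commutators
  \<open>g h g\<^sup>-\<^sup>1 h\<^sup>-\<^sup>1\<close> of elements of \<open>G\<close>. The infimum of the empty set is \<open>\<infinity>\<close>; this value is
  never attained on the commutator subgroup.\<close>

definition commutator_length :: "('a, 'b) monoid_scheme \<Rightarrow> 'a \<Rightarrow> enat" where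
  "commutator_length G g =
     (INF cs \<in> {cs. set cs \<subseteq> derived_set G (carrier G) \<and> list_mult G cs = g}. enat (length cs))"

definition commutator_width :: "('a, 'b) monoid_scheme \<Rightarrow> enat" where
  "commutator_width G = (SUP g \<in> derived G (carrier G). commutator_length G g)"


section \<open>Regular trees and the Neretin group\<close>

text \<open>A simple graph is given by its vertex set \<open>V\<close> and its adjacency relation \<open>E\<close>. (The notions
  of cycle and tree in the AFP entry on digraphs are directed: there an edge traversed back and
  forth is a cycle.)\<close>

definition simple_graph :: "'v set \<Rightarrow> 'v rel \<Rightarrow> bool" where
  "simple_graph V E \<longleftrightarrow> E \<subseteq> V \<times> V \<and> sym E \<and> irrefl E"

definition graph_cycle :: "'v rel \<Rightarrow> 'v list \<Rightarrow> bool" where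
  "graph_cycle E xs \<longleftrightarrow> length xs \<ge> 3 \<and> distinct xs \<and>
     successively (\<lambda>x y. (x, y) \<in> E) xs \<and> (last xs, hd xs) \<in> E"

definition tree :: "'v set \<Rightarrow> 'v rel \<Rightarrow> bool" where
  "tree V E \<longleftrightarrow> simple_graph V E \<and> V \<noteq> {} \<and> (\<forall>x\<in>V. \<forall>y\<in>V. (x, y) \<in> E\<^sup>*) \<and>
     \<not> (\<exists>xs. graph_cycle E xs)"

definition regular_tree :: "nat \<Rightarrow> 'v set \<Rightarrow> 'v rel \<Rightarrow> bool" where
  "regular_tree d V E \<longleftrightarrow> tree V E \<and> (\<forall>v\<in>V. finite (E `` {v}) \<and> card (E `` {v}) = d)"

text \<open>For every \<open>d\<close> there is a \<open>d\<close>-regular tree: the Cayley graph of the free product of \<open>d\<close> groups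
  of order two.\<close>

lemma regular_tree_exists: "\<exists>(V :: nat list set) E. regular_tree d V E"
proof -
  define V :: "nat list set" where "V = {w. set w \<subseteq> {..<d} \<and> distinct_adj w}"
  define E where "E = {(w, w') \<in> V \<times> V. (w \<noteq> [] \<and> w' = tl w) \<or> (w' \<noteq> [] \<and> w = tl w')}"
  have tlV: "tl w \<in> V" if "w \<in> V" for w
    using that by (cases w) (auto simp: V_def distinct_adj_Cons)
  have simple: "simple_graph V E"
  proof -
    have "w \<noteq> tl w" if "w \<noteq> []" for w :: "nat list" using that by (cases w) auto
    thus ?thesis by (auto simp: simple_graph_def E_def sym_def irrefl_def)
  qed
  have symE: "sym E" using simple by (simp add: simple_graph_def)
  have root: "(w, []) \<in> E\<^sup>*" if "w \<in> V" for w
    using that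
  proof (induction w)
    case (Cons a w)
    have "w \<in> V" using tlV[OF Cons.prems] by simp
    moreover from this have "(a # w, w) \<in> E" using Cons.prems by (simp add: E_def)
    ultimately show ?case using Cons.IH by (meson converse_rtrancl_into_rtrancl)
  qed auto
  have conn: "(x, y) \<in> E\<^sup>*" if "x \<in> V" "y \<in> V" for x y
    using root[OF that(1)] root[OF that(2)] sym_rtrancl[OF symE] by (meson rtrancl_trans symD)
  have acyc: "\<not> graph_cycle E xs" for xs
  proof
    assume c: "graph_cycle E xs"
    define n where "n = length xs"
    have n: "n \<ge> 3" and dist: "distinct xs" using c by (auto simp: graph_cycle_def n_def)
    have edge: "(xs ! i, xs ! (Suc i mod n)) \<in> E" if "i < n" for i
    proof (cases "Suc i < n")
      case True
      thus ?thesis using c by (auto simp: graph_cycle_def successively_conv_nth n_def)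
    next
      case False
      hence i: "i = n - 1" using that by simp
      hence "Suc i mod n = 0" using n by simp
      moreover have "xs \<noteq> []" using n by (auto simp: n_def)
      ultimately show ?thesis using c i by (simp add: graph_cycle_def last_conv_nth hd_conv_nth n_def)
    qed
    have "\<exists>i. i < n \<and> (\<forall>j. j < n \<longrightarrow> length (xs ! j) \<le> length (xs ! i))"
    proof -
      have "0 \<in> {..<n}" using n by simp
      hence "finite ((\<lambda>i. length (xs ! i)) ` {..<n})" "(\<lambda>i. length (xs ! i)) ` {..<n} \<noteq> {}"
        by blast+
      from Max_in[OF this] Max_ge[OF this(1)] show ?thesis by fastforce
    qed
    then obtain i where i: "i < n" and mx: "\<And>j. j < n \<Longrightarrow> length (xs ! j) \<le> length (xs ! i)"
      by blast
    have down: "xs ! j = tl (xs ! i)" if "j < n" "(xs ! i, xs ! j) \<in> E" for j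
    proof (rule ccontr)
      assume "xs ! j \<noteq> tl (xs ! i)"
      hence "xs ! j \<noteq> []" "xs ! i = tl (xs ! j)" using that by (auto simp: E_def)
      thus False using mx[OF that(1)] by (cases "xs ! j") auto
    qed
    define j where "j = Suc i mod n"
    define k where "k = (if i = 0 then n - 1 else i - 1)"
    have jk: "j < n" "k < n" "Suc k mod n = i" "j \<noteq> k"
      using n i by (auto simp: j_def k_def mod_Suc)
    have "(xs ! i, xs ! j) \<in> E" using edge[OF i] by (simp add: j_def)
    moreover have "(xs ! i, xs ! k) \<in> E" using edge[OF jk(2)] jk(3) symE by (auto dest: symD)
    ultimately have "xs ! j = xs ! k" using down jk by metis
    thus False using dist jk by (simp add: nth_eq_iff_index_eq n_def)
  qed
  have deg: "finite (E `` {w}) \<and> card (E `` {w}) = d" if w: "w \<in> V" for w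
  proof (cases w)
    case Nil
    have "E `` {w} = (\<lambda>a. [a]) ` {..<d}"
      using Nil w by (auto simp: E_def V_def neq_Nil_conv tl_Nil)
    thus ?thesis by (simp add: card_image inj_on_def)
  next
    case (Cons b u)
    have b: "b < d" using w Cons by (simp add: V_def)
    have "E `` {w} = insert u ((\<lambda>a. a # w) ` ({..<d} - {b}))"
      using Cons w tlV[OF w] by (auto simp: E_def V_def neq_Nil_conv distinct_adj_Cons)
    moreover have "u \<notin> (\<lambda>a. a # w) ` ({..<d} - {b})" using Cons by auto
    moreover have "card ((\<lambda>a. a # w) ` ({..<d} - {b})) = d - 1"
      using b by (simp add: card_image inj_on_def)
    ultimately show ?thesis using b by simp
  qed
  have "[] \<in> V" by (simp add: V_def)
  hence "regular_tree d V E"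
    using simple conn acyc deg unfolding regular_tree_def tree_def by blast
  thus ?thesis by blast
qed

text \<open>Permutations of \<open>V\<close> preserving all but finitely many adjacency and nonadjacency relations.\<close>

definition almost_auts :: "'v set \<Rightarrow> 'v rel \<Rightarrow> ('v \<Rightarrow> 'v) set" where
  "almost_auts V E =
     {f \<in> Bij V. finite {(x, y). x \<in> V \<and> y \<in> V \<and> ((x, y) \<in> E) \<noteq> ((f x, f y) \<in> E)}}"

definition almost_aut_group :: "'v set \<Rightarrow> 'v rel \<Rightarrow> ('v \<Rightarrow> 'v) monoid" where
  "almost_aut_group V E = (BijGroup V)\<lparr>carrier := almost_auts V E\<rparr>"

definition finitary_auts :: "'v set \<Rightarrow> 'v rel \<Rightarrow> ('v \<Rightarrow> 'v) set" where
  "finitary_auts V E = {f \<in> almost_auts V E. finite {x \<in> V. f x \<noteq> x}}"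

text \<open>The group of spheromorphisms. Its elements are the classes of almost automorphisms modulo
  changes on a finite set of vertices, see \<open>spheromorphism_eq_iff\<close> below.\<close>

definition AAut :: "'v set \<Rightarrow> 'v rel \<Rightarrow> ('v \<Rightarrow> 'v) set monoid" where
  "AAut V E = almost_aut_group V E Mod finitary_auts V E"

lemma Bij_memD: "f \<in> Bij V \<Longrightarrow> x \<in> V \<Longrightarrow> f x \<in> V"
  by (auto dest: Bij_imp_funcset)

lemma Bij_inj_on: "f \<in> Bij V \<Longrightarrow> inj_on f V"
  by (simp add: Bij_def bij_betw_def)

lemma almost_auts_compose:
  assumes "f \<in> almost_auts V E" "g \<in> almost_auts V E"
  shows "compose V f g \<in> almost_auts V E"
proof -
  let ?bad = "\<lambda>f. {(x, y). x \<in> V \<and> y \<in> V \<and> ((x, y) \<in> E) \<noteq> ((f x, f y) \<in> E)}"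
  have fB: "f \<in> Bij V" and gB: "g \<in> Bij V" and fin: "finite (?bad f)" "finite (?bad g)"
    using assms by (auto simp: almost_auts_def)
  have "inj_on (map_prod g g) (V \<times> V)"
    using Bij_inj_on[OF gB] by (auto simp: inj_on_def)
  hence "finite (map_prod g g -` ?bad f \<inter> V \<times> V)"
    by (intro finite_vimage_IntI fin(1))
  moreover have "?bad (compose V f g) \<subseteq> ?bad g \<union> (map_prod g g -` ?bad f \<inter> V \<times> V)"
    by (auto simp: compose_def Bij_memD[OF gB])
  ultimately have "finite (?bad (compose V f g))"
    using fin(2) by (meson finite_UnI finite_subset)
  thus ?thesis using compose_Bij[OF fB gB] by (simp add: almost_auts_def)
qed

lemma almost_auts_inv:
  assumes "f \<in> almost_auts V E"
  shows "restrict (inv_into V f) V \<in> almost_auts V E"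
proof -
  let ?bad = "\<lambda>f. {(x, y). x \<in> V \<and> y \<in> V \<and> ((x, y) \<in> E) \<noteq> ((f x, f y) \<in> E)}"
  have fB: "f \<in> Bij V" and fin: "finite (?bad f)"
    using assms by (auto simp: almost_auts_def)
  have im: "f ` V = V" using fB by (simp add: Bij_def bij_betw_def)
  have "?bad (restrict (inv_into V f) V) \<subseteq> map_prod f f ` ?bad f"
  proof (clarify)
    fix x y
    assume a: "x \<in> V" "y \<in> V" "((x, y) \<in> E) \<noteq>
      ((restrict (inv_into V f) V x, restrict (inv_into V f) V y) \<in> E)"
    have "inv_into V f x \<in> V" "inv_into V f y \<in> V" "f (inv_into V f x) = x" "f (inv_into V f y) = y"
      using a im by (auto simp: inv_into_into f_inv_into_f)
    moreover from this a have "(inv_into V f x, inv_into V f y) \<in> ?bad f" by auto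
    ultimately show "(x, y) \<in> map_prod f f ` ?bad f"
      by (metis (no_types, lifting) map_prod_imageI)
  qed
  hence "finite (?bad (restrict (inv_into V f) V))"
    using fin by (meson finite_imageI finite_subset)
  thus ?thesis using restrict_inv_into_Bij[OF fB] by (simp add: almost_auts_def)
qed

lemma subgroup_almost_auts: "subgroup (almost_auts V E) (BijGroup V)"
proof (rule group.subgroupI[OF group_BijGroup])
  show "almost_auts V E \<subseteq> carrier (BijGroup V)"
    by (auto simp: almost_auts_def BijGroup_def)
  have "(\<lambda>x\<in>V. x) \<in> almost_auts V E"
    by (auto simp: almost_auts_def id_Bij cong: conj_cong)
  thus "almost_auts V E \<noteq> {}" by auto
next
  fix f assume f: "f \<in> almost_auts V E"
  hence "f \<in> Bij V" by (simp add: almost_auts_def)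
  thus "inv\<^bsub>BijGroup V\<^esub> f \<in> almost_auts V E"
    using almost_auts_inv[OF f] by (simp add: inv_BijGroup)
next
  fix f g assume fg: "f \<in> almost_auts V E" "g \<in> almost_auts V E"
  thus "f \<otimes>\<^bsub>BijGroup V\<^esub> g \<in> almost_auts V E"
    using almost_auts_compose[OF fg] by (simp add: BijGroup_def almost_auts_def)
qed

lemma group_almost_aut_group: "group (almost_aut_group V E)"
  unfolding almost_aut_group_def
  by (rule subgroup.subgroup_is_group[OF subgroup_almost_auts group_BijGroup])

lemma almost_aut_group_simps:
  "carrier (almost_aut_group V E) = almost_auts V E"
  "f \<in> almost_auts V E \<Longrightarrow> g \<in> almost_auts V E \<Longrightarrow> f \<otimes>\<^bsub>almost_aut_group V E\<^esub> g = compose V f g"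
  "f \<in> almost_auts V E \<Longrightarrow> inv\<^bsub>almost_aut_group V E\<^esub> f = restrict (inv_into V f) V"
  "\<one>\<^bsub>almost_aut_group V E\<^esub> = (\<lambda>x\<in>V. x)"
proof -
  assume f: "f \<in> almost_auts V E"
  have "f \<in> Bij V" using f by (simp add: almost_auts_def)
  thus "inv\<^bsub>almost_aut_group V E\<^esub> f = restrict (inv_into V f) V"
    unfolding almost_aut_group_def
    using group.m_inv_consistent[OF group_BijGroup subgroup_almost_auts f]
    by (simp add: inv_BijGroup)
qed (auto simp: almost_aut_group_def BijGroup_def almost_auts_def)

lemma finitary_div_iff:
  assumes "f \<in> almost_auts V E" "g \<in> almost_auts V E"
  shows "f \<otimes>\<^bsub>almost_aut_group V E\<^esub> inv\<^bsub>almost_aut_group V E\<^esub> g \<in> finitary_auts V E \<longleftrightarrow>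
    finite {x \<in> V. f x \<noteq> g x}"
proof -
  let ?h = "compose V f (restrict (inv_into V g) V)"
  have gB: "g \<in> Bij V" using assms by (auto simp: almost_auts_def)
  have inj: "inj_on g V" by (rule Bij_inj_on[OF gB])
  have im: "g ` V = V" using gB by (simp add: Bij_def bij_betw_def)
  have h: "?h \<in> almost_auts V E"
    by (intro almost_auts_compose almost_auts_inv assms)
  have "?h (g x) = f x" if "x \<in> V" for x
    using that inj Bij_memD[OF gB that] by (simp add: compose_def)
  note h_g = this
  have "{x \<in> V. ?h x \<noteq> x} = g ` {x \<in> V. f x \<noteq> g x}"
  proof (intro Set.set_eqI iffI)
    fix y assume y: "y \<in> {x \<in> V. ?h x \<noteq> x}"
    then obtain x where x: "x \<in> V" "y = g x" using im by blast
    thus "y \<in> g ` {x \<in> V. f x \<noteq> g x}" using h_g[OF x(1)] y by simp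
  next
    fix y assume "y \<in> g ` {x \<in> V. f x \<noteq> g x}"
    then obtain x where x: "x \<in> V" "f x \<noteq> g x" "y = g x" by blast
    thus "y \<in> {x \<in> V. ?h x \<noteq> x}" using h_g[OF x(1)] Bij_memD[OF gB x(1)] by simp
  qed
  moreover have "inj_on g {x \<in> V. f x \<noteq> g x}"
    using inj by (rule inj_on_subset) auto
  ultimately have "finite {x \<in> V. ?h x \<noteq> x} \<longleftrightarrow> finite {x \<in> V. f x \<noteq> g x}"
    by (simp add: finite_image_iff)
  thus ?thesis
    using h assms by (simp add: almost_aut_group_simps almost_auts_inv finitary_auts_def)
qed

lemma normal_finitary_auts: "finitary_auts V E \<lhd> almost_aut_group V E"
proof -
  let ?P = "almost_aut_group V E"
  interpret P: group ?P by (rule group_almost_aut_group)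
  note s = almost_aut_group_simps
  have sub: "finitary_auts V E \<subseteq> almost_auts V E" by (auto simp: finitary_auts_def)
  have one: "(\<lambda>x\<in>V. x) \<in> almost_auts V E" using P.one_closed by (simp add: s)
  have "subgroup (finitary_auts V E) ?P"
  proof (rule P.subgroupI)
    show "finitary_auts V E \<subseteq> carrier ?P" using sub by (simp add: s)
    show "finitary_auts V E \<noteq> {}"
      using one by (auto simp: finitary_auts_def cong: conj_cong)
  next
    fix f assume f: "f \<in> finitary_auts V E"
    hence fa: "f \<in> almost_auts V E" using sub by auto
    have "finite {x \<in> V. (\<lambda>x\<in>V. x) x \<noteq> f x}"
      using f by (simp add: finitary_auts_def eq_commute cong: conj_cong)
    hence "\<one>\<^bsub>?P\<^esub> \<otimes>\<^bsub>?P\<^esub> inv\<^bsub>?P\<^esub> f \<in> finitary_auts V E"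
      using finitary_div_iff[OF one fa] by (simp add: s(4))
    thus "inv\<^bsub>?P\<^esub> f \<in> finitary_auts V E"
      using P.l_one[OF P.inv_closed] fa by (simp only: s(1))
  next
    fix f g assume f: "f \<in> finitary_auts V E" and g: "g \<in> finitary_auts V E"
    have fa: "f \<in> almost_auts V E" and ga: "g \<in> almost_auts V E" using f g sub by auto
    have "{x \<in> V. compose V f g x \<noteq> x} \<subseteq> {x \<in> V. f x \<noteq> x} \<union> {x \<in> V. g x \<noteq> x}"
      by (auto simp: compose_def)
    hence "finite {x \<in> V. compose V f g x \<noteq> x}"
      using f g by (auto simp: finitary_auts_def intro: finite_subset)
    thus "f \<otimes>\<^bsub>?P\<^esub> g \<in> finitary_auts V E"
      using fa ga almost_auts_compose[OF fa ga] by (simp add: s finitary_auts_def)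
  qed
  moreover have "p \<otimes>\<^bsub>?P\<^esub> f \<otimes>\<^bsub>?P\<^esub> inv\<^bsub>?P\<^esub> p \<in> finitary_auts V E"
    if p: "p \<in> carrier ?P" and f: "f \<in> finitary_auts V E" for p f
  proof -
    have pa: "p \<in> almost_auts V E" and fa: "f \<in> almost_auts V E" using p f sub by (auto simp: s)
    have "{x \<in> V. compose V p f x \<noteq> p x} \<subseteq> {x \<in> V. f x \<noteq> x}"
      by (auto simp: compose_def)
    hence "finite {x \<in> V. compose V p f x \<noteq> p x}"
      using f by (auto simp: finitary_auts_def intro: finite_subset)
    thus ?thesis
      using finitary_div_iff[OF almost_auts_compose[OF pa fa] pa] pa fa by (simp add: s)
  qed
  ultimately show ?thesis by (simp add: P.normal_inv_iff)
qed

lemma group_AAut: "group (AAut V E)"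
  unfolding AAut_def by (rule normal.factorgroup_is_group[OF normal_finitary_auts])

lemma spheromorphism_eq_iff:
  assumes "f \<in> almost_auts V E" "g \<in> almost_auts V E"
  shows "finitary_auts V E #>\<^bsub>almost_aut_group V E\<^esub> f = finitary_auts V E #>\<^bsub>almost_aut_group V E\<^esub> g
    \<longleftrightarrow> finite {x \<in> V. f x \<noteq> g x}"
proof -
  let ?P = "almost_aut_group V E" and ?F = "finitary_auts V E"
  interpret P: group ?P by (rule group_almost_aut_group)
  interpret N: normal ?F ?P by (rule normal_finitary_auts)
  have c: "f \<in> carrier ?P" "g \<in> carrier ?P" using assms by (simp_all add: almost_aut_group_simps)
  have "?F #>\<^bsub>?P\<^esub> f = ?F #>\<^bsub>?P\<^esub> g \<longleftrightarrow> f \<otimes>\<^bsub>?P\<^esub> inv\<^bsub>?P\<^esub> g \<in> ?F"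
  proof
    assume "?F #>\<^bsub>?P\<^esub> f = ?F #>\<^bsub>?P\<^esub> g"
    hence "f \<in> ?F #>\<^bsub>?P\<^esub> g" using P.rcos_self[OF c(1) N.is_subgroup] by simp
    thus "f \<otimes>\<^bsub>?P\<^esub> inv\<^bsub>?P\<^esub> g \<in> ?F" using N.rcos_module[OF P.is_group c(2) c(1)] by simp
  next
    assume "f \<otimes>\<^bsub>?P\<^esub> inv\<^bsub>?P\<^esub> g \<in> ?F"
    hence "f \<in> ?F #>\<^bsub>?P\<^esub> g" using N.rcos_module[OF P.is_group c(2) c(1)] by simp
    thus "?F #>\<^bsub>?P\<^esub> f = ?F #>\<^bsub>?P\<^esub> g"
      using P.repr_independence[OF _ c(2) N.is_subgroup] by simp
  qed
  thus ?thesis using finitary_div_iff[OF assms] by simp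
qed


section \<open>Jonsson--Tarski algebras and the Higman--Thompson group\<close>

text \<open>The \<open>q\<close>-ary operation takes lists of length \<open>q\<close>; the unary operations are indexed by
  \<open>{..<q}\<close> instead of \<open>{1..q}\<close>.\<close>

record 'a jt_algebra =
  jt_carrier :: "'a set"
  jt_lam :: "'a list \<Rightarrow> 'a"
  jt_alp :: "nat \<Rightarrow> 'a \<Rightarrow> 'a"

definition jt_variety :: "nat \<Rightarrow> 'a jt_algebra \<Rightarrow> bool" where
  "jt_variety q A \<longleftrightarrow>
     (\<forall>xs. length xs = q \<and> set xs \<subseteq> jt_carrier A \<longrightarrow> jt_lam A xs \<in> jt_carrier A) \<and>
     (\<forall>i<q. \<forall>x \<in> jt_carrier A. jt_alp A i x \<in> jt_carrier A) \<and>
     (\<forall>xs. length xs = q \<and> set xs \<subseteq> jt_carrier A \<longrightarrow>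
        (\<forall>i<q. jt_alp A i (jt_lam A xs) = xs ! i)) \<and>
     (\<forall>x \<in> jt_carrier A. jt_lam A (map (\<lambda>i. jt_alp A i x) [0..<q]) = x)"

definition jt_hom :: "nat \<Rightarrow> 'a jt_algebra \<Rightarrow> 'b jt_algebra \<Rightarrow> ('a \<Rightarrow> 'b) set" where
  "jt_hom q A B = {h \<in> jt_carrier A \<rightarrow> jt_carrier B.
     (\<forall>xs. length xs = q \<and> set xs \<subseteq> jt_carrier A \<longrightarrow> h (jt_lam A xs) = jt_lam B (map h xs)) \<and>
     (\<forall>i<q. \<forall>x \<in> jt_carrier A. h (jt_alp A i x) = jt_alp B i (h x))}"

definition jt_auto_group :: "nat \<Rightarrow> 'a jt_algebra \<Rightarrow> ('a \<Rightarrow> 'a) monoid" where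
  "jt_auto_group q A =
     (BijGroup (jt_carrier A))\<lparr>carrier := jt_hom q A A \<inter> Bij (jt_carrier A)\<rparr>"

text \<open>The free algebra is constructed as the algebra of terms in the generators
  \<open>Gen 0, \<dots>, Gen (r - 1)\<close> modulo the congruence generated by the defining identities of the variety.
  It belongs to the variety and has the universal property, see \<open>jt_variety_jt_free\<close> and
  \<open>jt_free_universal\<close> below.\<close>

datatype jt_term = Gen nat | Lam "jt_term list" | Alp nat jt_term

inductive_set jt_terms :: "nat \<Rightarrow> nat \<Rightarrow> jt_term set" for q r where
  Gen: "i < r \<Longrightarrow> Gen i \<in> jt_terms q r"
| Lam: "length ts = q \<Longrightarrow> (\<And>t. t \<in> set ts \<Longrightarrow> t \<in> jt_terms q r) \<Longrightarrow> Lam ts \<in> jt_terms q r"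
| Alp: "i < q \<Longrightarrow> t \<in> jt_terms q r \<Longrightarrow> Alp i t \<in> jt_terms q r"

inductive jt_eq :: "nat \<Rightarrow> nat \<Rightarrow> jt_term \<Rightarrow> jt_term \<Rightarrow> bool" for q r where
  refl: "t \<in> jt_terms q r \<Longrightarrow> jt_eq q r t t"
| sym: "jt_eq q r s t \<Longrightarrow> jt_eq q r t s"
| trans: "jt_eq q r s t \<Longrightarrow> jt_eq q r t u \<Longrightarrow> jt_eq q r s u"
| Lam: "length ss = q \<Longrightarrow> length ts = q \<Longrightarrow> (\<And>i. i < q \<Longrightarrow> jt_eq q r (ss ! i) (ts ! i)) \<Longrightarrow>
    jt_eq q r (Lam ss) (Lam ts)"
| Alp: "i < q \<Longrightarrow> jt_eq q r s t \<Longrightarrow> jt_eq q r (Alp i s) (Alp i t)"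
| Alp_Lam: "length ts = q \<Longrightarrow> set ts \<subseteq> jt_terms q r \<Longrightarrow> i < q \<Longrightarrow>
    jt_eq q r (Alp i (Lam ts)) (ts ! i)"
| Lam_Alp: "t \<in> jt_terms q r \<Longrightarrow> jt_eq q r (Lam (map (\<lambda>i. Alp i t) [0..<q])) t"

definition jt_rel :: "nat \<Rightarrow> nat \<Rightarrow> jt_term rel" where
  "jt_rel q r = {(s, t). jt_eq q r s t}"

definition jt_free :: "nat \<Rightarrow> nat \<Rightarrow> jt_term set jt_algebra" where
  "jt_free q r = \<lparr>jt_carrier = jt_terms q r // jt_rel q r,
     jt_lam = (\<lambda>Cs. \<Union>ts \<in> listset Cs. jt_rel q r `` {Lam ts}),
     jt_alp = (\<lambda>i C. \<Union>t \<in> C. jt_rel q r `` {Alp i t})\<rparr>"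

abbreviation jt_class :: "nat \<Rightarrow> nat \<Rightarrow> jt_term \<Rightarrow> jt_term set" where
  "jt_class q r t \<equiv> jt_rel q r `` {t}"

lemma jt_eq_terms: "jt_eq q r s t \<Longrightarrow> s \<in> jt_terms q r \<and> t \<in> jt_terms q r"
proof (induction rule: jt_eq.induct)
  case (Lam ss ts)
  thus ?case by (auto intro!: jt_terms.Lam simp: in_set_conv_nth)
next
  case (Alp_Lam ts i)
  thus ?case by (auto intro!: jt_terms.intros)
next
  case (Lam_Alp t)
  thus ?case by (auto intro!: jt_terms.intros)
qed (auto intro: jt_terms.intros)

lemma equiv_jt_rel: "equiv (jt_terms q r) (jt_rel q r)"
proof (rule equivI)
  show "jt_rel q r \<subseteq> jt_terms q r \<times> jt_terms q r"
    by (auto simp: jt_rel_def dest: jt_eq_terms)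
  show "refl_on (jt_terms q r) (jt_rel q r)"
    by (auto simp: jt_rel_def refl_on_def intro: jt_eq.refl)
  show "Relation.sym (jt_rel q r)"
    by (auto simp: jt_rel_def intro!: symI intro: jt_eq.sym)
  show "Relation.trans (jt_rel q r)"
    by (auto simp: jt_rel_def intro!: transI intro: jt_eq.trans)
qed

lemma jt_class_eq_iff:
  "s \<in> jt_terms q r \<Longrightarrow> t \<in> jt_terms q r \<Longrightarrow> jt_class q r s = jt_class q r t \<longleftrightarrow> jt_eq q r s t"
  using eq_equiv_class_iff[OF equiv_jt_rel] by (simp add: jt_rel_def)

lemma jt_class_eqI: "jt_eq q r s t \<Longrightarrow> jt_class q r s = jt_class q r t"
  using equiv_class_eq[OF equiv_jt_rel] by (simp add: jt_rel_def)

lemma mem_listset_iff: "xs \<in> listset As \<longleftrightarrow> list_all2 (\<in>) xs As"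
  by (induction As arbitrary: xs) (auto simp: set_Cons_def list_all2_Cons2)

lemma jt_free_carrier: "jt_carrier (jt_free q r) = jt_class q r ` jt_terms q r"
  by (auto simp: jt_free_def quotient_def)

lemma jt_free_lam:
  assumes "length ts = q" "set ts \<subseteq> jt_terms q r"
  shows "jt_lam (jt_free q r) (map (jt_class q r) ts) = jt_class q r (Lam ts)"
proof -
  have lt: "Lam ts \<in> jt_terms q r" using assms by (auto intro: jt_terms.Lam)
  have eq: "jt_class q r (Lam us) = jt_class q r (Lam ts)"
    if "us \<in> listset (map (jt_class q r) ts)" for us
  proof -
    have l: "length us = q" and e: "\<And>i. i < q \<Longrightarrow> jt_eq q r (ts ! i) (us ! i)"
      using that assms by (auto simp: mem_listset_iff list_all2_conv_all_nth jt_rel_def)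
    show ?thesis using jt_class_eqI[OF jt_eq.Lam[OF assms(1) l e]] by (rule HOL.sym)
  qed
  have "ts \<in> listset (map (jt_class q r) ts)"
    using assms
    by (auto simp: mem_listset_iff list_all2_conv_all_nth jt_rel_def subset_iff intro!: jt_eq.refl)
  thus ?thesis
    unfolding jt_free_def jt_algebra.select_convs by (rule UN_constant_eq) (intro ballI eq)
qed

lemma jt_free_alp:
  assumes "i < q" "t \<in> jt_terms q r"
  shows "jt_alp (jt_free q r) i (jt_class q r t) = jt_class q r (Alp i t)"
proof -
  have eq: "jt_class q r (Alp i u) = jt_class q r (Alp i t)" if "u \<in> jt_class q r t" for u
  proof -
    have tu: "jt_eq q r t u" using that by (simp add: jt_rel_def)
    show ?thesis using jt_class_eqI[OF jt_eq.Alp[OF assms(1) tu]] by (rule HOL.sym)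
  qed
  have "t \<in> jt_class q r t" using assms(2) by (simp add: jt_rel_def jt_eq.refl)
  thus ?thesis
    unfolding jt_free_def jt_algebra.select_convs by (rule UN_constant_eq) (intro ballI eq)
qed

lemma jt_free_list:
  assumes "set xs \<subseteq> jt_carrier (jt_free q r)"
  obtains ts where "xs = map (jt_class q r) ts" "set ts \<subseteq> jt_terms q r"
proof -
  have "\<exists>ts. xs = map (jt_class q r) ts \<and> set ts \<subseteq> jt_terms q r"
    using assms
  proof (induction xs)
    case (Cons x xs)
    then obtain ts t where "xs = map (jt_class q r) ts" "set ts \<subseteq> jt_terms q r"
      "x = jt_class q r t" "t \<in> jt_terms q r"
      by (auto simp: jt_free_carrier)
    thus ?case by (intro exI[of _ "t # ts"]) auto
  qed auto
  thus ?thesis using that by blast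
qed

lemma jt_variety_jt_free: "jt_variety q (jt_free q r)"
  unfolding jt_variety_def
proof (intro conjI allI impI ballI; (elim conjE)?)
  fix xs assume xs: "length xs = q" "set xs \<subseteq> jt_carrier (jt_free q r)"
  obtain ts where ts: "xs = map (jt_class q r) ts" "set ts \<subseteq> jt_terms q r"
    using jt_free_list[OF xs(2)] .
  have l: "length ts = q" using xs(1) ts(1) by simp
  have L: "Lam ts \<in> jt_terms q r" using l ts(2) by (auto intro: jt_terms.Lam)
  show "jt_lam (jt_free q r) xs \<in> jt_carrier (jt_free q r)"
    using L by (simp only: ts(1) jt_free_lam[OF l ts(2)] jt_free_carrier) blast
  fix i assume i: "i < q"
  have "jt_class q r (Alp i (Lam ts)) = jt_class q r (ts ! i)"
    by (rule jt_class_eqI[OF jt_eq.Alp_Lam[OF l ts(2) i]])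
  thus "jt_alp (jt_free q r) i (jt_lam (jt_free q r) xs) = xs ! i"
    using i l by (simp only: ts(1) jt_free_lam[OF l ts(2)] jt_free_alp[OF i L] nth_map)
next
  fix i x assume "i < q" "x \<in> jt_carrier (jt_free q r)"
  thus "jt_alp (jt_free q r) i x \<in> jt_carrier (jt_free q r)"
    by (auto simp only: jt_free_carrier jt_free_alp intro!: imageI jt_terms.Alp)
next
  fix x assume "x \<in> jt_carrier (jt_free q r)"
  then obtain t where t: "t \<in> jt_terms q r" "x = jt_class q r t"
    by (auto simp: jt_free_carrier)
  let ?ts = "map (\<lambda>i. Alp i t) [0..<q]"
  have l: "length ?ts = q" and ts: "set ?ts \<subseteq> jt_terms q r"
    using t(1) by (auto intro: jt_terms.Alp)
  have "map (\<lambda>i. jt_alp (jt_free q r) i x) [0..<q] = map (jt_class q r) ?ts"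
    using t by (simp add: jt_free_alp)
  hence "jt_lam (jt_free q r) (map (\<lambda>i. jt_alp (jt_free q r) i x) [0..<q]) = jt_class q r (Lam ?ts)"
    using jt_free_lam[OF l ts] by (simp only:)
  also have "\<dots> = x"
    using jt_class_eqI[OF jt_eq.Lam_Alp[OF t(1)]] t(2) by simp
  finally show "jt_lam (jt_free q r) (map (\<lambda>i. jt_alp (jt_free q r) i x) [0..<q]) = x" .
qed

primrec jt_eval :: "'a jt_algebra \<Rightarrow> (nat \<Rightarrow> 'a) \<Rightarrow> jt_term \<Rightarrow> 'a" where
  "jt_eval B g (Gen i) = g i"
| "jt_eval B g (Lam ts) = jt_lam B (map (jt_eval B g) ts)"
| "jt_eval B g (Alp i t) = jt_alp B i (jt_eval B g t)"

lemma jt_varietyD: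
  assumes "jt_variety q A"
  shows "length xs = q \<Longrightarrow> set xs \<subseteq> jt_carrier A \<Longrightarrow> jt_lam A xs \<in> jt_carrier A"
    "i < q \<Longrightarrow> x \<in> jt_carrier A \<Longrightarrow> jt_alp A i x \<in> jt_carrier A"
    "length xs = q \<Longrightarrow> set xs \<subseteq> jt_carrier A \<Longrightarrow> i < q \<Longrightarrow> jt_alp A i (jt_lam A xs) = xs ! i"
    "x \<in> jt_carrier A \<Longrightarrow> jt_lam A (map (\<lambda>i. jt_alp A i x) [0..<q]) = x"
  using assms unfolding jt_variety_def by blast+

lemma jt_eval_closed:
  assumes B: "jt_variety q B" and g: "\<And>i. i < r \<Longrightarrow> g i \<in> jt_carrier B" and "t \<in> jt_terms q r"
  shows "jt_eval B g t \<in> jt_carrier B"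
  using assms(3)
proof (induction rule: jt_terms.induct)
  case (Gen i)
  thus ?case by (simp add: g)
next
  case (Lam ts)
  have "length (map (jt_eval B g) ts) = q" "set (map (jt_eval B g) ts) \<subseteq> jt_carrier B"
    using Lam.hyps(1) Lam.IH by auto
  thus ?case unfolding jt_eval.simps by (rule jt_varietyD(1)[OF B])
next
  case (Alp i t)
  show ?case unfolding jt_eval.simps by (rule jt_varietyD(2)[OF B Alp.hyps(1) Alp.IH])
qed

lemma jt_eval_eq:
  assumes B: "jt_variety q B" and g: "\<And>i. i < r \<Longrightarrow> g i \<in> jt_carrier B" and "jt_eq q r s t"
  shows "jt_eval B g s = jt_eval B g t"
  using assms(3)
proof (induction rule: jt_eq.induct)
  case (Lam ss ts)
  have "map (jt_eval B g) ss = map (jt_eval B g) ts"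
    using Lam.hyps(1,2) Lam.IH by (intro nth_equalityI) simp_all
  thus ?case by (simp only: jt_eval.simps)
next
  case (Alp_Lam ts i)
  have "length (map (jt_eval B g) ts) = q" "set (map (jt_eval B g) ts) \<subseteq> jt_carrier B"
    using Alp_Lam.hyps(1,2) jt_eval_closed[OF B g] by auto
  from jt_varietyD(3)[OF B this Alp_Lam.hyps(3)] show ?case
    using Alp_Lam.hyps(1,3) by (simp only: jt_eval.simps nth_map)
next
  case (Lam_Alp t)
  have "map (jt_eval B g) (map (\<lambda>i. Alp i t) [0..<q]) = map (\<lambda>i. jt_alp B i (jt_eval B g t)) [0..<q]"
    by simp
  with jt_varietyD(4)[OF B jt_eval_closed[OF B g Lam_Alp]] show ?case
    by (simp only: jt_eval.simps)
qed simp_all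

theorem jt_free_universal:
  assumes B: "jt_variety q B" and g: "\<And>i. i < r \<Longrightarrow> g i \<in> jt_carrier B"
  shows "\<exists>h \<in> jt_hom q (jt_free q r) B. (\<forall>i<r. h (jt_class q r (Gen i)) = g i) \<and>
    (\<forall>h' \<in> jt_hom q (jt_free q r) B. (\<forall>i<r. h' (jt_class q r (Gen i)) = g i) \<longrightarrow>
       (\<forall>x \<in> jt_carrier (jt_free q r). h' x = h x))"
proof -
  let ?A = "jt_free q r"
  define h where "h C = jt_eval B g (SOME t. t \<in> C)" for C
  have h: "h (jt_class q r t) = jt_eval B g t" if "t \<in> jt_terms q r" for t
  proof -
    have "t \<in> jt_class q r t" using that by (simp add: jt_rel_def jt_eq.refl)
    hence "(SOME u. u \<in> jt_class q r t) \<in> jt_class q r t" by (rule someI)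
    hence "jt_eq q r t (SOME u. u \<in> jt_class q r t)" by (simp add: jt_rel_def)
    from jt_eval_eq[OF B g this] show ?thesis by (simp add: h_def)
  qed
  have "h \<in> jt_hom q ?A B"
    unfolding jt_hom_def
  proof (intro CollectI conjI allI impI ballI; (elim conjE)?)
    show "h \<in> jt_carrier ?A \<rightarrow> jt_carrier B"
      using h jt_eval_closed[OF B g] by (auto simp: jt_free_carrier)
  next
    fix xs assume xs: "length xs = q" "set xs \<subseteq> jt_carrier ?A"
    obtain ts where ts: "xs = map (jt_class q r) ts" "set ts \<subseteq> jt_terms q r"
      using jt_free_list[OF xs(2)] .
    have l: "length ts = q" using xs(1) ts(1) by simp
    have L: "Lam ts \<in> jt_terms q r" using l ts(2) by (auto intro: jt_terms.Lam)
    have "map h xs = map (jt_eval B g) ts" using ts h by (auto simp: subset_iff)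
    moreover have "h (jt_lam ?A xs) = jt_lam B (map (jt_eval B g) ts)"
      using h[OF L] by (simp only: jt_free_lam[OF l ts(2)] ts(1) jt_eval.simps)
    ultimately show "h (jt_lam ?A xs) = jt_lam B (map h xs)" by (simp only:)
  next
    fix i x assume i: "i < q" and "x \<in> jt_carrier ?A"
    then obtain t where t: "t \<in> jt_terms q r" "x = jt_class q r t"
      by (auto simp: jt_free_carrier)
    thus "h (jt_alp ?A i x) = jt_alp B i (h x)"
      using h[OF t(1)] h[OF jt_terms.Alp[OF i t(1)]] jt_free_alp[OF i t(1)] by simp
  qed
  moreover have "\<forall>i<r. h (jt_class q r (Gen i)) = g i"
    using h jt_terms.Gen by simp
  moreover have "\<forall>x \<in> jt_carrier ?A. h' x = h x"
    if h': "h' \<in> jt_hom q ?A B" and gen: "\<forall>i<r. h' (jt_class q r (Gen i)) = g i" for h'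
  proof -
    have "h' (jt_class q r t) = jt_eval B g t" if "t \<in> jt_terms q r" for t
      using that
    proof (induction rule: jt_terms.induct)
      case (Gen i)
      thus ?case using gen by simp
    next
      case (Lam ts)
      have ts: "set ts \<subseteq> jt_terms q r" using Lam by auto
      let ?xs = "map (jt_class q r) ts"
      have "length ?xs = q" "set ?xs \<subseteq> jt_carrier ?A"
        using Lam(1) ts by (auto simp: jt_free_carrier)
      hence "h' (jt_lam ?A ?xs) = jt_lam B (map h' ?xs)"
        using h' unfolding jt_hom_def by blast
      moreover have "map h' ?xs = map (jt_eval B g) ts" using Lam.IH by simp
      ultimately show ?case by (simp only: jt_free_lam[OF Lam(1) ts] jt_eval.simps)
    next
      case (Alp i t)
      have "jt_class q r t \<in> jt_carrier ?A" using Alp by (auto simp: jt_free_carrier)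
      hence "h' (jt_alp ?A i (jt_class q r t)) = jt_alp B i (h' (jt_class q r t))"
        using h' Alp(1) unfolding jt_hom_def by blast
      thus ?case using jt_free_alp[OF Alp(1,2)] Alp.IH by simp
    qed
    thus ?thesis using h by (auto simp: jt_free_carrier)
  qed
  ultimately show ?thesis by blast
qed

definition Higman_Thompson :: "nat \<Rightarrow> nat \<Rightarrow> (jt_term set \<Rightarrow> jt_term set) monoid" where
  "Higman_Thompson q r = jt_auto_group q (jt_free q r)"

end

theory Submission
  imports Defs "HOL-Library.Omega_Words_Fun"
begin

text \<open>
  Both groups act on a Cantor set \<open>\<Omega>\<close>, the boundary of a rooted tree in which the root has \<open>r\<close>
  children and every other vertex has \<open>q\<close>: they are the groups of all homeomorphisms which, on all
  sufficiently small cones, replace a prefix and twist the remaining tail by an element of a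
  self-similar group \<open>K\<close>. For the Higman--Thompson group \<open>K\<close> is trivial, for the Neretin group \<open>r\<close> is
  \<open>q + 1\<close> and \<open>K\<close> consists of all automorphisms of the rooted \<open>q\<close>-ary tree. Such a group \<open>G\<close> contains
  everything obtained by gluing pieces of its elements along clopen sets, and it can move any proper
  clopen set into any nonempty one.

  Let \<open>D\<close> be the commutator subgroup, \<open>f, h \<in> D\<close> nontrivial and \<open>U\<close> a small clopen set with
  \<open>h U \<inter> U = {}\<close>. Some \<open>D\<close>-conjugate \<open>e\<close> of \<open>h\<close> agrees with \<open>f\<close> on a clopen set, so \<open>f = e f'\<close>
  with \<open>f'\<close> supported on a proper clopen set. For a suitable \<open>D\<close>-conjugate \<open>h'\<close> of \<open>h\<close> the product
  \<open>t = h' h\<close> maps \<open>U\<close> into a proper subset, and \<open>f'\<close> can be conjugated to a product of commutators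
  of elements of \<open>D\<close> supported on a subset of \<open>U\<close> which is disjoint from \<open>t U\<close>. By the displacement
  trick of Burago and Ivanov the conjugate of \<open>f'\<close> is \<open>[\<phi>, t] [A, B]\<close> with \<open>A\<close>, \<open>B\<close> supported on \<open>U\<close>.
  Here \<open>[\<phi>, t]\<close> is a product of four conjugates of \<open>h\<close> and its inverse, and so is
  \<open>[A, B] = [[A, h], B]\<close>, whence \<open>1 + 4 + 4 = 9\<close>. For the commutator width take \<open>h = f\<close> and
  choose instead of \<open>e\<close> a commutator of elements of \<open>D\<close> which agrees with \<open>f\<close> on \<open>U\<close>, whence
  \<open>1 + 1 + 1 = 3\<close>.
\<close>

section \<open>Permutation groups with extremely proximal dynamics\<close>

text \<open>The element \<open>f'\<close> may need arbitrarily many commutators, and each of them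
  asks for its own translate of one set. The relation \<open>h U \<inter> U = {}\<close> alone gives
  a single translate. The map \<open>t\<close> gives infinitely many: if
  \<open>Z \<subseteq> U\<close> is disjoint from \<open>t U \<subseteq> U\<close>, then
  \<open>Z\<close>, \<open>t Z\<close>, \<open>t (t Z)\<close>, ... are pairwise disjoint.

  Two obstacles come before that. A factorisation of \<open>f'\<close> into commutators need not
  respect its support; it is pushed through a homomorphism of the whole group into the elements
  supported on a proper clopen set which fixes \<open>f'\<close>. Its factors then still lie only in
  \<open>G\<close>; they are moved into \<open>D\<close> by multiplying the entries of each
  commutator with displaced copies of their inverses.

  In the Neretin case a homeomorphism prescribes images only for the deep vertices of the tree,
  whereas an almost automorphism permutes all of them. The vertices left over on the two sides are
  equally many, because the number of leaves of a finite complete prefix code determines the number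
  of its inner nodes.\<close>

abbreviation pinv :: "('a \<Rightarrow> 'b) \<Rightarrow> 'b \<Rightarrow> 'a" where "pinv \<equiv> inv_into UNIV"

definition perm_conj :: "('x \<Rightarrow> 'x) \<Rightarrow> ('x \<Rightarrow> 'x) \<Rightarrow> 'x \<Rightarrow> 'x" where
  "perm_conj k f = k \<circ> f \<circ> pinv k"

definition perm_comm :: "('x \<Rightarrow> 'x) \<Rightarrow> ('x \<Rightarrow> 'x) \<Rightarrow> 'x \<Rightarrow> 'x" where
  "perm_comm a b = a \<circ> b \<circ> pinv a \<circ> pinv b"

definition supp_in :: "'x set \<Rightarrow> ('x \<Rightarrow> 'x) \<Rightarrow> bool" where
  "supp_in A f \<longleftrightarrow> (\<forall>x. x \<notin> A \<longrightarrow> f x = x)"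

text \<open>Inverses come for free, since the inverse of \<open>perm_comm a b\<close> is
  \<open>perm_comm b a\<close>. For a group \<open>H\<close> of permutations this is its derived
  subgroup.\<close>

inductive comm_prod :: "('x \<Rightarrow> 'x) set \<Rightarrow> ('x \<Rightarrow> 'x) \<Rightarrow> bool" for H where
  id: "comm_prod H id"
| step: "a \<in> H \<Longrightarrow> b \<in> H \<Longrightarrow> comm_prod H d \<Longrightarrow> comm_prod H (perm_comm a b \<circ> d)"

definition comm_prods :: "('x \<Rightarrow> 'x) set \<Rightarrow> ('x \<Rightarrow> 'x) set" where
  "comm_prods H = {f. comm_prod H f}"

section \<open>Calculus of conjugates, commutators and supports\<close>

lemma comm_prods_id: "id \<in> comm_prods H"
  by (simp add: comm_prods_def comm_prod.id)

lemma comm_prods_step: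
  "a \<in> H \<Longrightarrow> b \<in> H \<Longrightarrow> d \<in> comm_prods H \<Longrightarrow> perm_comm a b \<circ> d \<in> comm_prods H"
  by (simp add: comm_prods_def comm_prod.step)

lemma comm_prods_induct [consumes 1, case_names id step, induct set: comm_prods]:
  assumes "f \<in> comm_prods H" "P id"
    "\<And>a b d. a \<in> H \<Longrightarrow> b \<in> H \<Longrightarrow> d \<in> comm_prods H \<Longrightarrow> P d \<Longrightarrow> P (perm_comm a b \<circ> d)"
  shows "P f"
proof -
  have "comm_prod H f" using assms(1) by (simp add: comm_prods_def)
  thus ?thesis
  proof induction
    case (step a b d)
    thus ?case using assms(3)[of a b d] by (simp only: comm_prods_def mem_Collect_eq)
  qed (rule assms(2))
qed

lemma inv_apply: "bij f \<Longrightarrow> pinv f (f x) = x" "bij f \<Longrightarrow> f (pinv f x) = x"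
  by (simp_all add: bij_is_inj bij_is_surj surj_f_inv_f)

lemma inv_comp_apply: "bij f \<Longrightarrow> bij g \<Longrightarrow> pinv (\<lambda>x. f (g x)) y = pinv g (pinv f y)"
  using o_inv_distrib[of f g] by (simp add: o_def)

lemma bij_comp': "bij f \<Longrightarrow> bij g \<Longrightarrow> bij (\<lambda>x. f (g x))"
  using bij_comp[of g f] by (simp add: o_def)

lemmas perm_simps = fun_eq_iff perm_conj_def perm_comm_def inv_comp_apply inv_apply inv_inv_eq
  bij_comp' bij_imp_bij_inv o_inv_distrib bij_comp

lemma bij_perm_conj: "bij k \<Longrightarrow> bij f \<Longrightarrow> bij (perm_conj k f)"
  by (simp add: perm_conj_def bij_comp bij_imp_bij_inv)

lemma bij_perm_comm: "bij a \<Longrightarrow> bij b \<Longrightarrow> bij (perm_comm a b)"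
  by (simp add: perm_comm_def bij_comp bij_imp_bij_inv)

lemma perm_conj_comp: "bij k \<Longrightarrow> perm_conj k (f \<circ> g) = perm_conj k f \<circ> perm_conj k g"
  by (simp add: perm_simps)

lemma perm_conj_comm:
  "bij k \<Longrightarrow> bij a \<Longrightarrow> bij b \<Longrightarrow> perm_conj k (perm_comm a b) = perm_comm (perm_conj k a) (perm_conj k b)"
  by (simp add: perm_simps)

lemma perm_conj_conj: "bij k \<Longrightarrow> bij l \<Longrightarrow> perm_conj k (perm_conj l f) = perm_conj (k \<circ> l) f"
  by (simp add: perm_simps)

lemma supp_in_mono: "supp_in A f \<Longrightarrow> A \<subseteq> B \<Longrightarrow> supp_in B f"
  by (auto simp: supp_in_def)

lemma supp_in_id [simp]: "supp_in A id" by (simp add: supp_in_def)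

lemma supp_in_comp: "supp_in A f \<Longrightarrow> supp_in A g \<Longrightarrow> supp_in A (f \<circ> g)"
  by (auto simp: supp_in_def)

lemma supp_in_inv: "bij f \<Longrightarrow> supp_in A f \<Longrightarrow> supp_in A (pinv f)"
  unfolding supp_in_def by (metis inv_apply(1))

lemma supp_in_conj: "bij k \<Longrightarrow> supp_in A f \<Longrightarrow> supp_in (k ` A) (perm_conj k f)"
  unfolding supp_in_def perm_conj_def by (metis comp_apply image_eqI inv_apply(2))

lemma supp_in_comm: "bij a \<Longrightarrow> bij b \<Longrightarrow> supp_in A a \<Longrightarrow> supp_in A b \<Longrightarrow> supp_in A (perm_comm a b)"
  by (simp add: perm_comm_def supp_in_comp supp_in_inv)

lemma supp_in_apply: "bij f \<Longrightarrow> supp_in A f \<Longrightarrow> x \<in> A \<Longrightarrow> f x \<in> A"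
  unfolding supp_in_def by (metis inv_apply(1))

lemma supp_in_disjoint_commute:
  assumes "bij f" "bij g" "supp_in A f" "supp_in B g" "A \<inter> B = {}"
  shows "f \<circ> g = g \<circ> f"
proof
  fix x show "(f \<circ> g) x = (g \<circ> f) x"
    using assms supp_in_apply[OF assms(1,3), of x] supp_in_apply[OF assms(2,4), of x]
    unfolding supp_in_def by (cases "x \<in> A"; cases "x \<in> B") auto
qed

lemma commute_inv:
  assumes "bij f" "bij g" "f \<circ> g = g \<circ> f"
  shows "f \<circ> pinv g = pinv g \<circ> f"
proof
  fix x
  have "g (f (pinv g x)) = f x"
    using assms(2) fun_cong[OF assms(3), of "pinv g x"] by (simp add: inv_apply)
  thus "(f \<circ> pinv g) x = (pinv g \<circ> f) x" using assms inv_apply by (metis comp_apply)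
qed

text \<open>The primed maps commute with the unprimed ones and can be collected on the right. This
  serves to modify the entries of a commutator in a controlled way.\<close>

lemma perm_comm_mult:
  assumes b: "bij a" "bij b" "bij a'" "bij b'"
    and c: "a \<circ> a' = a' \<circ> a" "a \<circ> b' = b' \<circ> a" "b \<circ> a' = a' \<circ> b" "b \<circ> b' = b' \<circ> b"
  shows "perm_comm (a \<circ> a') (b \<circ> b') = perm_comm a b \<circ> perm_comm a' b'"
proof -
  have i: "a' \<circ> pinv a = pinv a \<circ> a'" "a' \<circ> pinv b = pinv b \<circ> a'" "b' \<circ> pinv a = pinv a \<circ> b'"
     "b' \<circ> pinv b = pinv b \<circ> b'" "pinv a' \<circ> pinv b = pinv b \<circ> pinv a'"
     "pinv a' \<circ> pinv a = pinv a \<circ> pinv a'" "pinv b' \<circ> pinv b = pinv b \<circ> pinv b'"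
    using b c commute_inv bij_imp_bij_inv by metis+
  have e: "\<And>x. a' (b x) = b (a' x)" "\<And>x. a' (pinv a x) = pinv a (a' x)" "\<And>x. a' (pinv b x) = pinv b (a' x)"
    "\<And>x. b' (pinv a x) = pinv a (b' x)" "\<And>x. b' (pinv b x) = pinv b (b' x)"
    "\<And>x. pinv a' (pinv b x) = pinv b (pinv a' x)" "\<And>x. pinv a' (pinv a x) = pinv a (pinv a' x)"
    "\<And>x. pinv b' (pinv b x) = pinv b (pinv b' x)"
    using i c by (metis comp_apply)+
  show ?thesis using b by (simp add: perm_simps e)
qed

lemma comm_prods_comp: "f \<in> comm_prods H \<Longrightarrow> g \<in> comm_prods H \<Longrightarrow> f \<circ> g \<in> comm_prods H"
  by (induction rule: comm_prods_induct) (auto simp: comp_assoc intro: comm_prods_step)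

lemma comm_prods_comm: "a \<in> H \<Longrightarrow> b \<in> H \<Longrightarrow> perm_comm a b \<in> comm_prods H"
  using comm_prods_step[OF _ _ comm_prods_id, of a H b] by simp

lemma comm_prods_closed:
  assumes "id \<in> H" "\<And>f g. f \<in> H \<Longrightarrow> g \<in> H \<Longrightarrow> f \<circ> g \<in> H" "\<And>f. f \<in> H \<Longrightarrow> pinv f \<in> H"
    "f \<in> comm_prods H"
  shows "f \<in> H"
  using assms(4) by induction (auto simp: perm_comm_def assms(1-3) simp del: o_apply id_apply)

lemma comm_prods_inv:
  assumes "\<And>f. f \<in> H \<Longrightarrow> bij f" and "f \<in> comm_prods H"
  shows "bij f \<and> pinv f \<in> comm_prods H"
  using assms(2)
proof induction
  case (step a b d)
  have ab: "bij a" "bij b" using step assms(1) by auto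
  have "pinv (perm_comm a b) = perm_comm b a" using ab by (simp add: perm_simps)
  moreover have "pinv (perm_comm a b \<circ> d) = pinv d \<circ> pinv (perm_comm a b)"
    using ab step by (intro o_inv_distrib) (auto simp: bij_perm_comm)
  ultimately show ?case using step ab by (auto intro!: comm_prods_comp comm_prods_comm bij_comp bij_perm_comm simp del: o_apply)
qed (auto intro: comm_prods_id simp del: id_apply)

text \<open>Multiplicativity is asked only for the products that occur in the induction, so that the
  rule also covers maps which are homomorphisms merely on \<open>G\<close>.\<close>

lemma comm_prods_hom:
  assumes "f \<in> comm_prods H" and "c id = id"
    and "\<And>a b. a \<in> H \<Longrightarrow> b \<in> H \<Longrightarrow> c (perm_comm a b) \<in> comm_prods H'"
    and "\<And>a b d. a \<in> H \<Longrightarrow> b \<in> H \<Longrightarrow> d \<in> comm_prods H \<Longrightarrow> c (perm_comm a b \<circ> d) = c (perm_comm a b) \<circ> c d"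
  shows "c f \<in> comm_prods H'"
  using assms(1)
  by induction (auto simp: assms(2,4) intro: comm_prods_id comm_prods_comp assms(3) simp del: o_apply id_apply)

text \<open>\<open>glue\<close> expresses that the group is full. \<open>compress\<close> supplies
  the homomorphism \<open>c\<close> from the whole group to the elements supported on a proper
  clopen set \<open>W\<close>; since it fixes everything supported on \<open>Y\<close>, it turns any
  expression of such an element by commutators into one with all entries supported on
  \<open>W\<close>.\<close>

locale proximal_full_group =
  fixes G :: "('x \<Rightarrow> 'x) set" and \<Omega> :: "'x set" and clopen :: "'x set set"
  assumes G_id: "id \<in> G"
    and G_comp: "f \<in> G \<Longrightarrow> g \<in> G \<Longrightarrow> f \<circ> g \<in> G"
    and G_inv: "f \<in> G \<Longrightarrow> pinv f \<in> G"
    and G_bij: "f \<in> G \<Longrightarrow> bij f"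
    and G_supp: "f \<in> G \<Longrightarrow> supp_in \<Omega> f"
    and clopen_sub: "A \<in> clopen \<Longrightarrow> A \<subseteq> \<Omega>"
    and clopen_space: "\<Omega> \<in> clopen"
    and clopen_Un: "A \<in> clopen \<Longrightarrow> B \<in> clopen \<Longrightarrow> A \<union> B \<in> clopen"
    and clopen_Diff: "A \<in> clopen \<Longrightarrow> B \<in> clopen \<Longrightarrow> A - B \<in> clopen"
    and clopen_image: "g \<in> G \<Longrightarrow> A \<in> clopen \<Longrightarrow> g ` A \<in> clopen"
    and clopen_split: "A \<in> clopen \<Longrightarrow> A \<noteq> {} \<Longrightarrow>
      \<exists>B\<in>clopen. \<exists>C\<in>clopen. B \<noteq> {} \<and> C \<noteq> {} \<and> B \<inter> C = {} \<and> B \<union> C \<subseteq> A"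
    and glue: "bij h \<Longrightarrow> f \<in> G \<Longrightarrow> g \<in> G \<Longrightarrow> A \<in> clopen \<Longrightarrow> B \<in> clopen \<Longrightarrow>
      \<forall>x\<in>A. h x = f x \<Longrightarrow> \<forall>x\<in>B. h x = g x \<Longrightarrow> supp_in (A \<union> B) h \<Longrightarrow> h \<in> G"
    and proximal: "A \<in> clopen \<Longrightarrow> B \<in> clopen \<Longrightarrow> A \<noteq> \<Omega> \<Longrightarrow> B \<noteq> {} \<Longrightarrow> \<exists>g\<in>G. g ` A \<subseteq> B"
    and displace: "g \<in> G \<Longrightarrow> g \<noteq> id \<Longrightarrow> \<exists>U\<in>clopen. U \<noteq> {} \<and> g ` U \<inter> U = {}"
    and compress: "Y \<in> clopen \<Longrightarrow> Y \<noteq> \<Omega> \<Longrightarrow> \<exists>W\<in>clopen. W \<noteq> \<Omega> \<and>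
      (\<exists>c. (\<forall>g\<in>G. c g \<in> G \<and> supp_in W (c g)) \<and> (\<forall>g\<in>G. \<forall>h\<in>G. c (g \<circ> h) = c g \<circ> c h) \<and>
        (\<forall>f\<in>G. supp_in Y f \<longrightarrow> c f = f))"
begin

definition D where "D = comm_prods G"

lemma G_comm: "a \<in> G \<Longrightarrow> b \<in> G \<Longrightarrow> perm_comm a b \<in> G"
  by (simp add: perm_comm_def G_comp G_inv)

lemma G_conj: "k \<in> G \<Longrightarrow> f \<in> G \<Longrightarrow> perm_conj k f \<in> G"
  by (simp add: perm_conj_def G_comp G_inv)

lemma D_G: "f \<in> D \<Longrightarrow> f \<in> G"
  unfolding D_def by (rule comm_prods_closed[OF G_id G_comp G_inv])

lemma D_bij: "f \<in> D \<Longrightarrow> bij f"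
  by (rule G_bij[OF D_G])

lemma D_id: "id \<in> D" by (simp add: D_def comm_prods_id)

lemma D_comp: "f \<in> D \<Longrightarrow> g \<in> D \<Longrightarrow> f \<circ> g \<in> D"
  by (simp add: D_def comm_prods_comp)

lemma D_inv: "f \<in> D \<Longrightarrow> pinv f \<in> D"
  using comm_prods_inv[of G f] G_bij by (auto simp: D_def)

lemma D_comm: "a \<in> G \<Longrightarrow> b \<in> G \<Longrightarrow> perm_comm a b \<in> D"
  by (simp add: D_def comm_prods_comm)

lemma perm_conj_id: "bij k \<Longrightarrow> perm_conj k id = id"
  by (simp add: perm_simps)

lemma D_conj:
  assumes k: "k \<in> G" and "f \<in> D"
  shows "perm_conj k f \<in> D"
  unfolding D_def
  by (rule comm_prods_hom[OF assms(2)[unfolded D_def]])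
    (auto simp: perm_conj_id perm_conj_comp perm_conj_comm G_bij k bij_perm_comm intro!: comm_prods_comm G_conj simp del: o_apply id_apply)

section \<open>Proximality of the commutator subgroup\<close>

lemma split2:
  assumes "A \<in> clopen" "A \<noteq> {}"
  obtains B C where "B \<in> clopen" "C \<in> clopen" "B \<noteq> {}" "C \<noteq> {}" "B \<inter> C = {}" "B \<subseteq> A" "C \<subseteq> A"
  using clopen_split[OF assms] by (metis Un_subset_iff)

lemma proper_iff: "A \<in> clopen \<Longrightarrow> A \<noteq> \<Omega> \<longleftrightarrow> \<Omega> - A \<noteq> {}"
  using clopen_sub by auto

text \<open>An involution exchanging \<open>A\<close> and \<open>g A\<close>, multiplied by a conjugate of itself supported in
  \<open>R\<close>, is a commutator.\<close>

lemma swap_in_D: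
  assumes g: "g \<in> G" and A: "A \<in> clopen" and dis: "A \<inter> g ` A = {}"
    and R: "R \<in> clopen" "R \<noteq> {}" "R \<inter> (A \<union> g ` A) = {}"
  shows "\<exists>d\<in>D. (\<forall>x\<in>A. d x = g x) \<and> (\<forall>x\<in>g ` A. d x = pinv g x) \<and> supp_in (A \<union> g ` A \<union> R) d"
proof -
  define k where "k x = (if x \<in> A then g x else if x \<in> g ` A then pinv g x else x)" for x
  have bg: "bij g" using g G_bij by simp
  have kk: "k (k x) = x" for x using dis bg by (auto simp: k_def inv_apply)
  hence bk: "bij k" by (intro o_bij[of k k]) auto
  have gA: "g ` A \<in> clopen" using g A clopen_image by simp
  have sk: "supp_in (A \<union> g ` A) k" by (auto simp: supp_in_def k_def)
  have kG: "k \<in> G"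
    using dis by (intro glue[OF bk g G_inv[OF g] A gA _ _ sk]) (auto simp: k_def)
  have AgA: "A \<union> g ` A \<in> clopen" using A gA clopen_Un by simp
  have "A \<union> g ` A \<noteq> \<Omega>" using R clopen_sub[OF R(1)] by auto
  then obtain s where s: "s \<in> G" "s ` (A \<union> g ` A) \<subseteq> R" using proximal[OF AgA R(1) _ R(2)] by auto
  have ik: "pinv k = k" using kk by (intro inv_equality) auto
  define d where "d = perm_comm k s"
  have de: "d = k \<circ> perm_conj s k" by (simp add: d_def perm_comm_def perm_conj_def ik comp_assoc)
  have sc: "supp_in R (perm_conj s k)"
    using supp_in_conj[OF G_bij[OF s(1)] sk] s(2) supp_in_mono by blast
  have out: "perm_conj s k x = x" if "x \<in> A \<union> g ` A" for x
    using sc that R(3) by (auto simp: supp_in_def)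
  have "supp_in (A \<union> g ` A \<union> R) d"
    unfolding de using sk sc by (intro supp_in_comp) (auto elim: supp_in_mono)
  moreover have "d \<in> D" using kG s D_comm by (simp add: d_def)
  moreover have "d x = g x" if "x \<in> A" for x using that out by (simp add: de k_def)
  moreover have "d x = pinv g x" if "x \<in> g ` A" for x
  proof -
    have "x \<notin> A" using that dis by auto
    thus ?thesis using that out by (simp add: de k_def)
  qed
  ultimately show ?thesis by blast
qed

text \<open>\<open>swap_in_D\<close> imitates an element of \<open>G\<close> by one of
  \<open>D\<close> if source and target are disjoint and leave some room. If \<open>B\<close> lies
  in \<open>A\<close>, the move takes a detour through half of the complement of \<open>A\<close>,
  the other half being the room; otherwise half of \<open>B - A\<close> serves as the
  target.\<close>

lemma D_proximal:
  assumes A: "A \<in> clopen" "A \<noteq> \<Omega>" and B: "B \<in> clopen" "B \<noteq> {}"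
  shows "\<exists>d\<in>D. d ` A \<subseteq> B"
proof -
  have disjoint: "\<exists>d\<in>D. d ` A \<subseteq> B" if A: "A \<in> clopen" and B: "B \<in> clopen" "B \<noteq> {}" "A \<inter> B = {}" "A \<union> B \<noteq> \<Omega>" for A B
  proof -
    have "A \<noteq> \<Omega>" using B clopen_sub[OF B(1)] by auto
    then obtain g where g: "g \<in> G" "g ` A \<subseteq> B" using proximal[OF A B(1) _ B(2)] by auto
    have R: "\<Omega> - (A \<union> B) \<in> clopen" "\<Omega> - (A \<union> B) \<noteq> {}"
      using A B clopen_space clopen_Un clopen_Diff proper_iff by auto
    obtain d where "d \<in> D" "\<forall>x\<in>A. d x = g x"
      using swap_in_D[OF g(1) A _ R] g(2) B(3) by blast
    thus ?thesis using g(2) by auto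
  qed
  show ?thesis
  proof (cases "B \<subseteq> A")
    case True
    have "\<Omega> - A \<in> clopen" "\<Omega> - A \<noteq> {}" using A clopen_space clopen_Diff proper_iff by auto
    then obtain P Q where PQ: "P \<in> clopen" "Q \<in> clopen" "P \<noteq> {}" "Q \<noteq> {}" "P \<inter> Q = {}" "P \<subseteq> \<Omega> - A" "Q \<subseteq> \<Omega> - A"
      by (rule split2)
    have "A \<union> P \<noteq> \<Omega>" using PQ(4,5,7) by blast
    then obtain d1 where d1: "d1 \<in> D" "d1 ` A \<subseteq> P" using disjoint[of A P] A PQ by auto
    have "P \<union> B \<noteq> \<Omega>" using PQ(4,5,7) True by blast
    then obtain d2 where d2: "d2 \<in> D" "d2 ` P \<subseteq> B" using disjoint[of P B] B PQ(1,6) True by blast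
    show ?thesis using d1 d2 D_comp by (intro bexI[of _ "d2 \<circ> d1"]) auto
  next
    case False
    then have "B - A \<in> clopen" "B - A \<noteq> {}" using A B clopen_Diff by auto
    then obtain P Q where PQ: "P \<in> clopen" "Q \<in> clopen" "P \<noteq> {}" "Q \<noteq> {}" "P \<inter> Q = {}" "P \<subseteq> B - A" "Q \<subseteq> B - A"
      by (rule split2)
    have "A \<union> P \<noteq> \<Omega>" using PQ(4,5,7) clopen_sub[OF B(1)] by blast
    then obtain d1 where "d1 \<in> D" "d1 ` A \<subseteq> P" using disjoint[of A P] A PQ(1,3,6) by blast
    thus ?thesis using PQ(6) by blast
  qed
qed

text \<open>Half of a displaced set is displaced as well, and the other half avoids both it and its
  image.\<close>

lemma displace_proper:
  assumes "g \<in> G" "g \<noteq> id"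
  obtains U where "U \<in> clopen" "U \<noteq> {}" "g ` U \<inter> U = {}" "U \<union> g ` U \<noteq> \<Omega>"
proof -
  obtain U where U: "U \<in> clopen" "U \<noteq> {}" "g ` U \<inter> U = {}" using displace[OF assms] by auto
  obtain P Q where PQ: "P \<in> clopen" "Q \<in> clopen" "P \<noteq> {}" "Q \<noteq> {}" "P \<inter> Q = {}" "P \<subseteq> U" "Q \<subseteq> U"
    using split2[OF U(1,2)] .
  have "Q \<inter> (P \<union> g ` P) = {}" using PQ(5-7) U(3) by blast
  hence "P \<union> g ` P \<noteq> \<Omega>" using PQ(2,4) clopen_sub[OF PQ(2)] by blast
  moreover have "g ` P \<inter> P = {}" using PQ(6) U(3) by blast
  ultimately show ?thesis using that[of P] PQ(1,3) by blast
qed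

section \<open>Rigid stabilizers and the displacement trick\<close>

definition rigid :: "('x \<Rightarrow> 'x) set \<Rightarrow> 'x set \<Rightarrow> ('x \<Rightarrow> 'x) set" where
  "rigid H A = {f \<in> H. supp_in A f}"

text \<open>Three improvements of an expression of \<open>f\<close> by commutators:
  \<open>compress\<close> confines the entries to \<open>W\<close>, a conjugation in
  \<open>D\<close> moves \<open>W\<close> into a part \<open>Z1\<close> of \<open>Z\<close>, and
  correction factors supported in the rest of \<open>Z\<close> bring the entries from
  \<open>G\<close> into \<open>D\<close>.\<close>

lemma conj_into_comm_prods_rigid:
  assumes f: "f \<in> D" "supp_in Y f" and Y: "Y \<in> clopen" "Y \<noteq> \<Omega>" and Z: "Z \<in> clopen" "Z \<noteq> {}"
  shows "\<exists>k\<in>D. perm_conj k f \<in> comm_prods (rigid D Z)"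
proof -
  obtain W c where W: "W \<in> clopen" "W \<noteq> \<Omega>" and c: "\<And>g. g \<in> G \<Longrightarrow> c g \<in> G" "\<And>g. g \<in> G \<Longrightarrow> supp_in W (c g)"
    and hom: "\<And>g h. g \<in> G \<Longrightarrow> h \<in> G \<Longrightarrow> c (g \<circ> h) = c g \<circ> c h"
    and fx: "\<And>f. f \<in> G \<Longrightarrow> supp_in Y f \<Longrightarrow> c f = f"
    using compress[OF Y] by metis
  have cid: "c id = id" using fx G_id by simp
  have cinv: "c (pinv g) = pinv (c g)" if g: "g \<in> G" for g
  proof -
    have "pinv g \<circ> g = id" "g \<circ> pinv g = id" using G_bij[OF g] by (auto simp: perm_simps)
    hence "c (pinv g) \<circ> c g = id" "c g \<circ> c (pinv g) = id" using hom G_inv g cid by metis+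
    thus ?thesis by (intro inv_unique_comp[symmetric]) auto
  qed
  have ccomm: "c (perm_comm a b) = perm_comm (c a) (c b)" if "a \<in> G" "b \<in> G" for a b
    using that by (simp add: perm_comm_def hom cinv G_comp G_inv)
  \<comment> \<open>The homomorphism is applied to a factorisation of \<open>f\<close>, which it
    fixes.\<close>
  have "c f \<in> comm_prods (rigid G W)"
  proof (rule comm_prods_hom[OF f(1)[unfolded D_def], of c])
    show "c id = id" by (rule cid)
    show "c (perm_comm a b) \<in> comm_prods (rigid G W)" if "a \<in> G" "b \<in> G" for a b
      using that c by (auto simp: ccomm rigid_def intro!: comm_prods_comm)
    show "c (perm_comm a b \<circ> d) = c (perm_comm a b) \<circ> c d" if "a \<in> G" "b \<in> G" "d \<in> comm_prods G" for a b d
      using that D_G[unfolded D_def] by (intro hom G_comm) auto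
  qed
  hence fW: "f \<in> comm_prods (rigid G W)" using fx f D_G by simp
  \<comment> \<open>\<open>Z1\<close> receives the entries; \<open>Z3\<close> and \<open>Z4\<close>
    inside \<open>Z2\<close> receive the correction factors of the first and of the second
    entry.\<close>
  obtain Z1 Z2 where Z12: "Z1 \<in> clopen" "Z2 \<in> clopen" "Z1 \<noteq> {}" "Z2 \<noteq> {}" "Z1 \<inter> Z2 = {}" "Z1 \<subseteq> Z" "Z2 \<subseteq> Z"
    using split2[OF Z] .
  obtain Z3 Z4 where Z34: "Z3 \<in> clopen" "Z4 \<in> clopen" "Z3 \<noteq> {}" "Z4 \<noteq> {}" "Z3 \<inter> Z4 = {}" "Z3 \<subseteq> Z2" "Z4 \<subseteq> Z2"
    using split2[OF Z12(2,4)] .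
  have Z1X: "Z1 \<noteq> \<Omega>" using Z12(4,5) clopen_sub[OF Z12(2)] by blast
  obtain s where s: "s \<in> G" "s ` Z1 \<subseteq> Z3" using proximal[OF Z12(1) Z34(1) Z1X Z34(3)] by auto
  obtain s' where s': "s' \<in> G" "s' ` Z1 \<subseteq> Z4" using proximal[OF Z12(1) Z34(2) Z1X Z34(4)] by auto
  obtain k where k: "k \<in> D" "k ` W \<subseteq> Z1" using D_proximal[OF W Z12(1,3)] by auto
  have kb: "bij k" using k D_bij by simp
  have conjk: "perm_conj k a \<in> rigid G Z1" if "a \<in> rigid G W" for a
    using that k kb supp_in_conj[OF kb, of W a] supp_in_mono
    by (auto simp: rigid_def intro: G_conj D_G)
  have "perm_conj k f \<in> comm_prods (rigid G Z1)"
    using fW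
  proof (rule comm_prods_hom)
    show "perm_conj k id = id" using kb by (rule perm_conj_id)
    show "perm_conj k (perm_comm a b) \<in> comm_prods (rigid G Z1)" if "a \<in> rigid G W" "b \<in> rigid G W" for a b
      using that kb conjk G_bij by (auto simp: rigid_def perm_conj_comm intro!: comm_prods_comm)
    show "perm_conj k (perm_comm a b \<circ> d) = perm_conj k (perm_comm a b) \<circ> perm_conj k d" for a b d
      by (rule perm_conj_comp[OF kb])
  qed
  moreover have "perm_comm a b \<in> comm_prods (rigid D Z)" if ab: "a \<in> rigid G Z1" "b \<in> rigid G Z1" for a b
  proof -
    have a: "a \<in> G" "supp_in Z1 a" "bij a" and b: "b \<in> G" "supp_in Z1 b" "bij b"
      using ab G_bij by (auto simp: rigid_def)
    \<comment> \<open>With this choice \<open>a \<circ> a'\<close> is the commutator of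
      \<open>a\<close> and \<open>s\<close>, hence in \<open>D\<close>; likewise for
      \<open>b'\<close>. As \<open>a'\<close> and \<open>b'\<close> have disjoint supports, their
      own commutator is trivial and the value of \<open>perm_comm a b\<close> does not
      change.\<close>
    define a' where "a' = perm_conj s (pinv a)"
    define b' where "b' = perm_conj s' (pinv b)"
    have a': "bij a'" "supp_in Z3 a'" 
      using a s supp_in_conj[OF G_bij[OF s(1)] supp_in_inv[OF a(3,2)]] supp_in_mono
      by (auto simp: a'_def G_bij bij_imp_bij_inv bij_perm_conj)
    have b': "bij b'" "supp_in Z4 b'"
      using b s' supp_in_conj[OF G_bij[OF s'(1)] supp_in_inv[OF b(3,2)]] supp_in_mono
      by (auto simp: b'_def G_bij bij_imp_bij_inv bij_perm_conj)
    note cm = supp_in_disjoint_commute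
    have c3: "a' \<circ> b' = b' \<circ> a'" by (rule cm[OF a'(1) b'(1) a'(2) b'(2) Z34(5)])
    have dis: "Z1 \<inter> Z3 = {}" "Z1 \<inter> Z4 = {}" using Z34 Z12 by auto
    have "perm_comm (a \<circ> a') (b \<circ> b') = perm_comm a b \<circ> perm_comm a' b'"
      by (rule perm_comm_mult[OF a(3) b(3) a'(1) b'(1)
        cm[OF a(3) a'(1) a(2) a'(2) dis(1)] cm[OF a(3) b'(1) a(2) b'(2) dis(2)]
        cm[OF b(3) a'(1) b(2) a'(2) dis(1)] cm[OF b(3) b'(1) b(2) b'(2) dis(2)]])
    also have "perm_comm a' b' = id"
    proof -
      have "perm_comm a' b' = b' \<circ> a' \<circ> pinv a' \<circ> pinv b'" using c3 by (simp add: perm_comm_def)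
      also have "\<dots> = id" using a' b' by (simp add: perm_simps)
      finally show ?thesis .
    qed
    finally have e: "perm_comm a b = perm_comm (a \<circ> a') (b \<circ> b')"
      by (simp only: comp_id)
    have "a \<circ> a' = perm_comm a s" "b \<circ> b' = perm_comm b s'"
      by (auto simp: a'_def b'_def perm_conj_def perm_comm_def comp_assoc)
    hence "a \<circ> a' \<in> D" "b \<circ> b' \<in> D" using a b s s' D_comm by auto
    moreover have "supp_in Z (a \<circ> a')" "supp_in Z (b \<circ> b')"
      using a a' b b' Z12 Z34 by (auto intro!: supp_in_comp elim!: supp_in_mono)
    ultimately show ?thesis unfolding e by (intro comm_prods_comm) (auto simp: rigid_def)
  qed
  ultimately have "perm_conj k f \<in> comm_prods (rigid D Z)"
    by (induction rule: comm_prods_induct) (auto intro: comm_prods_id comm_prods_comp)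
  thus ?thesis using k by auto
qed

text \<open>The displacement trick of Burago and Ivanov. The factor \<open>\<phi>\<close> for \<open>f = [a, b] f'\<close> is
  \<open>f (t \<phi>' t\<^sup>-\<^sup>1)\<close>, where \<open>\<phi>'\<close> is the one for \<open>f'\<close>.\<close>

lemma two_commutators:
  assumes "f \<in> comm_prods (rigid D Z)" and t: "t \<in> D" and U: "t ` U \<subseteq> U" "Z \<subseteq> U" "Z \<inter> t ` U = {}"
  shows "\<exists>\<phi>\<in>D. \<exists>A\<in>rigid D (t ` U). \<exists>B\<in>rigid D (t ` U). f = perm_comm \<phi> t \<circ> perm_comm A B"
proof -
  have bt: "bij t" using t D_bij by simp
  \<comment> \<open>The induction also carries the support of \<open>f\<close>: the commutation of
    \<open>f\<close> with \<open>perm_comm A B\<close> depends on it.\<close>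
  have "f \<in> rigid D Z \<and> ?thesis" using assms(1)
  proof induction
    case id
    have "id = perm_comm id t \<circ> perm_comm id id" using bt by (simp add: perm_simps)
    moreover have "id \<in> rigid D A" for A using D_id by (simp add: rigid_def)
    ultimately show ?case using D_id by blast
  next
    case (step a b f)
    then obtain \<phi> A B where p: "\<phi> \<in> D" and AB: "A \<in> rigid D (t ` U)" "B \<in> rigid D (t ` U)"
      and f: "f = perm_comm \<phi> t \<circ> perm_comm A B" and fZ: "f \<in> rigid D Z" by blast
    have ab: "a \<in> D" "supp_in Z a" "b \<in> D" "supp_in Z b" using step by (auto simp: rigid_def)
    have b: "bij a" "bij b" "bij A" "bij B" "bij \<phi>" "bij f"
      using ab AB p fZ by (auto simp: rigid_def D_bij)
    have AB': "A \<in> D" "supp_in (t ` U) A" "B \<in> D" "supp_in (t ` U) B" using AB by (auto simp: rigid_def)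
    define g where "g = perm_comm a b \<circ> f"
    have cD: "perm_comm a b \<in> D" using ab D_G D_comm by simp
    have gZ: "g \<in> rigid D Z"
      using fZ ab b cD by (auto simp: g_def rigid_def intro!: D_comp supp_in_comp supp_in_comm)
    have bg: "bij g" using gZ D_bij by (auto simp: rigid_def)
    define \<psi> where "\<psi> = g \<circ> perm_conj t \<phi>"
    have pD: "\<psi> \<in> D" unfolding \<psi>_def using gZ p t D_conj D_G by (auto simp: rigid_def intro: D_comp)
    \<comment> \<open>Unrolled, the first entry is the product of the \<open>t\<close>-translates of
      all the \<open>a\<close>, one power of \<open>t\<close> for each factor. Their supports are
      disjoint, so a single commutator collects all the translated commutators.\<close>
    define A' where "A' = perm_conj t (a \<circ> A)"
    define B' where "B' = perm_conj t (b \<circ> B)"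
    have sU: "supp_in U (a \<circ> A)" "supp_in U (b \<circ> B)"
      using ab AB' U by (auto intro!: supp_in_comp elim: supp_in_mono)
    have A'B': "A' \<in> rigid D (t ` U)" "B' \<in> rigid D (t ` U)"
      unfolding A'_def B'_def rigid_def using ab AB' t D_conj D_G D_comp supp_in_conj[OF bt] sU by auto
    have "perm_comm (a \<circ> A) (b \<circ> B) = perm_comm a b \<circ> perm_comm A B"
      using ab AB' b U(3)
      by (intro perm_comm_mult) (auto intro!: supp_in_disjoint_commute)
    hence AB2: "perm_comm A' B' = perm_conj t (perm_comm a b \<circ> perm_comm A B)"
      using b bt by (simp add: A'_def B'_def perm_conj_comm[symmetric] bij_comp)
    define C where "C = perm_comm A B"
    have bC: "bij C" using b by (simp add: C_def bij_perm_comm)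
    have sC: "supp_in (t ` U) C" using AB' b by (simp add: C_def supp_in_comm)
    have fC: "f \<circ> C = C \<circ> f" 
      using fZ by (intro supp_in_disjoint_commute[OF b(6) bC _ sC U(3)]) (simp add: rigid_def)
    have fC': "pinv f \<circ> C = C \<circ> pinv f"
      using commute_inv[OF bC b(6)] fC by simp
    have ft: "perm_comm \<phi> t = f \<circ> pinv C"
      using bC by (simp add: f C_def[symmetric] fun_eq_iff inv_apply)
    \<comment> \<open>The two copies of \<open>t\<close> next to the conjugated \<phi> telescope.
      Since \<open>perm_comm \<phi> t\<close> is \<open>f\<close> times the inverse of
      \<open>C\<close>, and \<open>f\<close> commutes with \<open>C\<close>, only the inverse of
      \<open>perm_comm A' B'\<close> remains beside \<open>g\<close>.\<close>
    have "perm_comm \<psi> t = g \<circ> perm_conj t (perm_comm \<phi> t \<circ> pinv g)"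
      using b bt bg by (simp add: perm_simps \<psi>_def)
    also have "\<dots> = g \<circ> perm_conj t (f \<circ> pinv C \<circ> pinv f \<circ> pinv (perm_comm a b))"
      using b bij_perm_comm[OF b(1,2)] by (simp add: ft g_def o_inv_distrib comp_assoc)
    finally have e1: "perm_comm \<psi> t = g \<circ> perm_conj t (f \<circ> pinv C \<circ> pinv f \<circ> pinv (perm_comm a b))" .
    have "f \<circ> pinv C = pinv C \<circ> f" using commute_inv[OF b(6) bC fC] .
    hence "f \<circ> pinv C \<circ> pinv f = pinv C" using b by (simp add: fun_eq_iff inv_apply)
    hence "perm_comm \<psi> t = g \<circ> perm_conj t (pinv C \<circ> pinv (perm_comm a b))"
      using e1 by simp
    moreover have "perm_conj t (pinv C \<circ> pinv (perm_comm a b)) \<circ> perm_comm A' B' = id"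
      unfolding AB2 C_def[symmetric] perm_conj_comp[OF bt, symmetric]
      using bC bij_perm_comm[OF b(1,2)] bt
      by (simp add: perm_conj_def fun_eq_iff inv_apply)
    ultimately have "g = perm_comm \<psi> t \<circ> perm_comm A' B'" by (simp add: comp_assoc)
    thus ?case using pD A'B' gZ unfolding g_def[symmetric] by blast
  qed
  thus ?thesis by simp
qed

text \<open>The product of \<open>h\<close> with a conjugate is needed because \<open>h\<close>
  itself does not map \<open>U\<close> into \<open>U\<close>. The conjugator exchanges
  \<open>h U\<close> with a subset of \<open>P \<subseteq> U\<close>, which brings \<open>U\<close>
  back into \<open>P\<close>; the other half \<open>Q\<close> is then free for the
  commutators.\<close>

lemma conj_comm_comm:
  assumes "h \<in> D" "f \<in> D" "bij h" "U \<in> clopen" "U \<noteq> {}" "h ` U \<inter> U = {}" "U \<union> h ` U \<noteq> \<Omega>"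
    "supp_in Y f" "Y \<in> clopen" "Y \<noteq> \<Omega>"
  shows "\<exists>k\<in>D. \<exists>l\<in>D. \<exists>\<phi>\<in>D. \<exists>A\<in>rigid D U. \<exists>B\<in>rigid D U.
    perm_conj l f = perm_comm \<phi> (perm_conj k h \<circ> h) \<circ> perm_comm A B"
proof -
  note h = assms(1) and U = assms(4-7)
  have hU: "h ` U \<in> clopen" using h U D_G clopen_image by simp
  have R: "\<Omega> - (U \<union> h ` U) \<in> clopen" "\<Omega> - (U \<union> h ` U) \<noteq> {}"
    using U hU clopen_space clopen_Un clopen_Diff proper_iff by auto
  obtain P Q where PQ: "P \<in> clopen" "Q \<in> clopen" "P \<noteq> {}" "Q \<noteq> {}" "P \<inter> Q = {}" "P \<subseteq> U" "Q \<subseteq> U"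
    using split2[OF U(1,2)] .
  have "h ` U \<noteq> \<Omega>" using U(2,3) clopen_sub[OF U(1)] by auto
  then obtain g where g: "g \<in> G" "g ` (h ` U) \<subseteq> P" using proximal[OF hU PQ(1) _ PQ(3)] by auto
  obtain k where k: "k \<in> D" "\<forall>x\<in>h ` U. k x = g x" "\<forall>x\<in>g ` h ` U. k x = pinv g x"
    using swap_in_D[OF g(1) hU _ R] g(2) PQ U(3) by blast
  define t where "t = perm_conj k h \<circ> h"
  have tD: "t \<in> D" unfolding t_def using h k D_conj D_G D_comp by auto
  \<comment> \<open>On \<open>h U\<close> both \<open>k\<close> and its inverse act as
    \<open>g\<close>, since \<open>k\<close> exchanges \<open>h U\<close> and its image under
    \<open>g\<close>. Hence \<open>t\<close> is \<open>g h g h\<close> on \<open>U\<close>.\<close>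
  have "perm_conj k h y = g (h (g y))" if "y \<in> h ` U" for y
  proof -
    have "k (g y) = y" using k(3) that G_bij[OF g(1)] by (auto simp: inv_apply)
    hence "pinv k y = g y" using D_bij[OF k(1)] by (metis inv_apply(1))
    moreover have "h (g y) \<in> h ` U" using g(2) PQ that by blast
    ultimately show ?thesis using bspec[OF k(2)] by (simp add: perm_conj_def)
  qed
  hence "t x = g (h (g (h x)))" if "x \<in> U" for x using that by (simp add: t_def)
  moreover have "g (h (g (h x))) \<in> P" if "x \<in> U" for x using g(2) PQ that by blast
  ultimately have tP: "t ` U \<subseteq> P" by auto
  obtain l where l: "l \<in> D" "perm_conj l f \<in> comm_prods (rigid D Q)"
    using conj_into_comm_prods_rigid[OF assms(2,8,9,10) PQ(2,4)] by auto
  have two: "\<exists>\<phi>\<in>D. \<exists>A\<in>rigid D (t ` U). \<exists>B\<in>rigid D (t ` U). perm_conj l f = perm_comm \<phi> t \<circ> perm_comm A B"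
    using tP PQ by (intro two_commutators[OF l(2) tD]) auto
  have "t ` U \<subseteq> U" using tP PQ(6) by blast
  hence "rigid D (t ` U) \<subseteq> rigid D U" using supp_in_mono unfolding rigid_def by blast
  
  thus ?thesis using two k(1) l(1) unfolding t_def by blast
qed

section \<open>The two bounds for the permutation group\<close>

definition conjs where "conjs h = {perm_conj d h |d. d \<in> D} \<union> {perm_conj d (pinv h) |d. d \<in> D}"

lemma conjs_conj: "h \<in> D \<Longrightarrow> l \<in> D \<Longrightarrow> x \<in> conjs h \<Longrightarrow> perm_conj l x \<in> conjs h"
  unfolding conjs_def using perm_conj_conj[OF D_bij D_bij] D_comp by blast

text \<open>The conjugate of \<open>A\<close> by \<open>h\<close> is supported on \<open>h U\<close>
  and commutes with \<open>B\<close>. So \<open>A\<close> may be replaced by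
  \<open>perm_comm A h\<close> inside the commutator, and expanding the result leaves two conjugates
  of \<open>h\<close> and two of its inverse.\<close>

lemma comm_displaced:
  assumes h: "h \<in> D" and AB: "A \<in> rigid D U" "B \<in> rigid D U" and U: "h ` U \<inter> U = {}"
  shows "perm_comm A B = perm_conj A h \<circ> (pinv h \<circ> (perm_conj B h \<circ> perm_conj (B \<circ> A) (pinv h)))"
proof -
  have b: "bij A" "bij B" "bij h" using assms D_bij by (auto simp: rigid_def)
  have s: "supp_in U A" "supp_in U B" using AB by (auto simp: rigid_def)
  have c: "B \<circ> perm_conj h A = perm_conj h A \<circ> B" 
    using U by (intro supp_in_disjoint_commute[OF b(2) bij_perm_conj[OF b(3,1)] s(2) supp_in_conj[OF b(3) s(1)]]) auto
  have "B (h (A (pinv h y))) = h (A (pinv h (B y)))" for y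
    using fun_cong[OF c, of y] by (simp add: perm_conj_def)
  thus ?thesis using b by (simp add: perm_simps)
qed

text \<open>The quotient of \<open>f\<close> by \<open>e\<close> is the identity on
  \<open>V\<close>, so its support is proper and \<open>conj_comm_comm\<close> applies to it;
  \<open>m\<close> undoes the conjugation made there. The two bounds below differ in the choice of
  \<open>e\<close> and \<open>h\<close>.\<close>

lemma agreeing_decomposition:
  assumes h: "h \<in> D" and U: "U \<in> clopen" "U \<noteq> {}" "h ` U \<inter> U = {}" "U \<union> h ` U \<noteq> \<Omega>"
    and f: "f \<in> D" and e: "e \<in> D" and V: "V \<in> clopen" "V \<noteq> {}" "\<And>x. x \<in> V \<Longrightarrow> e x = f x"
  shows "\<exists>k\<in>D. \<exists>m\<in>D. \<exists>\<phi>\<in>D. \<exists>A\<in>rigid D U. \<exists>B\<in>rigid D U.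
    f = e \<circ> perm_conj m (perm_comm \<phi> (perm_conj k h \<circ> h) \<circ> perm_comm A B)"
proof -
  have be: "bij e" using e D_bij by simp
  define f' where "f' = pinv e \<circ> f"
  have f'D: "f' \<in> D" using e f D_comp D_inv by (simp add: f'_def)
  have ff': "f = e \<circ> f'" using be by (simp add: f'_def fun_eq_iff inv_apply)
  have "f' x = x" if "x \<in> V" for x using V(3)[OF that] be by (simp add: f'_def) (metis inv_apply(1))
  hence sf': "supp_in (\<Omega> - V) f'" using G_supp[OF D_G[OF f'D]] by (auto simp: supp_in_def)
  have Y: "\<Omega> - V \<in> clopen" "\<Omega> - V \<noteq> \<Omega>" using V(1,2) clopen_space clopen_Diff clopen_sub[OF V(1)] by blast+
  obtain k l \<phi> A B where D: "k \<in> D" "l \<in> D" "\<phi> \<in> D" and AB: "A \<in> rigid D U" "B \<in> rigid D U"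
    and eq: "perm_conj l f' = perm_comm \<phi> (perm_conj k h \<circ> h) \<circ> perm_comm A B"
    using conj_comm_comm[OF h f'D D_bij[OF h] U sf' Y] by blast
  have "f' = perm_conj (pinv l) (perm_conj l f')" using D_bij[OF D(2)] by (simp add: perm_simps)
  hence "f = e \<circ> perm_conj (pinv l) (perm_comm \<phi> (perm_conj k h \<circ> h) \<circ> perm_comm A B)" using ff' eq by simp
  thus ?thesis using D AB D_inv by blast
qed

theorem nine_conjugates:
  assumes f: "f \<in> D" "f \<noteq> id" and h: "h \<in> D" "h \<noteq> id"
  shows "\<exists>xs. length xs \<le> 9 \<and> set xs \<subseteq> conjs h \<and> f = foldr (\<circ>) xs id"
proof -
  have fG: "f \<in> G" "bij f" and hG: "h \<in> G" "bij h" using f h D_G D_bij by auto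
  obtain U where U: "U \<in> clopen" "U \<noteq> {}" "h ` U \<inter> U = {}" "U \<union> h ` U \<noteq> \<Omega>"
    using displace_proper[OF hG(1) h(2)] .
  obtain P where P: "P \<in> clopen" "P \<noteq> {}" "f ` P \<inter> P = {}" "P \<union> f ` P \<noteq> \<Omega>"
    using displace_proper[OF fG(1) f(2)] .
  have hU: "h ` U \<in> clopen" using U hG clopen_image by simp
  \<comment> \<open>Inside \<open>P\<close>, which \<open>f\<close> displaces, a conjugate of
    \<open>h\<close> carries \<open>U'\<close> to a set disjoint from it. It remains to correct the
    target to \<open>f U'\<close> without disturbing \<open>U'\<close>.\<close>
  obtain d where d: "d \<in> D" "d ` (U \<union> h ` U) \<subseteq> P"
    using D_proximal[OF clopen_Un[OF U(1) hU] U(4) P(1,2)] by auto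
  have bd: "bij d" using d D_bij by simp
  define h' where "h' = perm_conj d h"
  have h': "h' \<in> G" "bij h'" using d h D_conj D_G G_bij by (auto simp: h'_def)
  define U' where "U' = d ` U"
  have h'U: "h' ` U' = d ` (h ` U)" using bd by (auto simp: h'_def U'_def perm_conj_def inv_apply image_image)
  have U': "U' \<in> clopen" "U' \<noteq> {}" "h' ` U' \<in> clopen" "U' \<subseteq> P" "h' ` U' \<subseteq> P"
    using U hU d D_G clopen_image unfolding h'U by (auto simp: U'_def)
  have dis: "h' ` U' \<inter> U' = {}"
    unfolding h'U using U(3) bij_is_inj[OF bd] by (simp add: U'_def image_Int[symmetric])
  \<comment> \<open>On \<open>U'\<close> the composition of \<open>g\<close> after \<open>h'\<close>
    is \<open>f\<close>. The swap \<open>k\<close> imitates \<open>g\<close> on the image of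
    \<open>U'\<close> under \<open>h'\<close> and is the identity on \<open>U'\<close>, so the
    conjugate of \<open>h'\<close> by \<open>k\<close> agrees with \<open>f\<close> on
    \<open>U'\<close>.\<close>
  define g where "g = f \<circ> pinv h'"
  have gG: "g \<in> G" using fG h' G_comp G_inv by (simp add: g_def)
  have gV: "g ` (h' ` U') = f ` U'" using h' by (auto simp: g_def inv_apply image_image)
  have fU': "f ` U' \<subseteq> f ` P" using U' by auto
  have fP: "f ` P \<in> clopen" using P fG clopen_image by auto
  have R: "\<Omega> - (P \<union> f ` P) \<in> clopen" "\<Omega> - (P \<union> f ` P) \<noteq> {}" 
    using P fP clopen_space clopen_Un clopen_Diff proper_iff by auto
  have RR: "(\<Omega> - (P \<union> f ` P)) \<inter> (h' ` U' \<union> g ` h' ` U') = {}" "h' ` U' \<inter> g ` h' ` U' = {}"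
    unfolding gV using U'(4,5) fU' P(3) by blast+
  obtain k where k: "k \<in> D" "\<forall>x\<in>h' ` U'. k x = g x" "supp_in (h' ` U' \<union> g ` h' ` U' \<union> (\<Omega> - (P \<union> f ` P))) k"
    using swap_in_D[OF gG U'(3) RR(2) R RR(1)] by auto
  have bk: "bij k" using k D_bij by simp
  have kU: "k x = x" if "x \<in> U'" for x
    using k(3) that dis U' fU' P(3) unfolding gV supp_in_def by blast
  define e where "e = perm_conj k h'"
  have eU: "e x = f x" if "x \<in> U'" for x
  proof -
    have "pinv k x = x" using kU[OF that] bk by (metis inv_apply(1))
    thus ?thesis using k(2) that h' by (simp add: e_def perm_conj_def g_def inv_apply)
  qed
  have ec: "e = perm_conj (k \<circ> d) h" using bk bd by (simp add: e_def h'_def perm_conj_conj)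
  have eD: "e \<in> D" unfolding ec using k d h D_comp D_conj D_G by auto
  obtain k' m \<phi> A B where D: "k' \<in> D" "m \<in> D" "\<phi> \<in> D" and AB: "A \<in> rigid D U" "B \<in> rigid D U"
    and eq: "f = e \<circ> perm_conj m (perm_comm \<phi> (perm_conj k' h \<circ> h) \<circ> perm_comm A B)"
    using agreeing_decomposition[OF h(1) U f(1) eD U'(1,2) eU] by blast
  have bb: "bij k'" "bij m" "bij \<phi>" using D D_bij by auto
  have ABD: "A \<in> D" "B \<in> D" using AB by (auto simp: rigid_def)
  \<comment> \<open>The inverse of the product contributes its two factors in reverse order,
    unconjugated by \<phi>; this makes four conjugates.\<close>
  have c1: "perm_comm \<phi> (perm_conj k' h \<circ> h) = perm_conj (\<phi> \<circ> k') h \<circ> (perm_conj \<phi> h \<circ> (pinv h \<circ> perm_conj k' (pinv h)))"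
    using bb hG by (simp add: perm_simps)
  define ys where "ys = [perm_conj (\<phi> \<circ> k') h, perm_conj \<phi> h, perm_conj id (pinv h), perm_conj k' (pinv h),
    perm_conj A h, perm_conj id (pinv h), perm_conj B h, perm_conj (B \<circ> A) (pinv h)]"
  have ys: "set ys \<subseteq> conjs h" "length ys = 8"
    using D D_id ABD D_comp by (auto simp: conjs_def ys_def)
  have i: "perm_conj id (pinv h) = pinv h" by (simp add: perm_simps)
  have y: "perm_comm \<phi> (perm_conj k' h \<circ> h) \<circ> perm_comm A B = foldr (\<circ>) ys id"
    unfolding c1 comm_displaced[OF h(1) AB U(3)] ys_def foldr.simps i by (simp add: comp_assoc)
  have "perm_conj m (foldr (\<circ>) zs id) = foldr (\<circ>) (map (perm_conj m) zs) id" for zs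
    using bb by (induction zs) (simp_all add: perm_conj_id perm_conj_comp)
  hence "f = foldr (\<circ>) (e # map (perm_conj m) ys) id"
    using eq unfolding y by simp
  moreover have "e \<in> conjs h" unfolding conjs_def ec using k d D_comp by auto
  moreover have "perm_conj m y \<in> conjs h" if "y \<in> set ys" for y
    using conjs_conj[OF h(1) D(2)] ys that by blast
  ultimately show ?thesis by (intro exI[of _ "e # map (perm_conj m) ys"]) (auto simp: ys(2))
qed

theorem three_commutators:
  assumes f: "f \<in> D"
  shows "\<exists>xs. length xs \<le> 3 \<and> set xs \<subseteq> {perm_comm a b |a b. a \<in> D \<and> b \<in> D} \<and> f = foldr (\<circ>) xs id"
proof (cases "f = id")
  case True
  thus ?thesis by (intro exI[of _ "[]"]) auto
next
  case False
  have fG: "f \<in> G" "bij f" using f D_G D_bij by auto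
  obtain U where U: "U \<in> clopen" "U \<noteq> {}" "f ` U \<inter> U = {}" "U \<union> f ` U \<noteq> \<Omega>"
    using displace_proper[OF fG(1) False] .
  have fU: "f ` U \<in> clopen" using U fG clopen_image by simp
  have R: "\<Omega> - (U \<union> f ` U) \<in> clopen" "\<Omega> - (U \<union> f ` U) \<noteq> {}" 
    using U fU clopen_space clopen_Un clopen_Diff proper_iff by auto
  \<comment> \<open>\<open>P\<close> is the room for the swap \<open>d\<close> that imitates
    \<open>f\<close> on \<open>U\<close>. \<open>Q\<close> takes the displaced inverse of
    \<open>d\<close>, so that the commutator of \<open>d\<close> and \<open>s\<close> still agrees
    with \<open>f\<close> on \<open>U\<close>.\<close>
  obtain P Q where PQ: "P \<in> clopen" "Q \<in> clopen" "P \<noteq> {}" "Q \<noteq> {}" "P \<inter> Q = {}"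
    "P \<subseteq> \<Omega> - (U \<union> f ` U)" "Q \<subseteq> \<Omega> - (U \<union> f ` U)"
    using split2[OF R] .
  obtain d where d: "d \<in> D" "\<forall>x\<in>U. d x = f x" "supp_in (U \<union> f ` U \<union> P) d"
    using swap_in_D[OF fG(1) U(1) _ PQ(1,3)] PQ U(3) by blast
  have "U \<union> f ` U \<union> P \<in> clopen" "U \<union> f ` U \<union> P \<noteq> \<Omega>"
    using U fU PQ clopen_Un by auto
  then obtain s where s: "s \<in> D" "s ` (U \<union> f ` U \<union> P) \<subseteq> Q" using D_proximal PQ by meson
  have b: "bij d" "bij s" using d s D_bij by auto
  define e where "e = perm_comm d s"
  have ee: "e = d \<circ> perm_conj s (pinv d)" by (simp add: e_def perm_comm_def perm_conj_def comp_assoc)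
  have "supp_in Q (perm_conj s (pinv d))"
    using supp_in_conj[OF b(2) supp_in_inv[OF b(1) d(3)]] s(2) supp_in_mono by blast
  hence eU: "e x = f x" if "x \<in> U" for x
    using that d(2) PQ(7) U by (auto simp: ee supp_in_def)
  have eD: "e \<in> D" unfolding e_def using d s D_comm D_G by simp
  obtain k m \<phi> A B where D: "k \<in> D" "m \<in> D" "\<phi> \<in> D" and AB: "A \<in> rigid D U" "B \<in> rigid D U"
    and eq: "f = e \<circ> perm_conj m (perm_comm \<phi> (perm_conj k f \<circ> f) \<circ> perm_comm A B)"
    using agreeing_decomposition[OF f U f eD U(1,2) eU] by blast
  have ABD: "A \<in> D" "B \<in> D" using AB by (auto simp: rigid_def)
  define t where "t = perm_conj k f \<circ> f"
  have tD: "t \<in> D" unfolding t_def using f D D_conj D_G D_comp by auto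
  have m: "m \<in> D" "bij m" using D D_bij by auto
  have f'': "f = foldr (\<circ>) [perm_comm d s, perm_comm (perm_conj m \<phi>) (perm_conj m t), perm_comm (perm_conj m A) (perm_conj m B)] id"
    using eq m D ABD tD D_bij unfolding t_def[symmetric] e_def by (simp add: perm_conj_comp perm_conj_comm)
  have mD: "perm_conj m x \<in> D" if "x \<in> D" for x using that m D_conj D_G by simp
  have "set [perm_comm d s, perm_comm (perm_conj m \<phi>) (perm_conj m t), perm_comm (perm_conj m A) (perm_conj m B)]
    \<subseteq> {perm_comm a b |a b. a \<in> D \<and> b \<in> D}"
    using d s D ABD tD mD by (simp, blast)
  with f'' show ?thesis by (metis (no_types, lifting) length_Cons list.size(3) numeral_3_eq_3 order_refl)
qed

end

section \<open>Transfer of the bounds to abstract groups\<close>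

definition conjugates :: "('a, 'b) monoid_scheme \<Rightarrow> 'a set \<Rightarrow> 'a \<Rightarrow> 'a set" where
  "conjugates A D h = (\<Union>d\<in>D. {d \<otimes>\<^bsub>A\<^esub> h \<otimes>\<^bsub>A\<^esub> inv\<^bsub>A\<^esub> d, d \<otimes>\<^bsub>A\<^esub> inv\<^bsub>A\<^esub> h \<otimes>\<^bsub>A\<^esub> inv\<^bsub>A\<^esub> d})"

text \<open>Both bounds for the derived subgroup are phrased with the operations of \<open>A\<close>
  itself, so that they pass along isomorphisms of \<open>A\<close>. The commutators have their
  entries in \<open>D\<close>, since the width in question is that of the group
  \<open>D\<close>.\<close>

definition short_products :: "('a, 'b) monoid_scheme \<Rightarrow> bool" where
  "short_products A \<longleftrightarrow> (let D = derived A (carrier A) in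
     (\<forall>f \<in> D - {\<one>\<^bsub>A\<^esub>}. \<forall>h \<in> D - {\<one>\<^bsub>A\<^esub>}. \<exists>xs. length xs \<le> 9 \<and> set xs \<subseteq> conjugates A D h \<and> f = list_mult A xs) \<and>
     (\<forall>f \<in> D. \<exists>xs. length xs \<le> 3 \<and> set xs \<subseteq> derived_set A D \<and> f = list_mult A xs))"

lemma short_products_imp:
  assumes A: "group A" and P: "short_products A"
  shows "uniformly_simple 9 (commutator_subgroup A) \<and> commutator_width (commutator_subgroup A) \<le> 3"
proof -
  interpret A: group A by (rule A)
  define D where "D = derived A (carrier A)"
  define B where "B = commutator_subgroup A"
  have sub: "subgroup D A" unfolding D_def by (rule A.derived_is_subgroup) simp
  have B: "group B" unfolding B_def commutator_subgroup_def D_def[symmetric]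
    by (rule subgroup.subgroup_is_group[OF sub A])
  have s: "carrier B = D" "monoid.mult B = monoid.mult A" "one B = one A"
    by (simp_all add: B_def commutator_subgroup_def D_def)
  have i: "inv\<^bsub>B\<^esub> x = inv\<^bsub>A\<^esub> x" if "x \<in> D" for x
    using A.m_inv_consistent[OF sub that] by (simp add: B_def commutator_subgroup_def D_def)
  have lm: "list_mult B xs = list_mult A xs" for xs by (simp add: list_mult_def s)
  have DA: "x \<in> carrier A" if "x \<in> D" for x using sub that by (rule subgroup.mem_carrier)
  have "uniformly_simple 9 B"
    unfolding uniformly_simple_def Let_def
  proof (intro conjI ballI B)
    fix f h assume "f \<in> carrier B - {\<one>\<^bsub>B\<^esub>}" "h \<in> carrier B - {\<one>\<^bsub>B\<^esub>}"
    hence f: "f \<in> D - {\<one>\<^bsub>A\<^esub>}" and h: "h \<in> D - {\<one>\<^bsub>A\<^esub>}" by (simp_all add: s)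
    from P f h obtain xs where xs: "length xs \<le> 9" "f = list_mult A xs" "set xs \<subseteq> conjugates A D h"
      unfolding short_products_def D_def[symmetric] Let_def by blast
    have "conjugates A D h \<subseteq> conjugacy_class B h \<union> m_inv B ` conjugacy_class B h"
    proof
      fix x assume "x \<in> conjugates A D h"
      then obtain d where d: "d \<in> D" "x = d \<otimes>\<^bsub>A\<^esub> h \<otimes>\<^bsub>A\<^esub> inv\<^bsub>A\<^esub> d \<or> x = d \<otimes>\<^bsub>A\<^esub> inv\<^bsub>A\<^esub> h \<otimes>\<^bsub>A\<^esub> inv\<^bsub>A\<^esub> d"
        by (auto simp: conjugates_def)
      have c: "d \<otimes>\<^bsub>A\<^esub> h \<otimes>\<^bsub>A\<^esub> inv\<^bsub>A\<^esub> d \<in> conjugacy_class B h"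
        unfolding conjugacy_class_def s i[OF d(1), symmetric] using d by blast
      have "d \<otimes>\<^bsub>A\<^esub> h \<otimes>\<^bsub>A\<^esub> inv\<^bsub>A\<^esub> d \<in> D"
        using sub d h by (intro subgroup.m_closed[OF sub] subgroup.m_inv_closed[OF sub]) auto
      hence "m_inv B (d \<otimes>\<^bsub>A\<^esub> h \<otimes>\<^bsub>A\<^esub> inv\<^bsub>A\<^esub> d) = d \<otimes>\<^bsub>A\<^esub> inv\<^bsub>A\<^esub> h \<otimes>\<^bsub>A\<^esub> inv\<^bsub>A\<^esub> d"
        using DA d h by (simp add: i A.inv_mult_group A.m_assoc)
      thus "x \<in> conjugacy_class B h \<union> m_inv B ` conjugacy_class B h" using d c by (metis UnI1 UnI2 image_eqI)
    qed
    thus "\<exists>xs. length xs \<le> 9 \<and> set xs \<subseteq> conjugacy_class B h \<union> m_inv B ` conjugacy_class B h \<and> f = list_mult B xs"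
      unfolding lm using xs by blast
  qed
  moreover have "commutator_width B \<le> 3"
    unfolding commutator_width_def
  proof (rule SUP_least)
    fix g assume "g \<in> derived B (carrier B)"
    \<comment> \<open>The second derived subgroup lies in the first, for all of whose elements the
      bound is known.\<close>
    hence "g \<in> D" using group.derived_in_carrier[OF B, of "carrier B"] by (auto simp: s)
    with P obtain xs where xs: "length xs \<le> 3" "g = list_mult A xs" "set xs \<subseteq> derived_set A D"
      unfolding short_products_def D_def[symmetric] Let_def by blast
    have "derived_set A D = derived_set B (carrier B)" by (simp add: s i)
    hence "xs \<in> {cs. set cs \<subseteq> derived_set B (carrier B) \<and> list_mult B cs = g}"
      using xs(2,3) lm by auto
    hence "commutator_length B g \<le> enat (length xs)"
      unfolding commutator_length_def by (rule INF_lower)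
    also have "\<dots> \<le> 3" using xs(1) by (simp add: numeral_eq_enat)
    finally show "commutator_length B g \<le> 3" .
  qed
  ultimately show ?thesis by (simp add: B_def)
qed

lemma short_products_iso:
  assumes A: "group A" and B: "group B" and \<phi>: "\<phi> \<in> iso B A" and P: "short_products B"
  shows "short_products A"
proof -
  interpret A: group A by (rule A)
  interpret B: group B by (rule B)
  interpret h: group_hom B A \<phi>
    using \<phi> A B by (simp add: group_hom_def group_hom_axioms_def iso_def)
  have im: "\<phi> ` carrier B = carrier A" using \<phi> by (auto simp: iso_def bij_betw_def)
  define D where "D = derived B (carrier B)"
  have D: "derived A (carrier A) = \<phi> ` D"
    unfolding D_def im[symmetric] by (rule h.derived_img) simp
  have DB: "D \<subseteq> carrier B" using B.derived_in_carrier[of "carrier B"] by (simp add: D_def)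
  have lm: "\<phi> (list_mult B xs) = list_mult A (map \<phi> xs)" if "set xs \<subseteq> carrier B" for xs
  proof -
    have "list_mult B xs \<in> carrier B \<and> list_mult A (map \<phi> xs) = \<phi> (list_mult B xs)"
      using that by (induction xs) (auto simp: list_mult_def)
    thus ?thesis by simp
  qed
  show ?thesis
    unfolding short_products_def Let_def D
  proof (intro conjI ballI)
    fix f h assume "f \<in> \<phi> ` D - {\<one>\<^bsub>A\<^esub>}" "h \<in> \<phi> ` D - {\<one>\<^bsub>A\<^esub>}"
    hence fh: "f \<in> \<phi> ` D" "h \<in> \<phi> ` D" and ne: "f \<noteq> \<phi> \<one>\<^bsub>B\<^esub>" "h \<noteq> \<phi> \<one>\<^bsub>B\<^esub>" by auto
    obtain f' where f': "f' \<in> D - {\<one>\<^bsub>B\<^esub>}" "f = \<phi> f'" using fh(1) ne(1) by blast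
    obtain h' where h': "h' \<in> D - {\<one>\<^bsub>B\<^esub>}" "h = \<phi> h'" using fh(2) ne(2) by blast
    from P f'(1) h'(1) obtain xs where xs: "length xs \<le> 9" "f' = list_mult B xs" "set xs \<subseteq> conjugates B D h'"
      unfolding short_products_def D_def[symmetric] Let_def by blast
    have "conjugates B D h' \<subseteq> carrier B" using DB h'(1) by (auto simp: conjugates_def subset_iff)
    moreover have "\<phi> ` conjugates B D h' = conjugates A (\<phi> ` D) h"
      using DB h' by (simp add: conjugates_def image_UN subset_iff)
    ultimately show "\<exists>xs. length xs \<le> 9 \<and> set xs \<subseteq> conjugates A (\<phi> ` D) h \<and> f = list_mult A xs"
      using xs lm[of xs] f'(2) by (intro exI[of _ "map \<phi> xs"]) auto
  next
    fix f assume "f \<in> \<phi> ` D"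
    then obtain f' where f': "f' \<in> D" "f = \<phi> f'" by auto
    from P f'(1) obtain xs where xs: "length xs \<le> 3" "f' = list_mult B xs" "set xs \<subseteq> derived_set B D"
      unfolding short_products_def D_def[symmetric] Let_def by blast
    have "derived_set B D \<subseteq> carrier B" using DB by (auto simp: subset_iff)
    from lm[OF order_trans[OF xs(3) this]] have l: "f = list_mult A (map \<phi> xs)" unfolding f'(2) xs(2) .
    have "\<phi> ` derived_set B D = derived_set A (\<phi> ` D)"
      using DB by (simp add: image_UN subset_iff)
    hence m: "set (map \<phi> xs) \<subseteq> derived_set A (\<phi> ` D)" using image_mono[OF xs(3), of \<phi>] by (simp only: set_map)
    show "\<exists>xs. length xs \<le> 3 \<and> set xs \<subseteq> derived_set A (\<phi> ` D) \<and> f = list_mult A xs"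
      by (intro exI[of _ "map \<phi> xs"] conjI m l) (use xs(1) in simp)
  qed
qed

context proximal_full_group
begin

definition perm_group :: "('x \<Rightarrow> 'x) monoid" where
  "perm_group = \<lparr>carrier = G, monoid.mult = (\<circ>), one = id\<rparr>"

lemma perm_group_simps [simp]:
  "carrier perm_group = G" "f \<otimes>\<^bsub>perm_group\<^esub> g = f \<circ> g" "\<one>\<^bsub>perm_group\<^esub> = id"
  by (simp_all add: perm_group_def)

lemma group_perm_group: "group perm_group"
proof (rule groupI)
  fix f assume "f \<in> carrier perm_group"
  thus "\<exists>g\<in>carrier perm_group. g \<otimes>\<^bsub>perm_group\<^esub> f = \<one>\<^bsub>perm_group\<^esub>"
    using G_inv G_bij by (auto intro!: bexI[of _ "pinv f"] simp: fun_eq_iff inv_apply)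
qed (auto simp: G_id G_comp comp_assoc simp del: o_apply id_apply)

lemma perm_group_inv: 
  assumes "f \<in> G" shows "inv\<^bsub>perm_group\<^esub> f = pinv f"
proof -
  have "pinv f \<circ> f = id" using G_bij[OF assms] by (simp add: fun_eq_iff inv_apply)
  thus ?thesis using assms G_inv group.inv_equality[OF group_perm_group, of "pinv f" f] by simp
qed

lemma derived_perm_group: "derived perm_group G = D"
proof
  interpret P: group perm_group by (rule group_perm_group)
  show "derived perm_group G \<subseteq> D"
  proof
    fix f assume "f \<in> derived perm_group G"
    hence "f \<in> generate perm_group (derived_set perm_group G)" by (simp add: derived_def)
    thus "f \<in> D"
    proof induction
      case one thus ?case using D_id by (simp only: perm_group_simps)
    next
      case (incl f)
      then obtain a b where "a \<in> G" "b \<in> G" "f = perm_comm a b"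
        by (auto simp: perm_comm_def perm_group_inv simp del: o_apply)
      thus ?case using D_comm by simp
    next
      case (inv f)
      then obtain a b where "a \<in> G" "b \<in> G" "f = perm_comm a b"
        by (auto simp: perm_comm_def perm_group_inv simp del: o_apply)
      hence "f \<in> D" using D_comm by simp
      thus ?case using D_inv D_G perm_group_inv by metis
    next
      case (eng f g) thus ?case using D_comp by (simp only: perm_group_simps)
    qed
  qed
  have sub: "subgroup (derived perm_group G) perm_group" by (rule P.derived_is_subgroup) simp
  show "D \<subseteq> derived perm_group G"
  proof
    fix f assume "f \<in> D"
    hence "f \<in> comm_prods G" by (simp add: D_def)
    thus "f \<in> derived perm_group G"
    proof (induction)
      case id thus ?case using subgroup.one_closed[OF sub] by (simp only: perm_group_simps)
    next
      case (step a b d)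
      have "perm_comm a b \<in> derived_set perm_group G"
        unfolding perm_comm_def perm_group_inv[OF step(1), symmetric] perm_group_inv[OF step(2), symmetric]
        using step(1,2) by (simp only: UN_iff singleton_iff perm_group_simps) blast
      hence "perm_comm a b \<in> derived perm_group G" by (simp add: derived_def generate.incl)
      thus ?case using subgroup.m_closed[OF sub _ step.IH] by (simp only: perm_group_simps)
    qed
  qed
qed

lemma short_products_perm_group: "short_products perm_group"
proof -
  have lm: "list_mult perm_group xs = foldr (\<circ>) xs id" for xs
    by (simp add: list_mult_def perm_group_def)
  have c: "conjs h \<subseteq> conjugates perm_group D h" if "h \<in> D" for h
    using that D_G by (auto simp: conjs_def conjugates_def perm_conj_def perm_group_inv simp del: o_apply)
  have d: "{perm_comm a b |a b. a \<in> D \<and> b \<in> D} \<subseteq> derived_set perm_group D"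
    using D_G by (auto simp: perm_comm_def perm_group_inv simp del: o_apply)
  show ?thesis
    unfolding short_products_def Let_def perm_group_simps(1,3) derived_perm_group lm
  proof (intro conjI ballI)
    fix f h assume "f \<in> D - {id}" "h \<in> D - {id}"
    hence fh: "f \<in> D" "f \<noteq> id" "h \<in> D" "h \<noteq> id" by auto
    from nine_conjugates[OF this] obtain xs where
      xs: "length xs \<le> 9" "f = foldr (\<circ>) xs id" "set xs \<subseteq> conjs h" by blast
    show "\<exists>xs. length xs \<le> 9 \<and> set xs \<subseteq> conjugates perm_group D h \<and> f = foldr (\<circ>) xs id"
      by (intro exI[of _ xs] conjI xs order_trans[OF xs(3) c[OF fh(3)]])
  next
    fix f assume "f \<in> D"
    from three_commutators[OF this] obtain xs where xs: "length xs \<le> 3" "f = foldr (\<circ>) xs id"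
      "set xs \<subseteq> {perm_comm a b |a b. a \<in> D \<and> b \<in> D}" by blast
    show "\<exists>xs. length xs \<le> 3 \<and> set xs \<subseteq> derived_set perm_group D \<and> f = foldr (\<circ>) xs id"
      by (intro exI[of _ xs] conjI xs order_trans[OF xs(3) d])
  qed
qed

theorem uniformly_simple_iso:
  assumes "group A" "\<phi> \<in> iso perm_group A"
  shows "uniformly_simple 9 (commutator_subgroup A) \<and> commutator_width (commutator_subgroup A) \<le> 3"
  by (rule short_products_imp[OF assms(1) short_products_iso[OF assms(1) group_perm_group assms(2) short_products_perm_group]])

end

section \<open>Locally similar homeomorphisms of a Cantor set\<close>

definition seqs :: "nat \<Rightarrow> nat word set" where
  "seqs q = {y. \<forall>i. y i < q}"

definition points :: "nat \<Rightarrow> nat \<Rightarrow> nat word set" where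
  "points q r = {x. x 0 < r \<and> (\<forall>i. x (Suc i) < q)}"

definition tree_words :: "nat \<Rightarrow> nat \<Rightarrow> nat list set" where
  "tree_words q r = {u. \<forall>i<length u. u ! i < (if i = 0 then r else q)}"

lemma prefix_eq_iff: "prefix n x = prefix n y \<longleftrightarrow> (\<forall>i<n. x i = y i)"
  by (auto simp: list_eq_iff_nth_eq)

lemma prefix_eq_le: "prefix n x = prefix n y \<Longrightarrow> m \<le> n \<Longrightarrow> prefix m x = prefix m y"
  by (auto simp: prefix_eq_iff)

lemma build_suffix: "y 0 = a \<Longrightarrow> a ## suffix (Suc 0) y = y"
  using build_first[of y] by simp

lemma suffix_build: "suffix (Suc 0) (a ## y) = y"
  by (simp add: fun_eq_iff)

lemma tree_words_Nil [simp]: "[] \<in> tree_words q r"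
  by (simp add: tree_words_def)

lemma tree_words_append: "u \<noteq> [] \<Longrightarrow> u @ s \<in> tree_words q r \<longleftrightarrow> u \<in> tree_words q r \<and> set s \<subseteq> {..<q}"
proof
  assume u: "u \<noteq> []" and us: "u @ s \<in> tree_words q r"
  have "u ! i < (if i = 0 then r else q)" if "i < length u" for i
    using us that by (auto simp: tree_words_def nth_append dest!: spec[of _ i])
  moreover have "s ! i < q" if "i < length s" for i
    using us u that unfolding tree_words_def by (auto simp: nth_append dest!: spec[of _ "length u + i"])
  ultimately show "u \<in> tree_words q r \<and> set s \<subseteq> {..<q}"
    by (auto simp: tree_words_def in_set_conv_nth)
next
  assume "u \<noteq> []" "u \<in> tree_words q r \<and> set s \<subseteq> {..<q}"
  thus "u @ s \<in> tree_words q r"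
    by (auto simp: tree_words_def nth_append subset_iff)
qed

lemma finite_tree_words: "finite {u \<in> tree_words q r. length u = n}"
proof (rule finite_subset)
  show "{u \<in> tree_words q r. length u = n} \<subseteq> {xs. set xs \<subseteq> {..<max q r} \<and> length xs = n}"
    by (auto simp: tree_words_def in_set_conv_nth less_max_iff_disj split: if_splits)
  show "finite {xs. set xs \<subseteq> {..<max q r} \<and> length xs = n}"
    by (rule finite_lists_length_eq) simp
qed

lemma seqs_conc: "s \<frown> y \<in> seqs q \<longleftrightarrow> set s \<subseteq> {..<q} \<and> y \<in> seqs q"
proof
  assume s: "s \<frown> y \<in> seqs q"
  have "s ! i < q" if "i < length s" for i
    using s that by (auto simp: seqs_def conc_def dest!: spec[of _ i])
  moreover have "y i < q" for i
    using s by (auto simp: seqs_def conc_def dest!: spec[of _ "length s + i"])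
  ultimately show "set s \<subseteq> {..<q} \<and> y \<in> seqs q" by (auto simp: seqs_def in_set_conv_nth)
qed (auto simp: seqs_def conc_def subset_iff)

lemma seqs_build: "i ## y \<in> seqs q \<longleftrightarrow> i < q \<and> y \<in> seqs q"
  using seqs_conc[of "[i]" y q] by simp

lemma points_conc: "u \<in> tree_words q r \<Longrightarrow> u \<noteq> [] \<Longrightarrow> y \<in> seqs q \<Longrightarrow> u \<frown> y \<in> points q r"
  by (auto simp: points_def tree_words_def seqs_def conc_def)

lemma prefix_points: "x \<in> points q r \<Longrightarrow> prefix n x \<in> tree_words q r"
  by (auto simp: points_def tree_words_def gr0_conv_Suc)

lemma suffix_points: "x \<in> points q r \<Longrightarrow> n > 0 \<Longrightarrow> suffix n x \<in> seqs q"
  by (auto simp: points_def seqs_def gr0_conv_Suc)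

lemma suffix_seqs: "x \<in> seqs q \<Longrightarrow> suffix n x \<in> seqs q"
  by (auto simp: seqs_def)

lemma prefix_seqs: "x \<in> seqs q \<Longrightarrow> set (prefix n x) \<subseteq> {..<q}"
  by (auto simp: seqs_def)

text \<open>The members of \<open>K\<close> are functions on all words, but only their values on
  \<open>seqs q\<close> matter; hence inverses are required merely there. \<open>K_section\<close>
  is the self-similarity: past the first letter a member acts again as a member.\<close>

locale self_similar =
  fixes q r :: nat and K :: "(nat word \<Rightarrow> nat word) set"
  assumes q: "q \<ge> 2" and r: "r \<ge> 1"
    and K_id: "id \<in> K"
    and K_seqs: "\<kappa> \<in> K \<Longrightarrow> y \<in> seqs q \<Longrightarrow> \<kappa> y \<in> seqs q"
    and K_comp: "\<kappa> \<in> K \<Longrightarrow> \<kappa>' \<in> K \<Longrightarrow> \<kappa> \<circ> \<kappa>' \<in> K"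
    and K_inv: "\<kappa> \<in> K \<Longrightarrow> \<exists>\<kappa>'\<in>K. \<forall>y\<in>seqs q. \<kappa>' (\<kappa> y) = y \<and> \<kappa> (\<kappa>' y) = y"
    and K_section: "\<kappa> \<in> K \<Longrightarrow> i < q \<Longrightarrow> \<exists>j<q. \<exists>\<kappa>'\<in>K. \<forall>y\<in>seqs q. \<kappa> (i ## y) = j ## \<kappa>' y"
begin

abbreviation \<Omega> where "\<Omega> \<equiv> points q r"

abbreviation cells where "cells \<equiv> tree_words q r - {[]}"

definition piece :: "(nat word \<Rightarrow> nat word) \<Rightarrow> nat list \<Rightarrow> nat list \<Rightarrow> bool" where
  "piece f u v \<longleftrightarrow> (\<exists>\<kappa>\<in>K. \<forall>y\<in>seqs q. f (u \<frown> y) = v \<frown> \<kappa> y)"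

text \<open>One depth for all cells takes the place of a compactness argument.\<close>

definition locally_similar :: "(nat word \<Rightarrow> nat word) \<Rightarrow> bool" where
  "locally_similar f \<longleftrightarrow> (\<exists>n>0. \<forall>u\<in>cells. length u = n \<longrightarrow> (\<exists>v\<in>cells. piece f u v))"

definition clopens :: "nat word set set" where
  "clopens = {A. A \<subseteq> \<Omega> \<and> (\<exists>n. \<forall>x\<in>A. \<forall>y\<in>\<Omega>. prefix n x = prefix n y \<longrightarrow> y \<in> A)}"

text \<open>Being the identity off \<open>\<Omega>\<close> makes these permutations of the whole
  type, so the group operations are plain composition and inversion.\<close>

definition homeos :: "(nat word \<Rightarrow> nat word) set" where
  "homeos = {f. bij f \<and> supp_in \<Omega> f \<and> locally_similar f}"

section \<open>Pieces, depths and closure under the group operations\<close>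

lemma K_section_word:
  "\<kappa> \<in> K \<Longrightarrow> set s \<subseteq> {..<q} \<Longrightarrow>
    \<exists>s' \<kappa>'. length s' = length s \<and> set s' \<subseteq> {..<q} \<and> \<kappa>' \<in> K \<and> (\<forall>y\<in>seqs q. \<kappa> (s \<frown> y) = s' \<frown> \<kappa>' y)"
proof (induction s arbitrary: \<kappa>)
  case Nil
  thus ?case by (intro exI[of _ "[]"]) auto
next
  case (Cons i s)
  then obtain j \<kappa>1 where j: "j < q" "\<kappa>1 \<in> K" "\<And>y. y \<in> seqs q \<Longrightarrow> \<kappa> (i ## y) = j ## \<kappa>1 y"
    using K_section[of \<kappa> i] by auto
  obtain s' \<kappa>' where s: "length s' = length s" "set s' \<subseteq> {..<q}" "\<kappa>' \<in> K" "\<forall>y\<in>seqs q. \<kappa>1 (s \<frown> y) = s' \<frown> \<kappa>' y"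
    using Cons.IH[OF j(2)] Cons.prems by auto
  show ?case
    using j s Cons.prems by (intro exI[of _ "j # s'"] exI[of _ \<kappa>']) (auto simp: seqs_conc)
qed

lemma piece_comp: "piece g u v \<Longrightarrow> piece f v w \<Longrightarrow> piece (f \<circ> g) u w"
  unfolding piece_def using K_comp K_seqs by (metis comp_apply)

lemma piece_cong: "piece f u v \<Longrightarrow> (\<And>y. y \<in> seqs q \<Longrightarrow> g (u \<frown> y) = f (u \<frown> y)) \<Longrightarrow> piece g u v"
  by (simp add: piece_def)

lemma pieceI: "(\<And>y. y \<in> seqs q \<Longrightarrow> f (u \<frown> y) = v \<frown> y) \<Longrightarrow> piece f u v"
  unfolding piece_def using K_id by (intro bexI[of _ id]) auto

text \<open>Self-similarity of \<open>K\<close>: a piece restricts to smaller cones, and its target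
  grows by as many letters as its source.\<close>

lemma piece_extend:
  assumes "piece f u v" "set s \<subseteq> {..<q}"
  shows "\<exists>s'. length s' = length s \<and> set s' \<subseteq> {..<q} \<and> piece f (u @ s) (v @ s')"
proof -
  obtain \<kappa> where k: "\<kappa> \<in> K" "\<And>y. y \<in> seqs q \<Longrightarrow> f (u \<frown> y) = v \<frown> \<kappa> y"
    using assms(1) by (auto simp: piece_def)
  obtain s' \<kappa>' where s: "length s' = length s" "set s' \<subseteq> {..<q}" "\<kappa>' \<in> K" "\<forall>y\<in>seqs q. \<kappa> (s \<frown> y) = s' \<frown> \<kappa>' y"
    using K_section_word[OF k(1) assms(2)] by auto
  have "f ((u @ s) \<frown> y) = (v @ s') \<frown> \<kappa>' y" if "y \<in> seqs q" for y
  proof -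
    have "s \<frown> y \<in> seqs q" using that assms(2) by (simp add: seqs_conc)
    from k(2)[OF this] show ?thesis using s(4) that by (simp flip: conc_conc)
  qed
  thus ?thesis using s unfolding piece_def by blast
qed

lemma cells_append: "u \<in> cells \<Longrightarrow> u @ s \<in> cells \<longleftrightarrow> set s \<subseteq> {..<q}"
  by (auto simp: tree_words_append)

lemma cells_split:
  assumes "w \<in> cells" "0 < n" "n \<le> length w"
  shows "take n w \<in> cells" "set (drop n w) \<subseteq> {..<q}"
  using assms tree_words_append[of "take n w" "drop n w" q r] by auto

lemma cells_prefix: "x \<in> \<Omega> \<Longrightarrow> n > 0 \<Longrightarrow> prefix n x \<in> cells"
  by (simp add: prefix_points)

text \<open>A quantitative form of local similarity: \<open>m\<close> extra letters in the source
  force more than \<open>m\<close> letters in the target. This supplies the depth needed by a second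
  map and the modulus of continuity.\<close>

definition deep :: "(nat word \<Rightarrow> nat word) \<Rightarrow> nat \<Rightarrow> bool" where
  "deep f n \<longleftrightarrow> n > 0 \<and>
     (\<forall>m. \<forall>u\<in>cells. length u \<ge> n + m \<longrightarrow> (\<exists>v\<in>cells. length v > m \<and> piece f u v))"

lemma deepD:
  "deep f n \<Longrightarrow> n > 0"
  "deep f n \<Longrightarrow> u \<in> cells \<Longrightarrow> length u \<ge> n + m \<Longrightarrow> \<exists>v\<in>cells. length v > m \<and> piece f u v"
  unfolding deep_def by blast+

lemma locally_similar_deep:
  assumes "locally_similar f"
  obtains n where "deep f n"
proof -
  obtain n where n: "n > 0" "\<And>u. u \<in> cells \<Longrightarrow> length u = n \<Longrightarrow> \<exists>v\<in>cells. piece f u v"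
    using assms by (auto simp: locally_similar_def)
  have "\<exists>v\<in>cells. length v > m \<and> piece f u v" if u: "u \<in> cells" "length u \<ge> n + m" for m u
  proof -
    have t: "take n u \<in> cells" "set (drop n u) \<subseteq> {..<q}" using cells_split[of u n] u n by auto
    then obtain v where v: "v \<in> cells" "piece f (take n u) v" using n(2)[of "take n u"] u by auto
    obtain s' where "length s' = length (drop n u)" "set s' \<subseteq> {..<q}" "piece f (take n u @ drop n u) (v @ s')"
      using piece_extend[OF v(2) t(2)] by auto
    moreover have "length v > 0" using v by auto
    moreover have "v @ s' \<in> cells" using v calculation cells_append by blast
    moreover have "length (v @ s') > m" using calculation(1,4) u(2) by (simp add: Suc_le_eq[symmetric])
    ultimately show ?thesis by (intro bexI[of _ "v @ s'"]) auto
  qed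
  thus ?thesis using that[of n] n by (simp add: deep_def)
qed

text \<open>Every cell is a prefix of a point, obtained by padding with zeros.\<close>

lemma locally_similarI:
  assumes "n > 0" "\<And>x. x \<in> \<Omega> \<Longrightarrow> \<exists>v\<in>cells. piece f (prefix n x) v"
  shows "locally_similar f"
  unfolding locally_similar_def
proof (intro exI[of _ n] conjI assms(1) ballI impI)
  fix u assume u: "u \<in> cells" "length u = n"
  have "u \<frown> (\<lambda>_. 0) \<in> \<Omega>" using u q by (intro points_conc) (auto simp: seqs_def)
  from assms(2)[OF this] show "\<exists>v\<in>cells. piece f u v" using u by simp
qed

lemma locally_similar_comp:
  assumes f: "locally_similar f" and g: "locally_similar g"
  shows "locally_similar (f \<circ> g)"
proof -
  obtain n where "deep f n" using locally_similar_deep[OF f] .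
  note n = deepD[OF this]
  obtain k where "deep g k" using locally_similar_deep[OF g] .
  note k = deepD[OF this]
  show ?thesis
    unfolding locally_similar_def
  proof (intro exI[of _ "k + n"] conjI ballI impI)
    fix u assume u: "u \<in> cells" "length u = k + n"
    then obtain v where v: "v \<in> cells" "length v > n" "piece g u v" using k(2)[of u n] by auto
    then obtain w where "w \<in> cells" "piece f v w" using n(2)[of v 0] by auto
    thus "\<exists>w\<in>cells. piece (f \<circ> g) u w" using piece_comp[OF v(3)] by blast
  qed (use k in simp)
qed

lemma locally_similar_id: "locally_similar id"
proof (rule locally_similarI[of 1])
  fix x assume "x \<in> \<Omega>"
  hence "prefix 1 x \<in> cells" by (rule cells_prefix) simp
  moreover have "piece id (prefix 1 x) (prefix 1 x)" by (rule pieceI) simp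
  ultimately show "\<exists>v\<in>cells. piece id (prefix 1 x) v" by blast
qed simp

lemma locally_similar_points:
  assumes "locally_similar f" "x \<in> \<Omega>"
  shows "f x \<in> \<Omega>"
proof -
  obtain n where "deep f n" using locally_similar_deep[OF assms(1)] .
  note n = deepD[OF this]
  obtain v \<kappa> where v: "v \<in> cells" "\<kappa> \<in> K" "\<forall>y\<in>seqs q. f (prefix n x \<frown> y) = v \<frown> \<kappa> y"
    using n(2)[of "prefix n x" 0] cells_prefix[OF assms(2) n(1)] by (auto simp: piece_def)
  have s: "suffix n x \<in> seqs q" using suffix_points assms n by auto
  hence "f x = v \<frown> \<kappa> (suffix n x)" using v(3) by (metis prefix_suffix)
  thus ?thesis using v K_seqs[OF v(2) s] by (auto intro: points_conc)
qed

lemma locally_similar_continuous: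
  assumes "locally_similar f"
  shows "\<exists>n. \<forall>x\<in>\<Omega>. \<forall>y\<in>\<Omega>. prefix n x = prefix n y \<longrightarrow> prefix m (f x) = prefix m (f y)"
proof -
  obtain n where "deep f n" using locally_similar_deep[OF assms(1)] .
  note n = deepD[OF this]
  have "prefix m (f x) = prefix m (f y)" if xy: "x \<in> \<Omega>" "y \<in> \<Omega>" and e: "prefix (n + m) x = prefix (n + m) y" for x y
  proof -
    have nm: "n + m > 0" using n(1) by simp
    obtain v where v: "length v > m" "piece f (prefix (n + m) x) v"
      using n(2)[OF cells_prefix[OF xy(1) nm], of m] by auto
    obtain \<kappa> where k: "\<And>z. z \<in> seqs q \<Longrightarrow> f (prefix (n + m) x \<frown> z) = v \<frown> \<kappa> z"
      using v(2) by (auto simp: piece_def)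
    have "f x = v \<frown> \<kappa> (suffix (n + m) x)" "f y = v \<frown> \<kappa> (suffix (n + m) y)"
      using k[OF suffix_points[OF xy(1) nm]] k[OF suffix_points[OF xy(2) nm]]
      by (simp_all only: e prefix_suffix[symmetric]) (simp only: e[symmetric] prefix_suffix[symmetric])?
    thus ?thesis using v(1) by simp
  qed
  thus ?thesis by blast
qed

text \<open>The quantification over all \<open>m \<ge> n\<close> allows depths of several sets to be
  merged by adding them.\<close>

definition depends_on :: "nat word set \<Rightarrow> nat \<Rightarrow> bool" where
  "depends_on A n \<longleftrightarrow> (\<forall>m\<ge>n. \<forall>x\<in>\<Omega>. \<forall>y\<in>\<Omega>. prefix m x = prefix m y \<longrightarrow> (x \<in> A \<longleftrightarrow> y \<in> A))"

lemma depends_onD: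
  "depends_on A n \<Longrightarrow> n \<le> m \<Longrightarrow> x \<in> \<Omega> \<Longrightarrow> y \<in> \<Omega> \<Longrightarrow> prefix m x = prefix m y \<Longrightarrow> x \<in> A \<longleftrightarrow> y \<in> A"
  unfolding depends_on_def by blast

lemma clopens_depth:
  assumes "A \<in> clopens"
  obtains n where "depends_on A n"
proof -
  obtain n where n: "\<forall>x\<in>A. \<forall>y\<in>\<Omega>. prefix n x = prefix n y \<longrightarrow> y \<in> A" and A: "A \<subseteq> \<Omega>"
    using assms by (auto simp: clopens_def)
  have "x \<in> A \<longleftrightarrow> y \<in> A" if "n \<le> m" "x \<in> \<Omega>" "y \<in> \<Omega>" "prefix m x = prefix m y" for m x y
    using n that prefix_eq_le[OF that(4,1)] by metis
  thus ?thesis using that unfolding depends_on_def by blast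
qed

lemma clopensI:
  assumes "A \<subseteq> \<Omega>" "\<And>x y. x \<in> \<Omega> \<Longrightarrow> y \<in> \<Omega> \<Longrightarrow> prefix n x = prefix n y \<Longrightarrow> x \<in> A \<Longrightarrow> y \<in> A"
  shows "A \<in> clopens"
  using assms by (auto simp: clopens_def)

text \<open>Below the depths of all four data each cone lies in \<open>A\<close>, in
  \<open>B\<close>, or outside both, and there one of the three formulas holds throughout.\<close>

lemma locally_similar_glue:
  assumes f: "locally_similar f" and g: "locally_similar g" and A: "A \<in> clopens" and B: "B \<in> clopens"
    and h: "\<And>x. x \<in> A \<Longrightarrow> h x = f x" "\<And>x. x \<in> B \<Longrightarrow> h x = g x" "\<And>x. x \<in> \<Omega> - (A \<union> B) \<Longrightarrow> h x = x"
  shows "locally_similar h"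
proof -
  obtain n1 where "deep f n1" using locally_similar_deep[OF f] .
  note n1 = deepD(2)[OF this]
  obtain n2 where "deep g n2" using locally_similar_deep[OF g] .
  note n2 = deepD(2)[OF this]
  obtain n3 where "depends_on A n3" using clopens_depth[OF A] .
  note n3 = depends_onD[OF this]
  obtain n4 where "depends_on B n4" using clopens_depth[OF B] .
  note n4 = depends_onD[OF this]
  define n where "n = Suc (n1 + n2 + n3 + n4)"
  have n0: "n > 0" by (simp add: n_def)
  show ?thesis
  proof (rule locally_similarI[OF n0])
    fix x assume x: "x \<in> \<Omega>"
    define u where "u = prefix n x"
    have u: "u \<in> cells" "length u = n" using cells_prefix[OF x n0] by (auto simp: u_def)
    have cone: "u \<frown> y \<in> \<Omega>" "u \<frown> y \<in> A \<longleftrightarrow> x \<in> A" "u \<frown> y \<in> B \<longleftrightarrow> x \<in> B" if "y \<in> seqs q" for y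
    proof -
      show p: "u \<frown> y \<in> \<Omega>" using u that by (auto intro: points_conc)
      have e: "prefix n (u \<frown> y) = prefix n x" using u(2) by (simp add: u_def)
      show "u \<frown> y \<in> A \<longleftrightarrow> x \<in> A" using n3[OF _ p x e] by (simp add: n_def)
      show "u \<frown> y \<in> B \<longleftrightarrow> x \<in> B" using n4[OF _ p x e] by (simp add: n_def)
    qed
    consider "x \<in> A" | "x \<in> B" | "x \<notin> A" "x \<notin> B" by blast
    thus "\<exists>v\<in>cells. piece h (prefix n x) v"
    proof cases
      case 1
      obtain v where "v \<in> cells" "piece f u v" using n1[of u 0] u by (auto simp: n_def)
      moreover from this(2) have "piece h u v" using cone(2) h(1) 1 by (rule_tac piece_cong) auto
      ultimately show ?thesis unfolding u_def[symmetric] by blast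
    next
      case 2
      obtain v where "v \<in> cells" "piece g u v" using n2[of u 0] u by (auto simp: n_def)
      moreover from this(2) have "piece h u v" using cone(3) h(2) 2 by (rule_tac piece_cong) auto
      ultimately show ?thesis unfolding u_def[symmetric] by blast
    next
      case 3
      have "piece h u u" using cone 3 h(3) by (intro pieceI) auto
      thus ?thesis using u unfolding u_def[symmetric] by blast
    qed
  qed
qed

lemma homeos_points: "f \<in> homeos \<Longrightarrow> f x \<in> \<Omega> \<longleftrightarrow> x \<in> \<Omega>"
  unfolding homeos_def using locally_similar_points by (force simp: supp_in_def)

lemma homeos_inv_points:
  assumes "f \<in> homeos" shows "pinv f x \<in> \<Omega> \<longleftrightarrow> x \<in> \<Omega>"
proof -
  have "bij f" using assms by (simp add: homeos_def)
  thus ?thesis using homeos_points[OF assms, of "pinv f x"] by (simp add: inv_apply)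
qed

text \<open>The image cones of the cells of length \<open>n\<close> cover the space, so every
  sufficiently long cell \<open>w\<close> lies below some \<open>t u\<close>. There the inverse map
  strips \<open>t u\<close>, applies the inverse twist, and puts \<open>u\<close> back in
  front.\<close>

lemma homeos_inv:
  assumes f: "f \<in> homeos"
  shows "pinv f \<in> homeos"
proof -
  have b: "bij f" and s: "supp_in \<Omega> f" and l: "locally_similar f" using f by (auto simp: homeos_def)
  obtain n where "deep f n" using locally_similar_deep[OF l] .
  note n = deepD[OF this]
  obtain t where t: "\<And>u. u \<in> cells \<Longrightarrow> length u = n \<Longrightarrow> t u \<in> cells \<and> piece f u (t u)"
    using n(2)[of _ 0] by (metis add_0_right order_refl)
  \<comment> \<open>The sum is a crude bound for all the lengths of the words
    \<open>t u\<close>.\<close>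
  define N where "N = Suc (\<Sum>u\<in>{u \<in> tree_words q r. length u = n}. length (t u))"
  have N: "length (t u) \<le> N" if "u \<in> cells" "length u = n" for u
    unfolding N_def using that finite_tree_words member_le_sum[of u "{u \<in> tree_words q r. length u = n}" "\<lambda>u. length (t u)"]
    by auto
  have "locally_similar (pinv f)"
    unfolding locally_similar_def
  proof (intro exI[of _ N] conjI ballI impI)
    show "N > 0" by (simp add: N_def)
    fix w assume w: "w \<in> cells" "length w = N"
    have z0: "(\<lambda>_. 0) \<in> seqs q" using q by (auto simp: seqs_def)
    \<comment> \<open>The preimage of this one point of the cone of \<open>w\<close> reveals the
      cell \<open>u\<close> that belongs to \<open>w\<close>.\<close>
    define x where "x = w \<frown> (\<lambda>_. 0)"
    have x: "x \<in> \<Omega>" unfolding x_def using w z0 by (auto intro: points_conc)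
    define x' where "x' = pinv f x"
    have x': "x' \<in> \<Omega>" "f x' = x" using homeos_inv_points[OF f] x b by (auto simp: x'_def inv_apply)
    define u where "u = prefix n x'"
    have u: "u \<in> cells" "length u = n" using cells_prefix[OF x'(1) n(1)] by (auto simp: u_def)
    obtain \<kappa> where k: "\<kappa> \<in> K" "\<And>y. y \<in> seqs q \<Longrightarrow> f (u \<frown> y) = t u \<frown> \<kappa> y"
      using t[OF u] by (auto simp: piece_def)
    have "x = t u \<frown> \<kappa> (suffix n x')"
      using k(2)[OF suffix_points[OF x'(1) n(1)]] x'(2) by (simp add: u_def)
    hence "prefix (length (t u)) x = t u" by simp
    moreover have "prefix (length (t u)) x = take (length (t u)) w"
      using N[OF u] w by (simp add: x_def)
    ultimately have ws: "w = t u @ drop (length (t u)) w" by (metis append_take_drop_id)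
    define s where "s = drop (length (t u)) w"
    have s: "set s \<subseteq> {..<q}" "w = t u @ s"
      using ws w(1) cells_append[of "t u" s] t[OF u] by (auto simp: s_def)
    obtain \<kappa>' where k': "\<kappa>' \<in> K" "\<forall>y\<in>seqs q. \<kappa>' (\<kappa> y) = y \<and> \<kappa> (\<kappa>' y) = y" using K_inv[OF k(1)] by auto
    obtain s' \<kappa>'' where s': "length s' = length s" "set s' \<subseteq> {..<q}" "\<kappa>'' \<in> K" "\<forall>y\<in>seqs q. \<kappa>' (s \<frown> y) = s' \<frown> \<kappa>'' y"
      using K_section_word[OF k'(1) s(1)] by auto
    have "pinv f (w \<frown> y) = (u @ s') \<frown> \<kappa>'' y" if y: "y \<in> seqs q" for y
    proof -
      have sy: "s \<frown> y \<in> seqs q" using s y by (simp add: seqs_conc)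
      have "f ((u @ s') \<frown> \<kappa>'' y) = f (u \<frown> \<kappa>' (s \<frown> y))" using s'(4) y by (simp flip: conc_conc)
      also have "\<dots> = t u \<frown> (s \<frown> y)" using k(2)[OF K_seqs[OF k'(1) sy]] k'(2) sy by simp
      also have "\<dots> = w \<frown> y" by (simp add: s(2))
      finally show ?thesis using b by (metis inv_apply(1))
    qed
    hence "piece (pinv f) w (u @ s')" using s'(3) by (auto simp: piece_def)
    moreover have "u @ s' \<in> cells" using u s' cells_append by blast
    ultimately show "\<exists>v\<in>cells. piece (pinv f) w v" by blast
  qed
  thus ?thesis using b s by (simp add: homeos_def supp_in_inv bij_imp_bij_inv)
qed

section \<open>Clopen sets\<close>

lemma clopens_Un: "A \<in> clopens \<Longrightarrow> B \<in> clopens \<Longrightarrow> A \<union> B \<in> clopens"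
proof -
  assume A: "A \<in> clopens" and B: "B \<in> clopens"
  obtain n where "depends_on A n" using clopens_depth[OF A] .
  note n = depends_onD[OF this]
  obtain k where "depends_on B k" using clopens_depth[OF B] .
  note k = depends_onD[OF this]
  show ?thesis
  proof (rule clopensI)
    fix x y assume "x \<in> \<Omega>" "y \<in> \<Omega>" "prefix (n + k) x = prefix (n + k) y"
    from n[OF le_add1 this] k[OF le_add2 this] show "x \<in> (A \<union> B) \<Longrightarrow> y \<in> A \<union> B" by blast
  qed (use A B in \<open>auto simp: clopens_def\<close>)
qed

lemma clopens_Diff: "A \<in> clopens \<Longrightarrow> B \<in> clopens \<Longrightarrow> A - B \<in> clopens"
proof -
  assume A: "A \<in> clopens" and B: "B \<in> clopens"
  obtain n where "depends_on A n" using clopens_depth[OF A] .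
  note n = depends_onD[OF this]
  obtain k where "depends_on B k" using clopens_depth[OF B] .
  note k = depends_onD[OF this]
  show ?thesis
  proof (rule clopensI)
    fix x y assume "x \<in> \<Omega>" "y \<in> \<Omega>" "prefix (n + k) x = prefix (n + k) y"
    from n[OF le_add1 this] k[OF le_add2 this] show "x \<in> A - B \<Longrightarrow> y \<in> A - B" by blast
  qed (use A B in \<open>auto simp: clopens_def\<close>)
qed

lemma clopens_vimage:
  assumes f: "locally_similar f" and A: "A \<in> clopens"
  shows "{x \<in> \<Omega>. f x \<in> A} \<in> clopens"
proof -
  obtain n where "depends_on A n" using clopens_depth[OF A] .
  note n = depends_onD[OF this]
  obtain k where k: "\<forall>x\<in>\<Omega>. \<forall>y\<in>\<Omega>. prefix k x = prefix k y \<longrightarrow> prefix n (f x) = prefix n (f y)"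
    using locally_similar_continuous[OF f] by blast
  show ?thesis
  proof (rule clopensI)
    fix x y assume xy: "x \<in> \<Omega>" "y \<in> \<Omega>" and e: "prefix k x = prefix k y"
    have "prefix n (f x) = prefix n (f y)" using k xy e by blast
    from n[OF order_refl locally_similar_points[OF f xy(1)] locally_similar_points[OF f xy(2)] this]
    show "x \<in> {x \<in> \<Omega>. f x \<in> A} \<Longrightarrow> y \<in> {x \<in> \<Omega>. f x \<in> A}" using xy by simp
  qed auto
qed

lemma clopens_image:
  assumes "f \<in> homeos" "A \<in> clopens"
  shows "f ` A \<in> clopens"
proof -
  have b: "bij f" using assms by (simp add: homeos_def)
  have "f ` A = {x \<in> \<Omega>. pinv f x \<in> A}"
  proof (intro Set.set_eqI iffI)
    fix x assume "x \<in> f ` A"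
    then obtain a where a: "a \<in> A" "x = f a" by auto
    hence "a \<in> \<Omega>" using assms(2) by (auto simp: clopens_def)
    thus "x \<in> {x \<in> \<Omega>. pinv f x \<in> A}" using a b homeos_points[OF assms(1)] by (simp add: inv_apply)
  next
    fix x assume "x \<in> {x \<in> \<Omega>. pinv f x \<in> A}"
    moreover have "x = f (pinv f x)" using b by (simp add: inv_apply)
    ultimately show "x \<in> f ` A" by blast
  qed
  thus ?thesis using clopens_vimage[of "pinv f" A] homeos_inv[OF assms(1)] assms(2) by (simp add: homeos_def)
qed

lemma cylinder_clopen: "{y \<in> \<Omega>. P (prefix n y)} \<in> clopens"
  by (rule clopensI[of _ n]) auto

lemma clopens_split:
  assumes "A \<in> clopens" "A \<noteq> {}"
  shows "\<exists>B\<in>clopens. \<exists>C\<in>clopens. B \<noteq> {} \<and> C \<noteq> {} \<and> B \<inter> C = {} \<and> B \<union> C \<subseteq> A"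
proof -
  obtain n where "depends_on A n" using clopens_depth[OF assms(1)] .
  note n = depends_onD[OF this]
  obtain x where x: "x \<in> A" "x \<in> \<Omega>" using assms by (auto simp: clopens_def)
  define m where "m = Suc n"
  have m: "m > 0" "n \<le> m" by (simp_all add: m_def)
  \<comment> \<open>The letter after the prefix separates the two parts; \<open>0\<close> and
    \<open>1\<close> are admissible because \<open>q \<ge> 2\<close>.\<close>
  define S where "S i = {y \<in> \<Omega>. prefix (Suc m) y = prefix m x @ [i]}" for i
  have c: "S i \<in> clopens" for i unfolding S_def by (rule cylinder_clopen)
  have ne: "S i \<noteq> {}" if "i < q" for i
  proof -
    have "prefix m x @ [i] \<in> cells"
      using cells_append[OF cells_prefix[OF x(2) m(1)], of "[i]"] that by simp
    moreover have "(\<lambda>_. 0) \<in> seqs q" using q by (simp add: seqs_def)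
    ultimately have "(prefix m x @ [i]) \<frown> (\<lambda>_. 0) \<in> \<Omega>"
      by (simp add: points_conc del: build_append conc_conc)
    moreover have "prefix (Suc m) ((prefix m x @ [i]) \<frown> (\<lambda>_. 0)) = prefix m x @ [i]"
      using prefix_conc_length[of "prefix m x @ [i]"] by (simp del: build_append)
    ultimately show ?thesis unfolding S_def by blast
  qed
  have sub: "S i \<subseteq> A" for i
  proof
    fix y assume "y \<in> S i"
    hence "y \<in> \<Omega>" "prefix m y @ [y m] = prefix m x @ [i]" by (auto simp: S_def)
    thus "y \<in> A" using n[OF m(2), of y x] x by auto
  qed
  have "S 0 \<inter> S 1 = {}" by (auto simp: S_def)
  thus ?thesis using c ne[of 0] ne[of 1] q sub
    by (intro bexI[of _ "S 0"] bexI[of _ "S 1"] conjI) auto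
qed

lemma homeos_displace:
  assumes g: "g \<in> homeos" "g \<noteq> id"
  shows "\<exists>U\<in>clopens. U \<noteq> {} \<and> g ` U \<inter> U = {}"
proof -
  obtain x where x: "g x \<noteq> x" using g(2) by (auto simp: fun_eq_iff)
  have xO: "x \<in> \<Omega>" using x g by (auto simp: homeos_def supp_in_def)
  obtain i where i: "g x i \<noteq> x i" using x by (auto simp: fun_eq_iff)
  have ls: "locally_similar g" using g by (simp add: homeos_def)
  obtain k where k: "\<forall>a\<in>\<Omega>. \<forall>y\<in>\<Omega>. prefix k a = prefix k y \<longrightarrow> prefix (Suc i) (g a) = prefix (Suc i) (g y)"
    using locally_similar_continuous[OF ls] by blast
  \<comment> \<open>Depth \<open>k\<close> controls the first \<open>i + 1\<close> letters of the
    images, and depth \<open>i + 1\<close> makes the letter at which \<open>x\<close> and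
    \<open>g x\<close> differ visible in \<open>U\<close>.\<close>
  define n where "n = max k (Suc i)"
  define U where "U = {y \<in> \<Omega>. prefix n y = prefix n x}"
  have "U \<in> clopens" unfolding U_def by (rule cylinder_clopen)
  moreover have "x \<in> U" using xO by (simp add: U_def)
  moreover have "g y \<notin> U" if "y \<in> U" for y
  proof
    assume "g y \<in> U"
    hence "g y i = x i" by (auto simp: U_def n_def prefix_eq_iff)
    moreover have "prefix (Suc i) (g y) = prefix (Suc i) (g x)"
    proof -
      have y: "y \<in> \<Omega>" "prefix n y = prefix n x" using that by (auto simp: U_def)
      have "prefix k y = prefix k x" by (rule prefix_eq_le[OF y(2)]) (simp add: n_def)
      thus ?thesis using k y(1) xO by blast
    qed
    ultimately show False using i by (auto simp: prefix_eq_iff)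
  qed
  ultimately show ?thesis by blast
qed

end

section \<open>Prefix replacements, proximality and compression\<close>

context self_similar
begin

text \<open>For three cells \<open>b\<close>, \<open>w\<close>, \<open>u\<close> of equal length, \<open>push b w u\<close> replaces the prefixes
  \<open>b \<mapsto> b0\<close>, \<open>w \<mapsto> b1\<close>, \<open>u0 \<mapsto> w\<close>, \<open>u1 \<mapsto> u\<close> and \<open>ui \<mapsto> bi\<close> for \<open>i \<ge> 2\<close>. It moves the first
  two cells into the first one.\<close>

definition push :: "nat list \<Rightarrow> nat list \<Rightarrow> nat list \<Rightarrow> nat word \<Rightarrow> nat word" where
  "push b w u x = (if x \<notin> \<Omega> then x else
     let n = length b; p = prefix n x; y = suffix n x in
     if p = b then b \<frown> (0 ## y) else if p = w then b \<frown> (1 ## y)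
     else if p = u then (if y 0 = 0 then w \<frown> suffix 1 y else if y 0 = 1 then u \<frown> suffix 1 y else b \<frown> y)
     else x)"

text \<open>The inverse of \<open>push b w u\<close>, introduced as the witness of
  bijectivity.\<close>

definition pull :: "nat list \<Rightarrow> nat list \<Rightarrow> nat list \<Rightarrow> nat word \<Rightarrow> nat word" where
  "pull b w u x = (if x \<notin> \<Omega> then x else
     let n = length b; p = prefix n x; y = suffix n x in
     if p = b then (if y 0 = 0 then b \<frown> suffix 1 y else if y 0 = 1 then w \<frown> suffix 1 y else u \<frown> y)
     else if p = w then u \<frown> (0 ## y) else if p = u then u \<frown> (1 ## y)
     else x)"

lemma point_cases:
  assumes "x \<in> \<Omega>" "n > 0"
  obtains p y where "x = p \<frown> y" "p \<in> cells" "length p = n" "y \<in> seqs q"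
  using assms cells_prefix[OF assms] suffix_points[OF assms]
  by (metis diff_zero prefix_suffix subsequence_length)

lemma push_conc:
  assumes c: "b \<in> cells" "w \<in> cells" "u \<in> cells" and l: "length w = length b" "length u = length b"
    and p: "p \<in> cells" "length p = length b" "y \<in> seqs q"
  shows "push b w u (p \<frown> y) = (if p = b then b \<frown> (0 ## y) else if p = w then b \<frown> (1 ## y)
     else if p = u then (if y 0 = 0 then w \<frown> suffix 1 y else if y 0 = 1 then u \<frown> suffix 1 y else b \<frown> y)
     else p \<frown> y)"
proof -
  have "p \<frown> y \<in> \<Omega>" using p by (auto intro: points_conc)
  moreover have "prefix (length b) (p \<frown> y) = p" "suffix (length b) (p \<frown> y) = y"
    using prefix_conc_length[of p y] suffix_conc_length[of p y] p(2) by simp_all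
  ultimately show ?thesis by (simp only: push_def Let_def not_True_eq_False if_False)
qed

lemma pull_conc:
  assumes c: "b \<in> cells" "w \<in> cells" "u \<in> cells" and l: "length w = length b" "length u = length b"
    and p: "p \<in> cells" "length p = length b" "y \<in> seqs q"
  shows "pull b w u (p \<frown> y) = (if p = b then (if y 0 = 0 then b \<frown> suffix 1 y else if y 0 = 1 then w \<frown> suffix 1 y else u \<frown> y)
     else if p = w then u \<frown> (0 ## y) else if p = u then u \<frown> (1 ## y)
     else p \<frown> y)"
proof -
  have "p \<frown> y \<in> \<Omega>" using p by (auto intro: points_conc)
  moreover have "prefix (length b) (p \<frown> y) = p" "suffix (length b) (p \<frown> y) = y"
    using prefix_conc_length[of p y] suffix_conc_length[of p y] p(2) by simp_all
  ultimately show ?thesis by (simp only: pull_def Let_def not_True_eq_False if_False)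
qed

lemma push_homeo:
  assumes c: "b \<in> cells" "w \<in> cells" "u \<in> cells" and l: "length w = length b" "length u = length b"
    and d: "b \<noteq> w" "b \<noteq> u" "w \<noteq> u"
  shows "push b w u \<in> homeos"
proof -
  note pc = push_conc[OF c l] pull_conc[OF c l]
  have n: "length b > 0" using c by auto
  have b01: "0 ## y \<in> seqs q" "1 ## y \<in> seqs q" "suffix 1 y \<in> seqs q" if "y \<in> seqs q" for y
    using that q by (simp_all add: seqs_build suffix_seqs)
  have "pull b w u (push b w u x) = x" for x
  proof (cases "x \<in> \<Omega>")
    case True
    from point_cases[OF this n] obtain p y where x: "x = p \<frown> y" "p \<in> cells" "length p = length b" "y \<in> seqs q" .
    show ?thesis
      unfolding x(1) using d c l x b01[OF x(4)]
      by (simp add: pc build_suffix suffix_build)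
  qed (simp add: push_def pull_def)
  moreover have "push b w u (pull b w u x) = x" for x
  proof (cases "x \<in> \<Omega>")
    case True
    from point_cases[OF this n] obtain p y where x: "x = p \<frown> y" "p \<in> cells" "length p = length b" "y \<in> seqs q" .
    show ?thesis
      unfolding x(1) using d c l x b01[OF x(4)]
      by (simp add: pc build_suffix suffix_build)
  qed (simp add: push_def pull_def)
  ultimately have "bij (push b w u)" by (intro o_bij[of "pull b w u"]) auto
  moreover have "supp_in \<Omega> (push b w u)" by (simp add: supp_in_def push_def)
  moreover have "locally_similar (push b w u)"
    unfolding locally_similar_def
  \<comment> \<open>One letter more than the length of the cells, because below \<open>u\<close> the
    replacement depends on the next letter.\<close>
  proof (intro exI[of _ "Suc (length b)"] conjI ballI impI)
    fix v assume v: "v \<in> cells" "length v = Suc (length b)"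
    define p where "p = take (length b) v"
    define i where "i = last v"
    have vp: "v = p @ [i]" using v unfolding p_def i_def
      by (metis append_butlast_last_id butlast_conv_take diff_Suc_1 length_greater_0_conv zero_less_Suc)
    have p: "p \<in> cells" "length p = length b" using cells_split(1)[OF v(1) n] v(2) by (auto simp: p_def)
    have i: "i < q" using v(1) p vp cells_append[OF p(1), of "[i]"] by simp
    have e: "push b w u (v \<frown> y) = (if p = b then b \<frown> (0 ## i ## y) else if p = w then b \<frown> (1 ## i ## y)
     else if p = u then (if i = 0 then w \<frown> y else if i = 1 then u \<frown> y else b \<frown> i ## y)
     else p \<frown> i ## y)" if "y \<in> seqs q" for y
    proof -
      have "i ## y \<in> seqs q" using that i by (simp add: seqs_build)
      thus ?thesis using pc(1)[OF p, of "i ## y"] by (simp add: vp suffix_build)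
    qed
    have z: "0 < q" "1 < q" using q by auto
    have "\<exists>v'\<in>cells. \<forall>y\<in>seqs q. push b w u (v \<frown> y) = v' \<frown> y"
    proof -
      consider "p = b" | "p = w" | "p = u" "i = 0" | "p = u" "i = 1" | "p = u" "i > 1" | "p \<noteq> b" "p \<noteq> w" "p \<noteq> u"
        by linarith
      thus ?thesis
      proof cases
        case 1 thus ?thesis using e cells_append[OF c(1), of "[0, i]"] z i d by (intro bexI[of _ "b @ [0, i]"]) auto
      next
        case 2 thus ?thesis using e cells_append[OF c(1), of "[1, i]"] z i d by (intro bexI[of _ "b @ [1, i]"]) auto
      next
        case 3 thus ?thesis using e c d by (intro bexI[of _ w]) auto
      next
        case 4 thus ?thesis using e c d by (intro bexI[of _ u]) auto
      next
        case 5 thus ?thesis using e cells_append[OF c(1), of "[i]"] i d by (intro bexI[of _ "b @ [i]"]) auto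
      next
        case 6 thus ?thesis using e cells_append[OF p(1), of "[i]"] i by (intro bexI[of _ "p @ [i]"]) auto
      qed
    qed
    thus "\<exists>v'\<in>cells. piece (push b w u) v v'" using pieceI by meson
  qed simp
  ultimately show ?thesis by (simp add: homeos_def)
qed

lemma homeos_id: "id \<in> homeos"
  using locally_similar_id bij_id by (simp add: homeos_def)

lemma homeos_comp: "f \<in> homeos \<Longrightarrow> g \<in> homeos \<Longrightarrow> f \<circ> g \<in> homeos"
  by (simp add: homeos_def bij_comp locally_similar_comp supp_in_comp)

text \<open>Each \<open>push\<close> absorbs one further cell of \<open>S\<close> into
  \<open>b\<close> and leaves the remaining cells of \<open>S\<close> in place. The cell
  \<open>u\<close> makes up for the freed space and gets scattered, which is why it has to stay
  outside \<open>S\<close>.\<close>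

lemma gather_cells:
  assumes "finite S" "S \<subseteq> {w \<in> cells. length w = length b}" "b \<in> cells" "u \<in> cells" "length u = length b"
    "b \<noteq> u" "b \<notin> S" "u \<notin> S"
  shows "\<exists>g\<in>homeos. \<forall>x\<in>\<Omega>. prefix (length b) x \<in> insert b S \<longrightarrow> prefix (length b) (g x) = b"
  using assms
proof (induction S rule: finite_induct)
  case empty
  show ?case using homeos_id by (intro bexI[of _ id]) auto
next
  case (insert w S)
  then obtain g where g: "g \<in> homeos" "\<forall>x\<in>\<Omega>. prefix (length b) x \<in> Set.insert b S \<longrightarrow> prefix (length b) (g x) = b"
    by auto
  have w: "w \<in> cells" "length w = length b" "b \<noteq> w" "w \<noteq> u" using insert by auto
  let ?p = "push b w u"
  have ph: "?p \<in> homeos" using insert w by (intro push_homeo) auto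
  have "prefix (length b) (g (?p x)) = b" if x: "x \<in> \<Omega>" "prefix (length b) x \<in> Set.insert b (Set.insert w S)" for x
  proof -
    have "?p x \<in> \<Omega>" using x homeos_points[OF ph] by simp
    moreover have "prefix (length b) (?p x) \<in> Set.insert b S"
    proof (cases "prefix (length b) x \<in> {b, w}")
      case True
      thus ?thesis using x(1) by (auto simp: push_def Let_def simp del: conc_conc)
    next
      case False
      thus ?thesis using x insert.prems(7) by (auto simp: push_def Let_def)
    qed
    ultimately show ?thesis using g(2) by blast
  qed
  thus ?case using homeos_comp[OF g(1) ph] by (intro bexI[of _ "g \<circ> ?p"]) auto
qed

text \<open>At a common depth choose a cell \<open>b\<close> inside \<open>B\<close> and another
  cell \<open>u\<close> outside \<open>A\<close>. Gathering all the other cells into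
  \<open>b\<close> takes \<open>A\<close> along.\<close>

lemma homeos_proximal:
  assumes A: "A \<in> clopens" "A \<noteq> \<Omega>" and B: "B \<in> clopens" "B \<noteq> {}"
  shows "\<exists>g\<in>homeos. g ` A \<subseteq> B"
proof -
  obtain n1 where "depends_on A n1" using clopens_depth[OF A(1)] .
  note n1 = depends_onD[OF this]
  obtain n2 where "depends_on B n2" using clopens_depth[OF B(1)] .
  note n2 = depends_onD[OF this]
  have sub: "A \<subseteq> \<Omega>" "B \<subseteq> \<Omega>" using A B by (auto simp: clopens_def)
  obtain x0 where x0: "x0 \<in> \<Omega>" "x0 \<notin> A" using A sub by auto
  obtain b0 where b0: "b0 \<in> \<Omega>" "b0 \<in> B" using B sub by auto
  define n where "n = Suc (n1 + n2)"
  \<comment> \<open>The point \<open>x0\<close> could lie in the cone chosen for \<open>B\<close>.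
    Changing a letter beyond the depths of \<open>A\<close> and \<open>B\<close> keeps the point
    outside \<open>A\<close> and makes \<open>u\<close> different from \<open>b\<close>; that letter
    is not the first one, so \<open>0\<close> and \<open>1\<close> are admissible.\<close>
  define x1 where "x1 = x0(n := if b0 n = 0 then 1 else 0)"
  have x1: "x1 \<in> \<Omega>" using x0(1) q by (auto simp: points_def x1_def n_def)
  have e: "prefix n x1 = prefix n x0" by (simp add: prefix_eq_iff x1_def)
  have x1A: "x1 \<notin> A" using n1[OF _ x1 x0(1) e] x0(2) by (simp add: n_def)
  define N where "N = Suc n"
  have N: "N > 0" "n1 \<le> N" "n2 \<le> N" by (simp_all add: N_def n_def)
  define b where "b = prefix N b0"
  define u where "u = prefix N x1"
  have bu: "b \<in> cells" "u \<in> cells" "length b = N" "length u = N"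
    using cells_prefix[OF b0(1) N(1)] cells_prefix[OF x1 N(1)] by (auto simp: b_def u_def)
  have "b0 n \<noteq> x1 n" by (simp add: x1_def)
  hence "b \<noteq> u" unfolding b_def u_def prefix_eq_iff by (auto simp: N_def)
  define S where "S = {w \<in> cells. length w = N} - {b, u}"
  have "finite S" unfolding S_def by (rule finite_subset[OF _ finite_tree_words[of q r N]]) auto
  hence "\<exists>g\<in>homeos. \<forall>x\<in>\<Omega>. prefix (length b) x \<in> insert b S \<longrightarrow> prefix (length b) (g x) = b"
    by (rule gather_cells[of S b u]) (use bu \<open>b \<noteq> u\<close> in \<open>auto simp: S_def\<close>)
  then obtain g where g: "g \<in> homeos" "\<forall>x\<in>\<Omega>. prefix N x \<in> insert b S \<longrightarrow> prefix N (g x) = b"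
    unfolding bu(3) by blast
  have "g x \<in> B" if x: "x \<in> A" for x
  proof -
    have xO: "x \<in> \<Omega>" using x sub by auto
    have "prefix N x \<noteq> u" using n1[OF N(2) xO x1] x x1A by (auto simp: u_def)
    hence "prefix N x \<in> insert b S" using cells_prefix[OF xO N(1)] by (simp add: S_def)
    hence "prefix N (g x) = prefix N b0" using g(2) xO unfolding b_def by blast
    thus ?thesis using n2[OF N(3) _ b0(1)] homeos_points[OF g(1)] xO b0(2) by blast
  qed
  thus ?thesis using g(1) by auto
qed

text \<open>The cone of a cell \<open>u\<close> disjoint from \<open>Y\<close> is squeezed into its
  child \<open>u0\<close>. This embeds the whole space onto a proper clopen \<open>W\<close>, and
  transport along the embedding is the homomorphism. A map supported on \<open>Y\<close> fixes the
  cone of \<open>u\<close> pointwise and is not changed.\<close>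

lemma homeos_compress:
  assumes Y: "Y \<in> clopens" "Y \<noteq> \<Omega>"
  shows "\<exists>W\<in>clopens. W \<noteq> \<Omega> \<and>
      (\<exists>c. (\<forall>g\<in>homeos. c g \<in> homeos \<and> supp_in W (c g)) \<and> (\<forall>g\<in>homeos. \<forall>h\<in>homeos. c (g \<circ> h) = c g \<circ> c h) \<and>
        (\<forall>f\<in>homeos. supp_in Y f \<longrightarrow> c f = f))"
proof -
  obtain n0 where "depends_on Y n0" using clopens_depth[OF Y(1)] .
  note n0 = depends_onD[OF this]
  have sub: "Y \<subseteq> \<Omega>" using Y by (auto simp: clopens_def)
  obtain x0 where x0: "x0 \<in> \<Omega>" "x0 \<notin> Y" using Y sub by auto
  define n where "n = Suc n0"
  have n: "n > 0" "n0 \<le> n" by (simp_all add: n_def)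
  define u where "u = prefix n x0"
  have u: "u \<in> cells" "length u = n" using cells_prefix[OF x0(1) n(1)] by (auto simp: u_def)
  have uY: "x \<notin> Y" if "x \<in> \<Omega>" "prefix n x = u" for x
    using n0[OF n(2) that(1) x0(1)] that(2) x0(2) by (auto simp: u_def)
  \<comment> \<open>An injection of the space with image \<open>W\<close> and, next, a left inverse
    of it, which is a two-sided inverse on \<open>W\<close>.\<close>
  define \<phi> where "\<phi> x = (if x \<in> \<Omega> \<and> prefix n x = u then u \<frown> (0 ## suffix n x) else x)" for x
  define \<psi> where "\<psi> x = (if x \<in> \<Omega> \<and> prefix n x = u then u \<frown> suffix (Suc n) x else x)" for x
  define W where "W = {x \<in> \<Omega>. prefix (Suc n) x \<in> {v. take n v = u \<longrightarrow> v ! n = 0}}"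
  have W: "x \<in> W \<longleftrightarrow> x \<in> \<Omega> \<and> (prefix n x = u \<longrightarrow> x n = 0)" for x
    by (auto simp: W_def nth_append)
  have Wc: "W \<in> clopens" unfolding W_def by (rule cylinder_clopen)
  have "u @ [1] \<in> cells" using cells_append[OF u(1), of "[1]"] q by simp
  moreover have z: "(\<lambda>_. 0) \<in> seqs q" using q by (simp add: seqs_def)
  ultimately have p1: "(u @ [1]) \<frown> (\<lambda>_. 0) \<in> \<Omega>" by (intro points_conc) auto
  hence "(u @ [1]) \<frown> (\<lambda>_. 0) \<notin> W" using u(2) by (simp add: W)
  hence WO: "W \<noteq> \<Omega>" using p1 by auto
  have \<phi>_points: "\<phi> x \<in> \<Omega> \<longleftrightarrow> x \<in> \<Omega>" for x
    using u suffix_points[OF _ n(1), of x] q by (auto simp: \<phi>_def seqs_build intro: points_conc)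
  have \<psi>_points: "\<psi> x \<in> \<Omega> \<longleftrightarrow> x \<in> \<Omega>" for x
    using u suffix_points[of x q r "Suc n"] by (auto simp: \<psi>_def intro: points_conc)
  have s: "suffix (Suc n) (u \<frown> (0 ## y)) = y" "prefix n (u \<frown> y) = u" for y
    using u(2) by (auto simp: fun_eq_iff)
  have \<phi>W: "\<phi> x \<in> W" if "x \<in> \<Omega>" for x
    using that \<phi>_points[of x] u(2) by (auto simp: W \<phi>_def)
  have \<psi>\<phi>: "\<psi> (\<phi> x) = x" for x
  proof (cases "x \<in> \<Omega> \<and> prefix n x = u")
    case True
    hence "\<phi> x \<in> \<Omega>" using \<phi>_points by simp
    moreover have p: "\<phi> x = u \<frown> (0 ## suffix n x)" using True by (simp add: \<phi>_def)
    ultimately have "\<psi> (\<phi> x) = u \<frown> suffix n x" by (simp add: \<psi>_def s del: build_append)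
    also have "\<dots> = x" using True by (metis prefix_suffix)
    finally show ?thesis .
  qed (auto simp: \<phi>_def \<psi>_def)
  have \<phi>\<psi>: "\<phi> (\<psi> x) = x" if "x \<in> W" for x
  proof (cases "prefix n x = u")
    case True
    have x: "x \<in> \<Omega>" "x n = 0" using that True W by auto
    have p: "\<psi> x = u \<frown> suffix (Suc n) x" using True x by (simp add: \<psi>_def)
    have "\<phi> (\<psi> x) = u \<frown> (0 ## suffix (Suc n) x)"
      using \<psi>_points[of x] x u(2) unfolding p by (simp add: \<phi>_def)
    also have "0 ## suffix (Suc n) x = suffix n x"
    proof
      fix i show "(0 ## suffix (Suc n) x) i = suffix n x i" using x(2) by (cases i) auto
    qed
    also have "u \<frown> suffix n x = x" using True by (metis prefix_suffix)
    finally show ?thesis .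
  qed (auto simp: \<phi>_def \<psi>_def)
  have ls_\<phi>: "locally_similar \<phi>"
  proof (rule locally_similarI[OF n(1)])
    fix x assume x: "x \<in> \<Omega>"
    have p: "prefix n x \<in> cells" by (rule cells_prefix[OF x n(1)])
    show "\<exists>v\<in>cells. piece \<phi> (prefix n x) v"
    proof (cases "prefix n x = u")
      case True
      have "\<phi> (u \<frown> y) = (u @ [0]) \<frown> y" if "y \<in> seqs q" for y
        using that u by (auto simp: \<phi>_def points_conc)
      hence "piece \<phi> u (u @ [0])" by (rule pieceI)
      moreover have "u @ [0] \<in> cells" using cells_append[OF u(1), of "[0]"] q by simp
      ultimately show ?thesis using True by auto
    next
      case False
      have "\<phi> (prefix n x \<frown> y) = prefix n x \<frown> y" if "y \<in> seqs q" for y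
        using False by (simp add: \<phi>_def)
      thus ?thesis using p pieceI by meson
    qed
  qed
  have ls_\<psi>: "locally_similar \<psi>"
  proof (rule locally_similarI[of "Suc n"])
    fix x assume x: "x \<in> \<Omega>"
    have p: "prefix (Suc n) x \<in> cells" by (rule cells_prefix[OF x]) simp
    have ps: "prefix (Suc n) x = prefix n x @ [x n]" by simp
    show "\<exists>v\<in>cells. piece \<psi> (prefix (Suc n) x) v"
    proof (cases "prefix n x = u")
      case True
      have p': "u @ [x n] \<in> cells" using p ps True by simp
      have "\<psi> ((u @ [x n]) \<frown> y) = u \<frown> y" if y: "y \<in> seqs q" for y
      proof -
        have "(u @ [x n]) \<frown> y \<in> \<Omega>" using p' y by (intro points_conc) auto
        moreover have "suffix (Suc n) ((u @ [x n]) \<frown> y) = y" using u(2) suffix_conc_length[of "u @ [x n]" y] by simp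
        ultimately show ?thesis using u(2) by (simp add: \<psi>_def)
      qed
      thus ?thesis using u pieceI unfolding ps True by meson
    next
      case False
      have "\<psi> (prefix (Suc n) x \<frown> y) = prefix (Suc n) x \<frown> y" if "y \<in> seqs q" for y
        using False by (simp add: \<psi>_def)
      thus ?thesis using p pieceI by meson
    qed
  qed simp
  define c where "c g x = (if x \<in> W then \<phi> (g (\<psi> x)) else x)" for g x
  have cc: "c (g \<circ> h) x = c g (c h x)" if "g \<in> homeos" "h \<in> homeos" for g h x
  proof (cases "x \<in> W")
    case True
    have "h (\<psi> x) \<in> \<Omega>" using True \<psi>_points homeos_points[OF that(2)] by (simp add: W)
    hence "\<phi> (h (\<psi> x)) \<in> W" by (rule \<phi>W)
    thus ?thesis using True by (simp add: c_def \<psi>\<phi>)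
  qed (simp add: c_def)
  have ci: "c id = id" by (auto simp: c_def fun_eq_iff \<phi>\<psi>)
  have "c g \<in> homeos" if g: "g \<in> homeos" for g
  proof -
    have b: "bij g" using g by (simp add: homeos_def)
    have i: "pinv g \<circ> g = id" "g \<circ> pinv g = id" using b by (auto simp: fun_eq_iff inv_apply)
    have "c (pinv g) (c g x) = x" "c g (c (pinv g) x) = x" for x
      using cc[OF homeos_inv[OF g] g] cc[OF g homeos_inv[OF g]] i ci by (metis id_apply)+
    hence "bij (c g)" by (intro o_bij[of "c (pinv g)"]) auto
    moreover have "supp_in \<Omega> (c g)" by (auto simp: supp_in_def c_def W)
    moreover have "locally_similar (c g)"
    proof -
      have "locally_similar (\<phi> \<circ> (g \<circ> \<psi>))"
        using g ls_\<phi> ls_\<psi> by (intro locally_similar_comp) (auto simp: homeos_def)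
      \<comment> \<open>Gluing with both sets equal to \<open>W\<close>: the transported map on
        \<open>W\<close>, the identity elsewhere.\<close>
      from locally_similar_glue[OF this this Wc Wc, of "c g"] show ?thesis by (simp add: c_def)
    qed
    ultimately show ?thesis by (simp add: homeos_def)
  qed
  moreover have "c f = f" if f: "f \<in> homeos" "supp_in Y f" for f
  proof
    fix x
    have b: "bij f" using f by (simp add: homeos_def)
    have fix_u: "f y = y" if "y \<in> \<Omega>" "prefix n y = u" for y
      using uY[OF that] f(2) by (simp add: supp_in_def)
    show "c f x = f x"
    proof (cases "prefix n x = u \<and> x \<in> \<Omega>")
      case True
      hence p: "\<psi> x = u \<frown> suffix (Suc n) x" by (simp add: \<psi>_def)
      have "f (\<psi> x) = \<psi> x"
        by (rule fix_u) (use True \<psi>_points in \<open>simp, simp only: p s(2)\<close>)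
      moreover have "f x = x" using True fix_u by blast
      ultimately show ?thesis using \<phi>\<psi> by (simp add: c_def)
    next
      case False
      show ?thesis
      proof (cases "x \<in> \<Omega>")
        case True
        \<comment> \<open>As \<open>f\<close> is injective and fixes the cone of \<open>u\<close>
          pointwise, it cannot move an outer point into that cone; so the embedding and its inverse
          act trivially on \<open>x\<close> and \<open>f x\<close>.\<close>
        have "prefix n (f x) \<noteq> u"
        proof
          assume "prefix n (f x) = u"
          hence "f (f x) = f x" using fix_u homeos_points[OF f(1)] True by simp
          hence "f x = x" using b by (metis inv_apply(1))
          thus False using False True \<open>prefix n (f x) = u\<close> by simp
        qed
        thus ?thesis using False True W by (simp add: c_def \<phi>_def \<psi>_def)
      next
        case False
        thus ?thesis using W f(1) by (auto simp: c_def homeos_def supp_in_def)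
      qed
    qed
  qed
  moreover have "supp_in W (c g)" for g by (simp add: supp_in_def c_def)
  moreover have "c (g \<circ> h) = c g \<circ> c h" if "g \<in> homeos" "h \<in> homeos" for g h
    using cc[OF that] by (simp add: fun_eq_iff)
  ultimately show ?thesis using Wc WO by (intro bexI[of _ W] conjI exI[of _ c]) blast+
qed

sublocale homeos: proximal_full_group homeos \<Omega> clopens
proof unfold_locales
  show "id \<in> homeos" by (rule homeos_id)
  show "f \<circ> g \<in> homeos" if "f \<in> homeos" "g \<in> homeos" for f g using that by (rule homeos_comp)
  show "pinv f \<in> homeos" if "f \<in> homeos" for f using that by (rule homeos_inv)
  show "bij f" "supp_in \<Omega> f" if "f \<in> homeos" for f using that by (auto simp: homeos_def)
  show "A \<subseteq> \<Omega>" if "A \<in> clopens" for A using that by (auto simp: clopens_def)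
  show "\<Omega> \<in> clopens" by (auto simp: clopens_def)
  show "h \<in> homeos" if "bij h" "f \<in> homeos" "g \<in> homeos" "A \<in> clopens" "B \<in> clopens"
    "\<forall>x\<in>A. h x = f x" "\<forall>x\<in>B. h x = g x" "supp_in (A \<union> B) h" for h f g A B
  proof -
    have "A \<union> B \<subseteq> \<Omega>" using that by (auto simp: clopens_def)
    moreover have "locally_similar h"
      by (rule locally_similar_glue[of f g A B]) (use that in \<open>auto simp: homeos_def supp_in_def\<close>)
    ultimately show ?thesis using that(1,8) supp_in_mono by (simp add: homeos_def) blast
  qed
qed (rule clopens_Un clopens_Diff clopens_image clopens_split homeos_proximal homeos_displace
  homeos_compress; assumption)+

end

section \<open>The Higman--Thompson group\<close>

text \<open>If one word were shorter, the tails constantly \<open>0\<close> and constantly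
  \<open>1\<close> would show different letters right after it, where the longer word prescribes
  one.\<close>

lemma conc_eq_imp_eq:
  assumes q: "q \<ge> 2" and e: "\<And>y. y \<in> seqs q \<Longrightarrow> a \<frown> y = b \<frown> y"
  shows "a = b"
proof -
  have longer: "length a = length b" if "length a \<le> length b" "\<And>y. y \<in> seqs q \<Longrightarrow> a \<frown> y = b \<frown> y" for a b
  proof (rule ccontr)
    assume "length a \<noteq> length b"
    hence l: "length a < length b" using that(1) by simp
    have "(\<lambda>_. 0) \<in> seqs q" "(\<lambda>_. 1) \<in> seqs q" using q by (auto simp: seqs_def)
    hence "(a \<frown> (\<lambda>_. 0)) (length a) = b ! length a" "(a \<frown> (\<lambda>_. 1)) (length a) = b ! length a"
      using that(2) l by (metis conc_fst)+
    thus False by simp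
  qed
  have l: "length a = length b" using longer[of a b] longer[of b a] e by (metis le_cases)
  have "(\<lambda>_. 0) \<in> seqs q" using q by (auto simp: seqs_def)
  thus ?thesis using concat_eq[OF l] e by blast
qed

text \<open>The algebra of all functions from tails to points: \<lambda> branches on the first
  letter and the unary operations prepend a letter to the argument. The free algebra will embed as
  the functions that replace prefixes at some depth.\<close>

definition word_alg :: "nat \<Rightarrow> nat \<Rightarrow> (nat word \<Rightarrow> nat word) jt_algebra" where
  "word_alg q r = \<lparr>jt_carrier = seqs q \<rightarrow>\<^sub>E points q r,
     jt_lam = (\<lambda>fs. \<lambda>y\<in>seqs q. (fs ! (y 0)) (suffix (Suc 0) y)),
     jt_alp = (\<lambda>i f. \<lambda>y\<in>seqs q. f (i ## y))\<rparr>"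

lemma jt_variety_word_alg: "jt_variety q (word_alg q r)"
  unfolding jt_variety_def
proof (intro conjI allI impI ballI; (elim conjE)?)
  fix fs assume fs: "length fs = q" "set fs \<subseteq> jt_carrier (word_alg q r)"
  have m: "(fs ! i) y \<in> points q r" if "i < q" "y \<in> seqs q" for i y
    using fs that nth_mem[of i fs] by (auto simp: word_alg_def PiE_def Pi_def subset_iff)
  have y0: "y 0 < q" if "y \<in> seqs q" for y using that by (simp add: seqs_def)
  show "jt_lam (word_alg q r) fs \<in> jt_carrier (word_alg q r)"
    using m y0 suffix_seqs by (auto simp: word_alg_def)
  fix i assume i: "i < q"
  have "fs ! i \<in> extensional (seqs q)"
    using fs i nth_mem[of i fs] by (auto simp: word_alg_def PiE_def subset_iff)
  thus "jt_alp (word_alg q r) i (jt_lam (word_alg q r) fs) = fs ! i"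
    using i by (auto simp: word_alg_def seqs_build suffix_build fun_eq_iff restrict_def extensional_def)
next
  fix i f assume "i < q" "f \<in> jt_carrier (word_alg q r)"
  thus "jt_alp (word_alg q r) i f \<in> jt_carrier (word_alg q r)"
    by (auto simp: word_alg_def seqs_build PiE_def Pi_def)
next
  fix f assume f: "f \<in> jt_carrier (word_alg q r)"
  show "jt_lam (word_alg q r) (map (\<lambda>i. jt_alp (word_alg q r) i f) [0..<q]) = f"
  proof
    fix y show "jt_lam (word_alg q r) (map (\<lambda>i. jt_alp (word_alg q r) i f) [0..<q]) y = f y"
    proof (cases "y \<in> seqs q")
      case True
      hence "y 0 < q" "suffix (Suc 0) y \<in> seqs q" "y 0 ## suffix (Suc 0) y = y"
        using suffix_seqs by (auto simp: seqs_def)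
      thus ?thesis using True by (simp add: word_alg_def)
    next
      case False
      thus ?thesis using f by (simp add: word_alg_def PiE_def extensional_def)
    qed
  qed
qed

text \<open>The first letter is applied first, so that \<open>alps s t\<close> corresponds to the
  restriction of the function of \<open>t\<close> to the cone of \<open>s\<close>.\<close>

primrec alps :: "nat list \<Rightarrow> jt_term \<Rightarrow> jt_term" where
  "alps [] t = t"
| "alps (i # s) t = alps s (Alp i t)"

lemma alps_terms: "t \<in> jt_terms q r \<Longrightarrow> set s \<subseteq> {..<q} \<Longrightarrow> alps s t \<in> jt_terms q r"
  by (induction s arbitrary: t) (auto intro: jt_terms.Alp)

lemma alps_cong: "jt_eq q r s t \<Longrightarrow> set u \<subseteq> {..<q} \<Longrightarrow> jt_eq q r (alps u s) (alps u t)"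
  by (induction u arbitrary: s t) (auto intro: jt_eq.Alp)

text \<open>Every \<lambda> in the term is cancelled by one unary operation, so a sufficiently long
  string of them leaves only unary operations on a generator.\<close>

lemma alps_normal_form:
  assumes "t \<in> jt_terms q r"
  shows "\<exists>n. \<forall>s. set s \<subseteq> {..<q} \<longrightarrow> length s \<ge> n \<longrightarrow>
    (\<exists>j<r. \<exists>v. set v \<subseteq> {..<q} \<and> jt_eq q r (alps s t) (alps v (Gen j)))"
  using assms
proof (induction rule: jt_terms.induct)
  case (Gen i)
  thus ?case by (intro exI[of _ 0]) (auto intro!: jt_eq.refl alps_terms jt_terms.Gen)
next
  case (Lam ts)
  have "\<forall>t\<in>set ts. \<exists>n. \<forall>s. set s \<subseteq> {..<q} \<longrightarrow> length s \<ge> n \<longrightarrow>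
    (\<exists>j<r. \<exists>v. set v \<subseteq> {..<q} \<and> jt_eq q r (alps s t) (alps v (Gen j)))"
    using Lam.IH by blast
  then obtain N where N: "\<And>t s. t \<in> set ts \<Longrightarrow> set s \<subseteq> {..<q} \<Longrightarrow> length s \<ge> N t \<Longrightarrow>
    \<exists>j<r. \<exists>v. set v \<subseteq> {..<q} \<and> jt_eq q r (alps s t) (alps v (Gen j))"
    by metis
  have *: "\<exists>j<r. \<exists>v. set v \<subseteq> {..<q} \<and> jt_eq q r (alps s (jt_term.Lam ts)) (alps v (Gen j))"
    if s: "set s \<subseteq> {..<q}" "length s \<ge> Suc (\<Sum>t\<in>set ts. N t)" for s
  proof -
    obtain i s' where si: "s = i # s'" using s by (cases s) auto
    have i: "i < q" "set s' \<subseteq> {..<q}" using s si by auto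
    have ti: "ts ! i \<in> set ts" using i Lam.hyps by simp
    have "N (ts ! i) \<le> (\<Sum>t\<in>set ts. N t)" using ti by (intro member_le_sum) auto
    hence "length s' \<ge> N (ts ! i)" using s si by simp
    then obtain j v where "j < r" "set v \<subseteq> {..<q}" "jt_eq q r (alps s' (ts ! i)) (alps v (Gen j))"
      using N[OF ti i(2)] by blast
    moreover have "jt_eq q r (alps s (jt_term.Lam ts)) (alps s' (ts ! i))"
      using Lam i unfolding si alps.simps by (intro alps_cong jt_eq.Alp_Lam) auto
    ultimately show ?thesis using jt_eq.trans by blast
  qed
  show ?case by (rule exI[of _ "Suc (\<Sum>t\<in>set ts. N t)"]) (use * in blast)
next
  case (Alp i t)
  then obtain n where n: "\<And>s. set s \<subseteq> {..<q} \<Longrightarrow> length s \<ge> n \<Longrightarrow>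
    \<exists>j<r. \<exists>v. set v \<subseteq> {..<q} \<and> jt_eq q r (alps s t) (alps v (Gen j))" by blast
  \<comment> \<open>The operation already present in the term counts as one more letter of the
    string, so the same bound works.\<close>
  show ?case using n[of "i # s" for s] Alp.hyps by (intro exI[of _ n]) auto
qed

text \<open>An element is recovered from its \<open>q\<close> components by \<lambda>; iterated,
  from its descendants at any fixed depth.\<close>

lemma jt_eq_by_alps:
  assumes "s \<in> jt_terms q r" "t \<in> jt_terms q r"
    "\<And>u. set u \<subseteq> {..<q} \<Longrightarrow> length u = n \<Longrightarrow> jt_eq q r (alps u s) (alps u t)"
  shows "jt_eq q r s t"
  using assms
proof (induction n arbitrary: s t)
  case 0
  show ?case using 0(3)[of "[]"] by simp
next
  case (Suc n)
  have "jt_eq q r (Alp i s) (Alp i t)" if i: "i < q" for i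
    by (rule Suc.IH) (use i Suc.prems Suc.prems(3)[of "i # u" for u] in \<open>auto intro: jt_terms.Alp\<close>)
  hence "jt_eq q r (Lam (map (\<lambda>i. Alp i s) [0..<q])) (Lam (map (\<lambda>i. Alp i t) [0..<q]))"
    by (intro jt_eq.Lam) auto
  thus ?case using Suc.prems jt_eq.Lam_Alp jt_eq.sym jt_eq.trans by meson
qed

section \<open>The free algebra as an algebra of functions\<close>

locale higman_thompson =
  fixes q r :: nat
  assumes q2: "q \<ge> 2" and r1: "r \<ge> 1"
begin

sublocale self_similar q r "{id}"
  by unfold_locales (use q2 r1 in auto)

abbreviation free where "free \<equiv> jt_free q r"
abbreviation alg where "alg \<equiv> word_alg q r"
abbreviation cls where "cls \<equiv> jt_class q r"
abbreviation terms where "terms \<equiv> jt_terms q r"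

lemma piece_iff: "piece f u v \<longleftrightarrow> (\<forall>y\<in>seqs q. f (u \<frown> y) = v \<frown> y)"
  by (simp add: piece_def)

definition gen :: "nat \<Rightarrow> nat word \<Rightarrow> nat word" where
  "gen j = (\<lambda>y\<in>seqs q. j ## y)"

lemma gen_point: "j < r \<Longrightarrow> y \<in> seqs q \<Longrightarrow> j ## y \<in> \<Omega>"
  by (auto simp: points_def seqs_def)

lemma gen_alg: "j < r \<Longrightarrow> gen j \<in> jt_carrier alg"
  using gen_point by (auto simp: word_alg_def gen_def)

text \<open>The homomorphism provided by freeness which sends the generator \<open>j\<close> to the
  inclusion of the cone of \<open>j\<close>.\<close>

definition ev :: "jt_term set \<Rightarrow> nat word \<Rightarrow> nat word" where
  "ev = (SOME h. h \<in> jt_hom q free alg \<and> (\<forall>i<r. h (cls (Gen i)) = gen i))"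

lemma ev_hom: "ev \<in> jt_hom q free alg" and ev_gen: "j < r \<Longrightarrow> ev (cls (Gen j)) = gen j"
proof -
  have "\<exists>h. h \<in> jt_hom q free alg \<and> (\<forall>i<r. h (cls (Gen i)) = gen i)"
    using jt_free_universal[of q alg r gen, OF jt_variety_word_alg gen_alg] by blast
  hence "ev \<in> jt_hom q free alg \<and> (\<forall>i<r. ev (cls (Gen i)) = gen i)"
    unfolding ev_def by (rule someI_ex)
  thus "ev \<in> jt_hom q free alg" "j < r \<Longrightarrow> ev (cls (Gen j)) = gen j" by blast+
qed

lemma hom_unique:
  assumes "h \<in> jt_hom q free alg" "h' \<in> jt_hom q free alg"
    "\<And>i. i < r \<Longrightarrow> h (cls (Gen i)) = h' (cls (Gen i))" "c \<in> jt_carrier free"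
  shows "h c = h' c"
proof -
  have g: "h' (cls (Gen i)) \<in> jt_carrier alg" if "i < r" for i
    using assms(2) that jt_terms.Gen[OF that] by (auto simp: jt_hom_def jt_free_carrier)
  from jt_free_universal[of q alg r "\<lambda>i. h' (cls (Gen i))", OF jt_variety_word_alg g] obtain h0 where
    "\<And>h'' x. h'' \<in> jt_hom q free alg \<Longrightarrow> \<forall>i<r. h'' (cls (Gen i)) = h' (cls (Gen i)) \<Longrightarrow> x \<in> jt_carrier free \<Longrightarrow> h'' x = h0 x"
    by blast
  thus ?thesis using assms by metis
qed

lemma homD:
  assumes "h \<in> jt_hom q A B"
  shows "c \<in> jt_carrier A \<Longrightarrow> h c \<in> jt_carrier B"
    "length xs = q \<Longrightarrow> set xs \<subseteq> jt_carrier A \<Longrightarrow> h (jt_lam A xs) = jt_lam B (map h xs)"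
    "i < q \<Longrightarrow> c \<in> jt_carrier A \<Longrightarrow> h (jt_alp A i c) = jt_alp B i (h c)"
  using assms unfolding jt_hom_def by blast+

lemma cls_carrier: "t \<in> terms \<Longrightarrow> cls t \<in> jt_carrier free"
  by (simp add: jt_free_carrier)

lemma ev_closed: "c \<in> jt_carrier free \<Longrightarrow> ev c \<in> jt_carrier alg"
  using homD(1)[OF ev_hom] .

lemma ev_point: "c \<in> jt_carrier free \<Longrightarrow> y \<in> seqs q \<Longrightarrow> ev c y \<in> \<Omega>"
  using ev_closed by (auto simp: word_alg_def)

lemma ev_alps:
  "t \<in> terms \<Longrightarrow> set s \<subseteq> {..<q} \<Longrightarrow> y \<in> seqs q \<Longrightarrow> ev (cls (alps s t)) y = ev (cls t) (s \<frown> y)"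
proof (induction s arbitrary: t)
  case (Cons i s)
  have i: "i < q" "set s \<subseteq> {..<q}" using Cons.prems by auto
  have sy: "s \<frown> y \<in> seqs q" using i Cons.prems by (simp add: seqs_conc)
  have "ev (cls (alps (i # s) t)) y = ev (cls (Alp i t)) (s \<frown> y)"
    using Cons.IH[OF jt_terms.Alp[OF i(1) Cons.prems(1)] i(2) Cons.prems(3)] by simp
  also have "\<dots> = ev (jt_alp free i (cls t)) (s \<frown> y)"
    using jt_free_alp[OF i(1) Cons.prems(1)] by simp
  also have "\<dots> = jt_alp alg i (ev (cls t)) (s \<frown> y)"
    using homD(3)[OF ev_hom i(1) cls_carrier[OF Cons.prems(1)]] by simp
  also have "\<dots> = ev (cls t) ((i # s) \<frown> y)" using sy by (simp add: word_alg_def)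
  finally show ?case .
qed auto

text \<open>The syntactic normal form and the resulting function are recorded with the same
  \<open>j\<close> and \<open>v\<close>, so that one can be read off from the other.\<close>

definition normal_beyond :: "jt_term \<Rightarrow> nat \<Rightarrow> bool" where
  "normal_beyond t n \<longleftrightarrow> (\<forall>s. set s \<subseteq> {..<q} \<longrightarrow> length s \<ge> n \<longrightarrow> (\<exists>j<r. \<exists>v. set v \<subseteq> {..<q} \<and>
    jt_eq q r (alps s t) (alps v (Gen j)) \<and> (\<forall>y\<in>seqs q. ev (cls t) (s \<frown> y) = (j # v) \<frown> y)))"

lemma normal_beyondD:
  "normal_beyond t n \<Longrightarrow> set s \<subseteq> {..<q} \<Longrightarrow> length s \<ge> n \<Longrightarrow> \<exists>j<r. \<exists>v. set v \<subseteq> {..<q} \<and>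
    jt_eq q r (alps s t) (alps v (Gen j)) \<and> (\<forall>y\<in>seqs q. ev (cls t) (s \<frown> y) = (j # v) \<frown> y)"
  unfolding normal_beyond_def by blast

lemma ev_normal_form:
  assumes "t \<in> terms" obtains n where "normal_beyond t n"
proof -
  obtain n where n: "\<forall>s. set s \<subseteq> {..<q} \<longrightarrow> length s \<ge> n \<longrightarrow>
    (\<exists>j<r. \<exists>v. set v \<subseteq> {..<q} \<and> jt_eq q r (alps s t) (alps v (Gen j)))"
    using alps_normal_form[OF assms] by blast
  have "\<exists>j<r. \<exists>v. set v \<subseteq> {..<q} \<and>
    jt_eq q r (alps s t) (alps v (Gen j)) \<and> (\<forall>y\<in>seqs q. ev (cls t) (s \<frown> y) = (j # v) \<frown> y)"
    if s: "set s \<subseteq> {..<q}" "length s \<ge> n" for s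
  proof -
    obtain j v where j: "j < r" "set v \<subseteq> {..<q}" "jt_eq q r (alps s t) (alps v (Gen j))"
      using n s by blast
    have "ev (cls t) (s \<frown> y) = (j # v) \<frown> y" if y: "y \<in> seqs q" for y
    proof -
      have "ev (cls t) (s \<frown> y) = ev (cls (alps s t)) y" using ev_alps[OF assms s(1) y] by simp
      also have "\<dots> = ev (cls (alps v (Gen j))) y" using jt_class_eqI[OF j(3)] by simp
      also have "\<dots> = gen j (v \<frown> y)" using ev_alps[OF jt_terms.Gen[OF j(1)] j(2) y] ev_gen[OF j(1)] by simp
      also have "\<dots> = (j # v) \<frown> y" using j(2) y by (simp add: gen_def seqs_conc)
      finally show ?thesis .
    qed
    thus ?thesis using j by blast
  qed
  thus ?thesis using that unfolding normal_beyond_def by blast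
qed

text \<open>At a common depth both terms are in normal form. Equal functions have equal prefixes
  \<open>j # v\<close>, hence equal normal forms, and \<open>jt_eq_by_alps\<close> climbs
  back.\<close>

lemma ev_inj: "inj_on ev (jt_carrier free)"
proof (rule inj_onI)
  fix c d assume "c \<in> jt_carrier free" "d \<in> jt_carrier free" and e: "ev c = ev d"
  then obtain s t where st: "s \<in> terms" "c = cls s" "t \<in> terms" "d = cls t"
    by (auto simp: jt_free_carrier)
  obtain n where "normal_beyond s n" using ev_normal_form[OF st(1)] .
  note n = normal_beyondD[OF this]
  obtain m where "normal_beyond t m" using ev_normal_form[OF st(3)] .
  note m = normal_beyondD[OF this]
  have "jt_eq q r (alps u s) (alps u t)" if u: "set u \<subseteq> {..<q}" "length u = n + m" for u
  proof -
    obtain j v where j: "jt_eq q r (alps u s) (alps v (Gen j))" "\<And>y. y \<in> seqs q \<Longrightarrow> ev (cls s) (u \<frown> y) = (j # v) \<frown> y"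
      using n[OF u(1)] u(2) by (metis le_add1)
    obtain k w where k: "jt_eq q r (alps u t) (alps w (Gen k))" "\<And>y. y \<in> seqs q \<Longrightarrow> ev (cls t) (u \<frown> y) = (k # w) \<frown> y"
      using m[OF u(1)] u(2) by (metis le_add2)
    have "j # v = k # w"
      by (rule conc_eq_imp_eq[OF q2]) (use j(2) k(2) e st in \<open>simp del: build_cons\<close>)
    thus ?thesis using j(1) k(1) jt_eq.sym jt_eq.trans by blast
  qed
  from jt_eq_by_alps[OF st(1,3) this] show "c = d" using st jt_class_eqI by blast
qed

text \<open>Induction on the depth: at depth zero the function is a generator followed by unary
  operations; otherwise \<lambda> joins preimages of the \<open>q\<close> restrictions.\<close>

lemma ev_image:
  assumes "\<phi> \<in> jt_carrier alg"
    "\<And>s. set s \<subseteq> {..<q} \<Longrightarrow> length s = n \<Longrightarrow> \<exists>v\<in>cells. \<forall>y\<in>seqs q. \<phi> (s \<frown> y) = v \<frown> y"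
  shows "\<phi> \<in> ev ` jt_carrier free"
  using assms
proof (induction n arbitrary: \<phi>)
  case 0
  then obtain w where w: "w \<in> cells" "\<And>y. y \<in> seqs q \<Longrightarrow> \<phi> y = w \<frown> y" by force
  obtain j v where jv: "w = j # v" using w by (cases w) auto
  have j: "j < r" "set v \<subseteq> {..<q}"
    using w(1) tree_words_append[of "[j]" v q r] unfolding jv by (auto simp: tree_words_def)
  have t: "alps v (Gen j) \<in> terms" using j by (intro alps_terms jt_terms.Gen)
  have "ev (cls (alps v (Gen j))) y = \<phi> y" for y
  proof (cases "y \<in> seqs q")
    case True
    have "ev (cls (alps v (Gen j))) y = gen j (v \<frown> y)"
      using ev_alps[OF jt_terms.Gen[OF j(1)] j(2) True] ev_gen[OF j(1)] by simp
    also have "\<dots> = \<phi> y" using w(2)[OF True] j(2) True by (simp add: gen_def seqs_conc jv)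
    finally show ?thesis .
  next
    case False
    thus ?thesis using 0(1) ev_closed[OF cls_carrier[OF t]]
      by (simp add: word_alg_def PiE_def extensional_def)
  qed
  thus ?case using cls_carrier[OF t] by (metis ext image_eqI)
next
  case (Suc n)
  have "jt_alp alg i \<phi> \<in> ev ` jt_carrier free" if i: "i < q" for i
  proof (rule Suc.IH)
    show "jt_alp alg i \<phi> \<in> jt_carrier alg" by (rule jt_varietyD(2)[OF jt_variety_word_alg i Suc.prems(1)])
    fix s assume s: "set s \<subseteq> {..<q}" "length s = n"
    obtain v where v: "v \<in> cells" "\<And>y. y \<in> seqs q \<Longrightarrow> \<phi> ((i # s) \<frown> y) = v \<frown> y"
      using Suc.prems(2)[of "i # s"] s i by auto
    have "jt_alp alg i \<phi> (s \<frown> y) = v \<frown> y" if "y \<in> seqs q" for y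
      using v(2)[OF that] that s by (simp add: word_alg_def seqs_conc)
    thus "\<exists>v\<in>cells. \<forall>y\<in>seqs q. jt_alp alg i \<phi> (s \<frown> y) = v \<frown> y" using v(1) by blast
  qed
  hence "\<forall>i\<in>{..<q}. \<exists>d. d \<in> jt_carrier free \<and> ev d = jt_alp alg i \<phi>" by force
  from bchoice[OF this] obtain c where
    c: "\<And>i. i < q \<Longrightarrow> c i \<in> jt_carrier free \<and> ev (c i) = jt_alp alg i \<phi>" by auto
  let ?xs = "map c [0..<q]"
  have xs: "length ?xs = q" "set ?xs \<subseteq> jt_carrier free" using c by auto
  have "ev (jt_lam free ?xs) = jt_lam alg (map ev ?xs)" by (rule homD(2)[OF ev_hom xs])
  also have "map ev ?xs = map (\<lambda>i. jt_alp alg i \<phi>) [0..<q]" using c by simp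
  also have "jt_lam alg \<dots> = \<phi>" by (rule jt_varietyD(4)[OF jt_variety_word_alg Suc.prems(1)])
  finally show ?case using jt_varietyD(1)[OF jt_variety_jt_free xs] by (metis image_eqI)
qed

section \<open>Automorphisms of the free algebra as homeomorphisms\<close>

definition boundary :: "(jt_term set \<Rightarrow> jt_term set) \<Rightarrow> nat word \<Rightarrow> nat word" where
  "boundary \<theta> x = (if x \<in> \<Omega> then ev (\<theta> (cls (Gen (x 0)))) (suffix (Suc 0) x) else x)"

lemma point_gen:
  assumes "x \<in> \<Omega>" obtains j y where "j < r" "y \<in> seqs q" "x = j ## y"
  using assms suffix_points[OF assms, of "Suc 0"] build_first[of x]
  by (metis (no_types, lifting) lessI mem_Collect_eq points_def)

lemma boundary_gen: "j < r \<Longrightarrow> y \<in> seqs q \<Longrightarrow> boundary \<theta> (j ## y) = ev (\<theta> (cls (Gen j))) y"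
  using gen_point by (simp add: boundary_def suffix_build)

abbreviation autos where "autos \<equiv> jt_hom q free free \<inter> Bij (jt_carrier free)"

lemma gen_carrier: "j < r \<Longrightarrow> cls (Gen j) \<in> jt_carrier free"
  by (intro cls_carrier jt_terms.Gen)

lemma boundary_points:
  assumes "\<theta> \<in> jt_hom q free free" "x \<in> \<Omega>" shows "boundary \<theta> x \<in> \<Omega>"
proof -
  obtain j y where "j < r" "y \<in> seqs q" "x = j ## y" using point_gen[OF assms(2)] .
  thus ?thesis using boundary_gen ev_point homD(1)[OF assms(1)] gen_carrier by simp
qed

text \<open>The operations of the function algebra touch only the argument, so they commute with
  anything done to the values.\<close>

lemma post_compose_hom:
  assumes "h \<in> jt_hom q free alg" "\<And>x. x \<in> \<Omega> \<Longrightarrow> f x \<in> \<Omega>"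
  shows "(\<lambda>c. \<lambda>y\<in>seqs q. f (h c y)) \<in> jt_hom q free alg"
  unfolding jt_hom_def
proof (intro CollectI conjI allI impI ballI; (elim conjE)?)
  have p: "h c y \<in> \<Omega>" if "c \<in> jt_carrier free" "y \<in> seqs q" for c y
    using homD(1)[OF assms(1) that(1)] that(2) by (auto simp: word_alg_def)
  show "(\<lambda>c. \<lambda>y\<in>seqs q. f (h c y)) \<in> jt_carrier free \<rightarrow> jt_carrier alg"
    using p assms(2) by (auto simp: word_alg_def)
  fix xs assume xs: "length xs = q" "set xs \<subseteq> jt_carrier free"
  have "y 0 < q" "suffix (Suc 0) y \<in> seqs q" if "y \<in> seqs q" for y
    using that suffix_seqs by (auto simp: seqs_def)
  thus "(\<lambda>y\<in>seqs q. f (h (jt_lam free xs) y)) = jt_lam alg (map (\<lambda>c. \<lambda>y\<in>seqs q. f (h c y)) xs)"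
    using xs by (auto simp: homD(2)[OF assms(1) xs] word_alg_def restrict_def fun_eq_iff)
next
  fix i c assume ic: "i < q" "c \<in> jt_carrier free"
  have "h (jt_alp free i c) y = h c (i ## y)" if "y \<in> seqs q" for y
    using that by (simp add: homD(3)[OF assms(1) ic] word_alg_def)
  thus "(\<lambda>y\<in>seqs q. f (h (jt_alp free i c) y)) = jt_alp alg i (\<lambda>y\<in>seqs q. f (h c y))"
    using ic by (simp add: word_alg_def seqs_build cong: restrict_cong)
qed

lemma compose_hom: "h \<in> jt_hom q B C \<Longrightarrow> k \<in> jt_hom q A B \<Longrightarrow> (\<lambda>c. h (k c)) \<in> jt_hom q A C"
proof -
  assume h: "h \<in> jt_hom q B C" and k: "k \<in> jt_hom q A B"
  show ?thesis
    unfolding jt_hom_def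
  proof (intro CollectI conjI allI impI ballI; (elim conjE)?)
    show "(\<lambda>c. h (k c)) \<in> jt_carrier A \<rightarrow> jt_carrier C" using homD(1)[OF h] homD(1)[OF k] by blast
    fix xs assume xs: "length xs = q" "set xs \<subseteq> jt_carrier A"
    have "length (map k xs) = q" "set (map k xs) \<subseteq> jt_carrier B" using xs homD(1)[OF k] by auto
    from homD(2)[OF h this] show "h (k (jt_lam A xs)) = jt_lam C (map (\<lambda>c. h (k c)) xs)"
      by (simp add: homD(2)[OF k xs] comp_def)
  next
    fix i c assume "i < q" "c \<in> jt_carrier A"
    thus "h (k (jt_alp A i c)) = jt_alp C i (h (k c))"
      using homD(1,3)[OF k] homD(3)[OF h] by simp
  qed
qed

text \<open>Both sides are homomorphisms of \<open>c\<close> and agree on the generators, where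
  \<open>boundary\<close> was defined to make them agree. An endomorphism thus acts by composition
  on the left, which makes \<open>boundary\<close> multiplicative.\<close>

lemma ev_boundary:
  assumes \<theta>: "\<theta> \<in> jt_hom q free free" and c: "c \<in> jt_carrier free" and y: "y \<in> seqs q"
  shows "ev (\<theta> c) y = boundary \<theta> (ev c y)"
proof -
  have "ev (\<theta> c) = (\<lambda>y\<in>seqs q. boundary \<theta> (ev c y))"
  proof (rule hom_unique[OF _ _ _ c])
    show "(\<lambda>c. ev (\<theta> c)) \<in> jt_hom q free alg" by (rule compose_hom[OF ev_hom \<theta>])
    show "(\<lambda>c. \<lambda>y\<in>seqs q. boundary \<theta> (ev c y)) \<in> jt_hom q free alg"
      by (rule post_compose_hom[OF ev_hom boundary_points[OF \<theta>]])
    fix i assume i: "i < r"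
    have "ev (\<theta> (cls (Gen i))) \<in> extensional (seqs q)"
      using ev_closed[OF homD(1)[OF \<theta> gen_carrier[OF i]]] by (simp add: word_alg_def PiE_def)
    thus "ev (\<theta> (cls (Gen i))) = (\<lambda>y\<in>seqs q. boundary \<theta> (ev (cls (Gen i)) y))"
      using boundary_gen[OF i] by (auto simp: ev_gen[OF i] gen_def fun_eq_iff restrict_def extensional_def)
  qed
  thus ?thesis using y by simp
qed

lemma boundary_compose:
  assumes "\<theta> \<in> jt_hom q free free" "\<theta>' \<in> jt_hom q free free"
  shows "boundary (compose (jt_carrier free) \<theta> \<theta>') = boundary \<theta> \<circ> boundary \<theta>'"
proof
  fix x show "boundary (compose (jt_carrier free) \<theta> \<theta>') x = (boundary \<theta> \<circ> boundary \<theta>') x"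
  proof (cases "x \<in> \<Omega>")
    case True
    then obtain j y where j: "j < r" "y \<in> seqs q" "x = j ## y" using point_gen by blast
    show ?thesis using j gen_carrier homD(1)[OF assms(2)]
      by (simp add: boundary_gen compose_def ev_boundary[OF assms(1)])
  qed (simp add: boundary_def)
qed

lemma boundary_id: "boundary (\<lambda>c\<in>jt_carrier free. c) = id"
proof
  fix x show "boundary (\<lambda>c\<in>jt_carrier free. c) x = id x"
  proof (cases "x \<in> \<Omega>")
    case True
    then obtain j y where "j < r" "y \<in> seqs q" "x = j ## y" using point_gen by blast
    thus ?thesis by (simp add: boundary_gen gen_carrier ev_gen gen_def)
  qed (simp add: boundary_def)
qed

lemma autos_compose: "\<theta> \<in> autos \<Longrightarrow> \<theta>' \<in> autos \<Longrightarrow> compose (jt_carrier free) \<theta> \<theta>' \<in> autos"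
proof -
  assume a: "\<theta> \<in> autos" "\<theta>' \<in> autos"
  have c: "compose (jt_carrier free) \<theta> \<theta>' d = \<theta> (\<theta>' d)" if "d \<in> jt_carrier free" for d
    using that by (simp add: compose_def)
  have h: "(\<lambda>c. \<theta> (\<theta>' c)) \<in> jt_hom q free free" using a compose_hom[of \<theta> free free \<theta>' free] by blast
  have "compose (jt_carrier free) \<theta> \<theta>' \<in> jt_hom q free free"
    unfolding jt_hom_def
  proof (intro CollectI conjI allI impI ballI; (elim conjE)?)
    show "compose (jt_carrier free) \<theta> \<theta>' \<in> jt_carrier free \<rightarrow> jt_carrier free"
      using homD(1)[OF h] c by auto
    fix xs assume xs: "length xs = q" "set xs \<subseteq> jt_carrier free"
    have m: "map (compose (jt_carrier free) \<theta> \<theta>') xs = map (\<lambda>c. \<theta> (\<theta>' c)) xs" using xs c by auto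
    show "compose (jt_carrier free) \<theta> \<theta>' (jt_lam free xs) = jt_lam free (map (compose (jt_carrier free) \<theta> \<theta>') xs)"
      unfolding m using homD(2)[OF h xs] c[OF jt_varietyD(1)[OF jt_variety_jt_free xs]] by simp
  next
    fix i d assume "i < q" "d \<in> jt_carrier free"
    thus "compose (jt_carrier free) \<theta> \<theta>' (jt_alp free i d) = jt_alp free i (compose (jt_carrier free) \<theta> \<theta>' d)"
      using homD(3)[OF h] c jt_varietyD(2)[OF jt_variety_jt_free] by metis
  qed
  thus ?thesis using a compose_Bij by blast
qed

lemma boundary_inj: "inj_on boundary autos"
proof (rule inj_onI)
  fix \<theta> \<theta>' assume a: "\<theta> \<in> autos" "\<theta>' \<in> autos" and e: "boundary \<theta> = boundary \<theta>'"
  show "\<theta> = \<theta>'"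
  proof (rule extensionalityI)
    show "\<theta> \<in> extensional (jt_carrier free)" "\<theta>' \<in> extensional (jt_carrier free)"
      using a by (auto simp: Bij_def)
    fix c assume c: "c \<in> jt_carrier free"
    have h: "\<theta> \<in> jt_hom q free free" "\<theta>' \<in> jt_hom q free free" using a by simp_all
    have m: "\<theta> c \<in> jt_carrier free" "\<theta>' c \<in> jt_carrier free"
      using homD(1)[OF h(1) c] homD(1)[OF h(2) c] by simp_all
    have "ev (\<theta> c) = ev (\<theta>' c)"
    proof (rule extensionalityI)
      show "ev (\<theta> c) \<in> extensional (seqs q)" "ev (\<theta>' c) \<in> extensional (seqs q)"
        using ev_closed m by (auto simp: word_alg_def PiE_def)
      show "ev (\<theta> c) y = ev (\<theta>' c) y" if "y \<in> seqs q" for y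
        using ev_boundary[OF h(1) c that] ev_boundary[OF h(2) c that] e by simp
    qed
    thus "\<theta> c = \<theta>' c" using inj_onD[OF ev_inj _ m] by blast
  qed
qed

lemma boundary_locally_similar:
  assumes "\<theta> \<in> jt_hom q free free"
  shows "locally_similar (boundary \<theta>)"
proof -
  have "\<exists>n. \<forall>s. set s \<subseteq> {..<q} \<longrightarrow> length s \<ge> n \<longrightarrow> (\<exists>v\<in>cells. \<forall>y\<in>seqs q. ev (\<theta> (cls (Gen j))) (s \<frown> y) = v \<frown> y)"
    if j: "j < r" for j
  proof -
    have "\<theta> (cls (Gen j)) \<in> jt_carrier free" using homD(1)[OF assms gen_carrier[OF j]] .
    then obtain t where t: "t \<in> terms" "\<theta> (cls (Gen j)) = cls t" by (auto simp: jt_free_carrier)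
    obtain n where "normal_beyond t n" using ev_normal_form[OF t(1)] .
  note n = normal_beyondD[OF this]
    have "\<exists>v\<in>cells. \<forall>y\<in>seqs q. ev (cls t) (s \<frown> y) = v \<frown> y" if s: "set s \<subseteq> {..<q}" "length s \<ge> n" for s
    proof -
      obtain k v where k: "k < r" "set v \<subseteq> {..<q}" "\<forall>y\<in>seqs q. ev (cls t) (s \<frown> y) = (k # v) \<frown> y"
        using n[OF s] by blast
      have "[k] \<in> cells" using k(1) by (simp add: tree_words_def)
      hence "k # v \<in> cells" using cells_append[of "[k]" v] k(2) by simp
      thus ?thesis using k(3) by blast
    qed
    thus ?thesis using t(2) by auto
  qed
  then obtain N where N: "\<And>j s. j < r \<Longrightarrow> set s \<subseteq> {..<q} \<Longrightarrow> length s \<ge> N j \<Longrightarrow>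
    \<exists>v\<in>cells. \<forall>y\<in>seqs q. ev (\<theta> (cls (Gen j))) (s \<frown> y) = v \<frown> y" by metis
  show ?thesis
    unfolding locally_similar_def
  \<comment> \<open>The \<open>Suc\<close> accounts for the first letter, which selects the
    generator; the sum dominates every \<open>N j\<close>.\<close>
  proof (intro exI[of _ "Suc (\<Sum>j<r. N j)"] conjI ballI impI)
    fix u assume u: "u \<in> cells" "length u = Suc (\<Sum>j<r. N j)"
    obtain j s where us: "u = j # s" using u by (cases u) auto
    have j: "j < r" "set s \<subseteq> {..<q}"
      using u(1) tree_words_append[of "[j]" s q r] unfolding us by (auto simp: tree_words_def)
    have "N j \<le> (\<Sum>j<r. N j)" using j by (intro member_le_sum) auto
    hence "length s \<ge> N j" using u us by simp
    then obtain v where v: "v \<in> cells" "\<And>y. y \<in> seqs q \<Longrightarrow> ev (\<theta> (cls (Gen j))) (s \<frown> y) = v \<frown> y"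
      using N[OF j] by blast
    have "boundary \<theta> (u \<frown> y) = v \<frown> y" if "y \<in> seqs q" for y
      using v(2)[OF that] boundary_gen[OF j(1), of "s \<frown> y"] that j(2) by (simp add: us seqs_conc)
    hence "piece (boundary \<theta>) u v" by (rule pieceI)
    thus "\<exists>v\<in>cells. piece (boundary \<theta>) u v" using v(1) by blast
  qed simp
qed

text \<open>After \<open>n\<close> letters the function of \<open>c\<close> replaces a prefix;
  \<open>m\<close> further letters make the replacement long enough for \<open>f\<close> to be a
  single piece on it. So the composition satisfies \<open>ev_image\<close> at depth
  \<open>n + m\<close>.\<close>

lemma locally_similar_ev:
  assumes f: "locally_similar f" and c: "c \<in> jt_carrier free"
  shows "(\<lambda>y\<in>seqs q. f (ev c y)) \<in> ev ` jt_carrier free"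
proof -
  obtain t where t: "t \<in> terms" "c = cls t" using c by (auto simp: jt_free_carrier)
  obtain n where "normal_beyond t n" using ev_normal_form[OF t(1)] .
  note n = normal_beyondD[OF this]
  obtain m where "deep f m" using locally_similar_deep[OF f] .
  note m = deepD[OF this]
  show ?thesis
  proof (rule ev_image[of _ "n + m"])
    show "(\<lambda>y\<in>seqs q. f (ev c y)) \<in> jt_carrier alg"
      using locally_similar_points[OF f ev_point[OF c]] by (auto simp: word_alg_def)
    fix s assume s: "set s \<subseteq> {..<q}" "length s = n + m"
    have s1: "set (take n s) \<subseteq> {..<q}" "set (drop n s) \<subseteq> {..<q}"
      using s(1) set_take_subset set_drop_subset by fastforce+
    obtain j v where j: "j < r" "set v \<subseteq> {..<q}" "\<And>y. y \<in> seqs q \<Longrightarrow> ev c (take n s \<frown> y) = (j # v) \<frown> y"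
      using n[OF s1(1)] s(2) t(2) by auto
    have e: "ev c (s \<frown> y) = (j # v @ drop n s) \<frown> y" if "y \<in> seqs q" for y
    proof -
      have "drop n s \<frown> y \<in> seqs q" using s1 that by (simp add: seqs_conc)
      from j(3)[OF this] show ?thesis by simp
    qed
    have "[j] \<in> cells" using j(1) by (simp add: tree_words_def)
    hence "j # v @ drop n s \<in> cells" using cells_append[of "[j]" "v @ drop n s"] j(2) s1 by simp
    then obtain w where w: "w \<in> cells" "piece f (j # v @ drop n s) w" using m(2)[of _ 0] s by force
    have "(\<lambda>y\<in>seqs q. f (ev c y)) (s \<frown> y) = w \<frown> y" if "y \<in> seqs q" for y
      using w(2) e[OF that] that s(1) by (simp add: piece_iff seqs_conc)
    thus "\<exists>v\<in>cells. \<forall>y\<in>seqs q. (\<lambda>y\<in>seqs q. f (ev c y)) (s \<frown> y) = v \<frown> y" using w(1) by blast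
  qed
qed

text \<open>The inverse of \<open>boundary\<close>: left composition with \<open>f\<close>, pulled
  back to the free algebra along \<open>ev\<close>.\<close>

definition lift :: "(nat word \<Rightarrow> nat word) \<Rightarrow> jt_term set \<Rightarrow> jt_term set" where
  "lift f = (\<lambda>c\<in>jt_carrier free. inv_into (jt_carrier free) ev (\<lambda>y\<in>seqs q. f (ev c y)))"

lemma lift_closed:
  assumes "locally_similar f" "c \<in> jt_carrier free"
  shows "lift f c \<in> jt_carrier free" "ev (lift f c) = (\<lambda>y\<in>seqs q. f (ev c y))"
  using locally_similar_ev[OF assms] assms(2)
  by (simp_all add: lift_def inv_into_into f_inv_into_f)

lemma ev_eqD: "c \<in> jt_carrier free \<Longrightarrow> d \<in> jt_carrier free \<Longrightarrow> ev c = ev d \<Longrightarrow> c = d"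
  using ev_inj by (auto dest: inj_onD)

lemma lift_hom:
  assumes f: "locally_similar f"
  shows "lift f \<in> jt_hom q free free"
  unfolding jt_hom_def
proof (intro CollectI conjI allI impI ballI; (elim conjE)?)
  have h: "(\<lambda>c. \<lambda>y\<in>seqs q. f (ev c y)) \<in> jt_hom q free alg"
    by (rule post_compose_hom[OF ev_hom locally_similar_points[OF f]])
  note l = lift_closed[OF f]
  note V = jt_varietyD[OF jt_variety_jt_free]
  show "lift f \<in> jt_carrier free \<rightarrow> jt_carrier free" using l(1) by blast
  fix xs assume xs: "length xs = q" "set xs \<subseteq> jt_carrier free"
  have m: "length (map (lift f) xs) = q" "set (map (lift f) xs) \<subseteq> jt_carrier free" using xs l(1) by auto
  have e: "map ev (map (lift f) xs) = map (\<lambda>c. \<lambda>y\<in>seqs q. f (ev c y)) xs" using xs l(2) by auto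
  show "lift f (jt_lam free xs) = jt_lam free (map (lift f) xs)"
  proof (rule ev_eqD[OF l(1)[OF V(1)[OF xs]] V(1)[OF m]])
    show "ev (lift f (jt_lam free xs)) = ev (jt_lam free (map (lift f) xs))"
      unfolding l(2)[OF V(1)[OF xs]] homD(2)[OF ev_hom m] e by (rule homD(2)[OF h xs])
  qed
next
  have h: "(\<lambda>c. \<lambda>y\<in>seqs q. f (ev c y)) \<in> jt_hom q free alg"
    by (rule post_compose_hom[OF ev_hom locally_similar_points[OF f]])
  note l = lift_closed[OF f]
  note V = jt_varietyD[OF jt_variety_jt_free]
  fix i c assume ic: "i < q" "c \<in> jt_carrier free"
  show "lift f (jt_alp free i c) = jt_alp free i (lift f c)"
  proof (rule ev_eqD[OF l(1)[OF V(2)[OF ic]] V(2)[OF ic(1) l(1)[OF ic(2)]]])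
    show "ev (lift f (jt_alp free i c)) = ev (jt_alp free i (lift f c))"
      unfolding l(2)[OF V(2)[OF ic]] homD(3)[OF ev_hom ic(1) l(1)[OF ic(2)]] l(2)[OF ic(2)]
      by (rule homD(3)[OF h ic])
  qed
qed

lemma lift_lift:
  assumes f: "f \<in> homeos" and g: "g \<in> homeos" and fg: "f \<circ> g = id" and c: "c \<in> jt_carrier free"
  shows "lift f (lift g c) = c"
proof (rule ev_eqD)
  have ls: "locally_similar f" "locally_similar g" using f g by (auto simp: homeos_def)
  note lg = lift_closed[OF ls(2) c]
  show "lift f (lift g c) \<in> jt_carrier free" by (rule lift_closed[OF ls(1) lg(1)])
  have "f (g x) = x" for x using fun_cong[OF fg, of x] by simp
  hence "ev (lift f (lift g c)) = (\<lambda>y\<in>seqs q. ev c y)"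
    by (simp add: lift_closed(2)[OF ls(1) lg(1)] lg(2) cong: restrict_cong)
  also have "\<dots> = ev c" using ev_closed[OF c] by (simp add: word_alg_def PiE_def extensional_restrict)
  finally show "ev (lift f (lift g c)) = ev c" .
qed (rule c)

lemma lift_autos:
  assumes f: "f \<in> homeos"
  shows "lift f \<in> autos"
proof -
  have b: "bij f" and ls: "locally_similar f" using f by (auto simp: homeos_def)
  have i: "pinv f \<in> homeos" by (rule homeos_inv[OF f])
  have fi: "f \<circ> pinv f = id" "pinv f \<circ> f = id" using b by (auto simp: fun_eq_iff inv_apply)
  have "bij_betw (lift f) (jt_carrier free) (jt_carrier free)"
    by (rule bij_betw_byWitness[of _ "lift (pinv f)"])
      (use lift_lift[OF f i fi(1)] lift_lift[OF i f fi(2)] lift_closed(1) ls i in \<open>auto simp: homeos_def\<close>)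
  thus ?thesis using lift_hom[OF ls] by (simp add: Bij_def lift_def)
qed

lemma boundary_lift:
  assumes f: "f \<in> homeos"
  shows "boundary (lift f) = f"
proof
  have ls: "locally_similar f" using f by (auto simp: homeos_def)
  fix x show "boundary (lift f) x = f x"
  proof (cases "x \<in> \<Omega>")
    case True
    then obtain j y where j: "j < r" "y \<in> seqs q" "x = j ## y" using point_gen by blast
    thus ?thesis by (simp add: boundary_gen lift_closed(2)[OF ls gen_carrier] ev_gen gen_def)
  next
    case False
    thus ?thesis using f by (simp add: boundary_def homeos_def supp_in_def)
  qed
qed

lemma boundary_homeo:
  assumes a: "\<theta> \<in> autos"
  shows "boundary \<theta> \<in> homeos"
proof -
  have h: "\<theta> \<in> jt_hom q free free" and B: "bij_betw \<theta> (jt_carrier free) (jt_carrier free)"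
    using a by (auto simp: Bij_def)
  define \<tau> where "\<tau> = (\<lambda>c\<in>jt_carrier free. inv_into (jt_carrier free) \<theta> c)"
  have t: "\<tau> c \<in> jt_carrier free" "\<theta> (\<tau> c) = c" "\<tau> (\<theta> c) = c" if "c \<in> jt_carrier free" for c
    using that B homD(1)[OF h that]
    by (auto simp: \<tau>_def bij_betw_def inv_into_into f_inv_into_f)
  note V = jt_varietyD[OF jt_variety_jt_free]
  have th: "\<tau> \<in> jt_hom q free free"
    unfolding jt_hom_def
  proof (intro CollectI conjI allI impI ballI; (elim conjE)?)
    show "\<tau> \<in> jt_carrier free \<rightarrow> jt_carrier free" using t by blast
    fix xs assume xs: "length xs = q" "set xs \<subseteq> jt_carrier free"
    have m: "length (map \<tau> xs) = q" "set (map \<tau> xs) \<subseteq> jt_carrier free" using xs t(1) by auto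
    have "map \<theta> (map \<tau> xs) = xs" using xs t(2) by (auto intro!: map_idI)
    hence "\<theta> (jt_lam free (map \<tau> xs)) = jt_lam free xs" using homD(2)[OF h m] by simp
    thus "\<tau> (jt_lam free xs) = jt_lam free (map \<tau> xs)" using t(3)[OF V(1)[OF m]] by simp
  next
    fix i c assume ic: "i < q" "c \<in> jt_carrier free"
    have "\<theta> (jt_alp free i (\<tau> c)) = jt_alp free i c" using homD(3)[OF h ic(1) t(1)[OF ic(2)]] t(2) ic by simp
    thus "\<tau> (jt_alp free i c) = jt_alp free i (\<tau> c)" using t(3)[OF V(2)[OF ic(1) t(1)[OF ic(2)]]] by simp
  qed
  have "compose (jt_carrier free) \<theta> \<tau> = (\<lambda>c\<in>jt_carrier free. c)" "compose (jt_carrier free) \<tau> \<theta> = (\<lambda>c\<in>jt_carrier free. c)"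
    using t by (simp_all add: compose_def cong: restrict_cong)
  hence "boundary \<theta> \<circ> boundary \<tau> = id" "boundary \<tau> \<circ> boundary \<theta> = id"
    using boundary_compose[OF h th] boundary_compose[OF th h] boundary_id by simp_all
  hence "bij (boundary \<theta>)" by (intro o_bij)
  thus ?thesis using boundary_locally_similar[OF h] by (simp add: homeos_def supp_in_def boundary_def)
qed

lemma Higman_Thompson_simps:
  "carrier (Higman_Thompson q r) = autos"
  "\<theta> \<in> autos \<Longrightarrow> \<theta>' \<in> autos \<Longrightarrow> \<theta> \<otimes>\<^bsub>Higman_Thompson q r\<^esub> \<theta>' = compose (jt_carrier free) \<theta> \<theta>'"
  "\<one>\<^bsub>Higman_Thompson q r\<^esub> = (\<lambda>c\<in>jt_carrier free. c)"
  by (auto simp: Higman_Thompson_def jt_auto_group_def BijGroup_def)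

lemma lift_iso: "lift \<in> iso homeos.perm_group (Higman_Thompson q r)"
  unfolding iso_def hom_def
proof (intro CollectI conjI ballI)
  show "lift \<in> carrier homeos.perm_group \<rightarrow> carrier (Higman_Thompson q r)"
    using lift_autos by (simp add: Higman_Thompson_simps)
  have bi: "lift (boundary \<theta>) = \<theta>" if "\<theta> \<in> autos" for \<theta>
    by (rule inj_onD[OF boundary_inj]) (use that boundary_lift lift_autos boundary_homeo in auto)
  show "bij_betw lift (carrier homeos.perm_group) (carrier (Higman_Thompson q r))"
    by (rule bij_betw_byWitness[of _ boundary])
      (use bi boundary_lift lift_autos boundary_homeo in \<open>auto simp: Higman_Thompson_simps\<close>)
  fix f g assume "f \<in> carrier homeos.perm_group" "g \<in> carrier homeos.perm_group"
  hence fg: "f \<in> homeos" "g \<in> homeos" by simp_all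
  have l: "lift f \<in> autos" "lift g \<in> autos" "lift (f \<circ> g) \<in> autos" using fg lift_autos homeos_comp by auto
  have "boundary (compose (jt_carrier free) (lift f) (lift g)) = boundary (lift (f \<circ> g))"
    using boundary_compose l boundary_lift fg homeos_comp by auto
  hence "compose (jt_carrier free) (lift f) (lift g) = lift (f \<circ> g)"
    using inj_onD[OF boundary_inj _ autos_compose[OF l(1,2)] l(3)] by blast
  thus "lift (f \<otimes>\<^bsub>homeos.perm_group\<^esub> g) = lift f \<otimes>\<^bsub>Higman_Thompson q r\<^esub> lift g"
    by (simp add: Higman_Thompson_simps(2)[OF l(1,2)])
qed

lemma group_Higman_Thompson: "group (Higman_Thompson q r)"
proof -
  have "lift id = (\<lambda>c\<in>jt_carrier free. c)"
  proof (rule extensionalityI)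
    fix c assume c: "c \<in> jt_carrier free"
    note l = lift_closed[OF locally_similar_id c]
    have "ev (lift id c) = ev c" using l(2) ev_closed[OF c] by (simp add: word_alg_def PiE_def extensional_restrict)
    thus "lift id c = (\<lambda>c\<in>jt_carrier free. c) c" using ev_eqD[OF l(1) c] c by simp
  qed (simp_all add: lift_def)
  \<comment> \<open>Transport of the group structure along an isomorphism takes the image of the
    unit as the new unit; this identifies it with the one already there.\<close>
  hence "Higman_Thompson q r\<lparr>one := lift \<one>\<^bsub>homeos.perm_group\<^esub>\<rparr> = Higman_Thompson q r"
    using Higman_Thompson_simps(3) by simp
  thus ?thesis using group.iso_imp_img_group[OF homeos.group_perm_group lift_iso] by simp
qed

theorem Higman_Thompson_uniformly_simple:
  "uniformly_simple 9 (commutator_subgroup (Higman_Thompson q r)) \<and>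
   commutator_width (commutator_subgroup (Higman_Thompson q r)) \<le> 3"
  by (rule homeos.uniformly_simple_iso[OF group_Higman_Thompson lift_iso])

end

section \<open>The Neretin group\<close>

text \<open>The tightest repetition along the walk closes up to a cycle. A gap of one is excluded by
  irreflexivity, a gap of two by the absence of backtracking.\<close>

lemma nonbacktracking_inj:
  assumes acyc: "\<not> (\<exists>xs. graph_cycle E xs)" and irr: "irrefl E"
    and edge: "\<And>k. k < N \<Longrightarrow> (z k, z (Suc k)) \<in> E"
    and nb: "\<And>k. Suc (Suc k) \<le> N \<Longrightarrow> z k \<noteq> z (Suc (Suc k))"
  shows "inj_on z {..N}"
proof (rule ccontr)
  assume "\<not> inj_on z {..N}"
  then obtain a b where ab: "a < b" "b \<le> N" "z a = z b"
    unfolding inj_on_def by (metis atMost_iff linorder_neqE_nat)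
  define P where "P d \<longleftrightarrow> d > 0 \<and> (\<exists>a. a + d \<le> N \<and> z a = z (a + d))" for d
  have "P (b - a)" using ab unfolding P_def by (intro conjI exI[of _ a]) auto
  \<comment> \<open>Minimality of the gap makes the vertices strictly between the two visits
    distinct.\<close>
  define d where "d = (LEAST d. P d)"
  have Pd: "P d" unfolding d_def by (rule LeastI[of P, OF \<open>P (b - a)\<close>])
  have min: "\<not> P e" if "e < d" for e using that unfolding d_def by (rule not_less_Least)
  obtain i where i: "d > 0" "i + d \<le> N" "z i = z (i + d)" using Pd by (auto simp: P_def)
  have "d \<noteq> 1" using edge[of i] i irr by (auto simp: irrefl_def)
  moreover have "d \<noteq> 2" using nb[of i] i by auto
  ultimately have d3: "d \<ge> 3" using i(1) by linarith
  define xs where "xs = map z [i..<i + d]"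
  have inj: "inj_on z {i..<i + d}"
  proof (rule inj_onI, rule ccontr)
    have neq: False if "a < b" "i \<le> a" "b < i + d" "z a = z b" for a b
    proof -
      have "P (b - a)" using that i unfolding P_def by (intro conjI exI[of _ a]) auto
      thus False using min[of "b - a"] that by auto
    qed
    fix a b assume "a \<in> {i..<i + d}" "b \<in> {i..<i + d}" "z a = z b" "a \<noteq> b"
    thus False using neq[of a b] neq[of b a] by (cases "a < b") auto
  qed
  have "graph_cycle E xs"
    unfolding graph_cycle_def
  proof (intro conjI)
    show "length xs \<ge> 3" using d3 by (simp add: xs_def)
    show "distinct xs" using inj by (simp add: xs_def distinct_map)
    show "successively (\<lambda>x y. (x, y) \<in> E) xs"
      using edge i by (auto simp: successively_conv_nth xs_def)
    have ne: "xs \<noteq> []" using i by (simp add: xs_def)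
    have "last xs = z (i + d - 1)" using ne i by (simp add: last_conv_nth xs_def add.commute)
    moreover have "hd xs = z (i + d)" using ne i by (simp add: hd_conv_nth xs_def)
    moreover have "Suc (i + d - 1) = i + d" using i by simp
    ultimately show "(last xs, hd xs) \<in> E" using edge[of "i + d - 1"] i by (metis Suc_le_eq)
  qed
  thus False using acyc by blast
qed

definition enum :: "'a set \<Rightarrow> nat \<Rightarrow> 'a" where
  "enum S = (SOME f. bij_betw f {..<card S} S)"

lemma enum_bij: "finite S \<Longrightarrow> bij_betw (enum S) {..<card S} S"
  unfolding enum_def using ex_bij_betw_nat_finite[of S]
  by (intro someI_ex[of "\<lambda>f. bij_betw f {..<card S} S"]) (simp add: atLeast0LessThan)

section \<open>Coding the vertices of the regular tree by words\<close>

locale neretin =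
  fixes q :: nat and V :: "'v set" and E :: "'v rel"
  assumes q2: "q \<ge> 2" and tree: "regular_tree (q + 1) V E"
begin

abbreviation W where "W \<equiv> tree_words q (Suc q)"

definition root :: 'v where "root = (SOME x. x \<in> V)"

text \<open>The recursion runs over the reversed word, whose head is the last step away from the
  root. The first component is the set of parents: empty at the root, a singleton elsewhere, so that
  both cases share one formula for the children.\<close>

primrec rnode :: "nat list \<Rightarrow> 'v set \<times> 'v" where
  "rnode [] = ({}, root)"
| "rnode (i # s) = ({snd (rnode s)}, enum (E `` {snd (rnode s)} - fst (rnode s)) i)"

definition node where "node w = snd (rnode (rev w))"
definition parents where "parents w = fst (rnode (rev w))"
definition children where "children w = E `` {node w} - parents w"

definition arity :: "nat list \<Rightarrow> nat" where "arity w = (if w = [] then Suc q else q)"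

lemma node_simps:
  "node [] = root" "node (w @ [i]) = enum (children w) i" "parents [] = {}" "parents (w @ [i]) = {node w}"
  by (simp_all add: node_def parents_def children_def)

lemma E_props: "E \<subseteq> V \<times> V" "(x, y) \<in> E \<Longrightarrow> (y, x) \<in> E" "irrefl E" "\<not> (\<exists>xs. graph_cycle E xs)"
  "x \<in> V \<Longrightarrow> y \<in> V \<Longrightarrow> (x, y) \<in> E\<^sup>*" "x \<in> V \<Longrightarrow> finite (E `` {x})" "x \<in> V \<Longrightarrow> card (E `` {x}) = Suc q"
  "V \<noteq> {}"
  using tree unfolding regular_tree_def tree_def simple_graph_def sym_def by (blast | simp)+

lemma words_snoc: "w @ [i] \<in> W \<longleftrightarrow> w \<in> W \<and> i < arity w"
proof (cases "w = []")
  case True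
  thus ?thesis by (simp add: tree_words_def arity_def)
next
  case False
  thus ?thesis using tree_words_append[OF False, of "[i]" q "Suc q"] by (simp add: arity_def)
qed

lemma node_children:
  "w \<in> W \<Longrightarrow> node w \<in> V \<and> bij_betw (\<lambda>i. node (w @ [i])) {..<arity w} (children w)"
proof (induction w rule: rev_induct)
  case Nil
  have r: "root \<in> V" unfolding root_def using E_props(8) by (auto intro: someI)
  have "children [] = E `` {root}" by (simp add: children_def node_simps)
  moreover have "(\<lambda>i. node ([] @ [i])) = enum (children [])" by (rule ext) (simp only: node_simps)
  ultimately show ?case
    using enum_bij[OF E_props(6)[OF r]] E_props(7)[OF r] r
    by (simp add: arity_def node_simps(1))
next
  case (snoc i w)
  hence w: "w \<in> W" "i < arity w" by (simp_all add: words_snoc)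
  hence IH: "node w \<in> V" "bij_betw (\<lambda>i. node (w @ [i])) {..<arity w} (children w)" using snoc by auto
  have "node (w @ [i]) \<in> children w" using bij_betwE[OF IH(2)] w(2) by auto
  hence e: "(node w, node (w @ [i])) \<in> E" by (auto simp: children_def)
  hence v: "node (w @ [i]) \<in> V" using E_props(1) by auto
  \<comment> \<open>The parent is one of the \<open>q + 1\<close> neighbours, which leaves
    \<open>q\<close> children.\<close>
  have e': "node w \<in> E `` {node (w @ [i])}" using E_props(2)[OF e] by auto
  have c: "card (children (w @ [i])) = arity (w @ [i])"
    using e' E_props(6,7)[OF v] by (simp add: children_def node_simps(4) arity_def)
  have f: "finite (children (w @ [i]))" using E_props(6)[OF v] by (simp add: children_def)
  have "(\<lambda>j. node ((w @ [i]) @ [j])) = enum (children (w @ [i]))" by (rule ext) (simp only: node_simps)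
  thus ?case using enum_bij[OF f] v unfolding c by simp
qed

lemma node_edge: "w @ [i] \<in> W \<Longrightarrow> (node w, node (w @ [i])) \<in> E"
proof -
  assume "w @ [i] \<in> W"
  hence w: "w \<in> W" "i < arity w" by (simp_all add: words_snoc)
  thus ?thesis using bij_betwE[OF conjunct2[OF node_children[OF w(1)]]] by (auto simp: children_def)
qed

lemma node_sibling: "w @ [i] \<in> W \<Longrightarrow> w @ [j] \<in> W \<Longrightarrow> node (w @ [i]) = node (w @ [j]) \<Longrightarrow> i = j"
  using node_children[of w] by (auto simp: words_snoc bij_betw_def inj_on_def)

lemma node_grandchild: "w @ [i, j] \<in> W \<Longrightarrow> node (w @ [i, j]) \<noteq> node w"
proof
  assume a: "w @ [i, j] \<in> W" and e: "node (w @ [i, j]) = node w"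
  have w: "w @ [i] \<in> W" "j < arity (w @ [i])" using a words_snoc[of "w @ [i]" j] by auto
  hence "node ((w @ [i]) @ [j]) \<in> children (w @ [i])"
    using bij_betwE[OF conjunct2[OF node_children[OF w(1)]]] by auto
  hence "node (w @ [i, j]) \<notin> {node w}" unfolding children_def node_simps(4) by simp
  thus False using e by simp
qed

lemma words_prefix: "u @ s \<in> W \<Longrightarrow> u \<in> W"
  by (cases "u = []") (simp_all add: tree_words_append)

text \<open>The walk from \<open>node w\<close> up to the longest common prefix and down to
  \<open>node w'\<close> does not backtrack. If its ends coincide,
  \<open>nonbacktracking_inj\<close> forces it to have length zero.\<close>

lemma node_inj: "inj_on node W"
proof (rule inj_onI)
  fix w w' assume w: "w \<in> W" "w' \<in> W" and eq: "node w = node w'"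
  obtain p a b where pab: "w = p @ a" "w' = p @ b" "a = [] \<or> b = [] \<or> hd a \<noteq> hd b"
  proof -
    have "\<exists>p a b. w = p @ a \<and> w' = p @ b \<and> (a = [] \<or> b = [] \<or> hd a \<noteq> hd b)"
    proof (induction w arbitrary: w')
      case (Cons x w)
      show ?case
      proof (cases "\<exists>v. w' = x # v")
        case True
        then obtain v where v: "w' = x # v" by auto
        from Cons.IH[of v] obtain p a b where "w = p @ a" "v = p @ b" "a = [] \<or> b = [] \<or> hd a \<noteq> hd b" by auto
        thus ?thesis using v by (intro exI[of _ "x # p"] exI[of _ a] exI[of _ b]) auto
      next
        case False
        thus ?thesis by (intro exI[of _ "[]"] exI[of _ "x # w"] exI[of _ w']) (cases w', auto)
      qed
    qed auto
    thus ?thesis using that by blast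
  qed
  define m where "m = length a"
  define N where "N = m + length b"
  \<comment> \<open>The first \<open>m\<close> steps climb along \<open>a\<close>, the remaining
    ones descend along \<open>b\<close>.\<close>
  define z where "z k = (if k \<le> m then node (p @ take (m - k) a) else node (p @ take (k - m) b))" for k
  have za: "z k = node (p @ take (m - k) a)" if "k \<le> m" for k using that by (simp add: z_def)
  have zb: "z (m + k) = node (p @ take k b)" for k by (cases k) (auto simp: z_def)
  have pW: "p @ take k a \<in> W" "p @ take k b \<in> W" for k
    using w words_prefix[of "p @ take k a" "drop k a"] words_prefix[of "p @ take k b" "drop k b"]
    by (simp_all add: pab)
  have down: "(node (p @ take k c), node (p @ take (Suc k) c)) \<in> E" if "k < length c" "c = a \<or> c = b" for k c
  proof -
    have "(p @ take k c) @ [c ! k] \<in> W" using pW(1)[of "Suc k"] pW(2)[of "Suc k"] that take_Suc_conv_app_nth[of k c] by auto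
    from node_edge[OF this] show ?thesis using that by (simp add: take_Suc_conv_app_nth)
  qed
  have down2: "node (p @ take (Suc (Suc k)) c) \<noteq> node (p @ take k c)" if "Suc k < length c" "c = a \<or> c = b" for k c
  proof -
    have t: "take (Suc (Suc k)) c = take k c @ [c ! k, c ! Suc k]" using that(1) by (simp add: take_Suc_conv_app_nth)
    hence "(p @ take k c) @ [c ! k, c ! Suc k] \<in> W"
      using pW(1)[of "Suc (Suc k)"] pW(2)[of "Suc (Suc k)"] that(2) by auto
    from node_grandchild[OF this] show ?thesis by (simp add: t)
  qed
  have "inj_on z {..N}"
  proof (rule nonbacktracking_inj[OF E_props(4) E_props(3)])
    fix k assume k: "k < N"
    show "(z k, z (Suc k)) \<in> E"
    proof (cases "k < m")
      case True
      hence "m - k = Suc (m - Suc k)" by simp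
      hence "(z (Suc k), z k) \<in> E" using True za[of k] za[of "Suc k"] down[of "m - Suc k" a] by (simp add: m_def)
      thus ?thesis by (rule E_props(2))
    next
      case False
      then obtain j where j: "k = m + j" using le_Suc_ex by (metis not_less)
      thus ?thesis using zb[of j] zb[of "Suc j"] down[of j b] k by (simp add: N_def)
    qed
  next
    fix k assume k: "Suc (Suc k) \<le> N"
    consider "Suc (Suc k) \<le> m" | "Suc k = m" | "m \<le> k" by linarith
    thus "z k \<noteq> z (Suc (Suc k))"
    proof cases
      case 1
      hence "m - k = Suc (Suc (m - Suc (Suc k)))" by simp
      thus ?thesis using 1 za[of k] za[of "Suc (Suc k)"] down2[of "m - Suc (Suc k)" a] by (simp add: m_def)
    next
      case 2
      \<comment> \<open>The turning point: the vertices before and after it are children of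
        \<open>node p\<close> with different last letters.\<close>
      hence l: "a \<noteq> []" "b \<noteq> []" using k by (auto simp: m_def N_def)
      have ta: "take (Suc 0) a = [hd a]" "take (Suc 0) b = [hd b]" using l by (simp_all add: take_Suc)
      have "m - k = Suc 0" using 2 by simp
      hence "z k = node (p @ [hd a])" using za[of k] 2 ta by simp
      moreover have "z (Suc (Suc k)) = node (p @ [hd b])" using zb[of "Suc 0"] 2 ta by simp
      moreover have "p @ [hd a] \<in> W" "p @ [hd b] \<in> W" using pW[of "Suc 0"] ta by simp_all
      ultimately show ?thesis using node_sibling[of p "hd a" "hd b"] pab(3) l by auto
    next
      case 3
      then obtain j where j: "k = m + j" using le_Suc_ex by metis
      thus ?thesis using zb[of j] zb[of "Suc (Suc j)"] down2[of j b] k by (simp add: N_def)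
    qed
  qed
  moreover have "z 0 = z N" using za[of 0] zb[of "length b"] eq by (simp add: m_def N_def pab)
  ultimately have "N = 0" by (auto simp: inj_on_def)
  thus "w = w'" by (simp add: N_def m_def pab)
qed

text \<open>Connectivity: along a path from the root, each neighbour of a coded vertex is its parent
  or one of its children.\<close>

lemma node_image: "node ` W = V"
proof
  show "node ` W \<subseteq> V" using node_children by auto
  show "V \<subseteq> node ` W"
  proof
    fix x assume x: "x \<in> V"
    have r: "root \<in> V" using node_children[of "[]"] by (simp add: node_simps)
    from E_props(5)[OF r x] show "x \<in> node ` W"
    proof (induction rule: rtrancl_induct)
      case base
      show ?case using node_simps(1) by (intro image_eqI[of _ _ "[]"]) auto
    next
      case (step y z)
      then obtain w where w: "w \<in> W" "y = node w" by auto
      show ?case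
      proof (cases "z \<in> parents w")
        case True
        then obtain w0 i where "w = w0 @ [i]" by (cases w rule: rev_cases) (auto simp: node_simps)
        thus ?thesis using True w words_snoc by (auto simp: node_simps)
      next
        case False
        hence "z \<in> children w" using step w by (auto simp: children_def)
        then obtain i where "i < arity w" "z = node (w @ [i])"
          using node_children[OF w(1)] by (auto simp: bij_betw_def)
        thus ?thesis using w words_snoc by blast
      qed
    qed
  qed
qed

definition adj :: "nat list \<Rightarrow> nat list \<Rightarrow> bool" where
  "adj u v \<longleftrightarrow> (\<exists>i. v = u @ [i]) \<or> (\<exists>i. u = v @ [i])"

lemma adj_iff: "u \<in> W \<Longrightarrow> v \<in> W \<Longrightarrow> (node u, node v) \<in> E \<longleftrightarrow> adj u v"
proof
  assume u: "u \<in> W" and v: "v \<in> W" and e: "(node u, node v) \<in> E"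
  show "adj u v"
  proof (cases "node v \<in> parents u")
    case True
    then obtain w0 i where w: "u = w0 @ [i]" by (cases u rule: rev_cases) (auto simp: node_simps)
    hence "node v = node w0" "w0 \<in> W" using True u by (auto simp: node_simps words_snoc)
    hence "v = w0" using inj_onD[OF node_inj] v by blast
    thus ?thesis using w by (auto simp: adj_def)
  next
    case False
    hence "node v \<in> children u" using e by (auto simp: children_def)
    then obtain i where i: "i < arity u" "node v = node (u @ [i])"
      using node_children[OF u] by (auto simp: bij_betw_def)
    hence "v = u @ [i]" using inj_onD[OF node_inj] v u words_snoc by blast
    thus ?thesis by (auto simp: adj_def)
  qed
next
  assume "u \<in> W" "v \<in> W" "adj u v"
  thus "(node u, node v) \<in> E" using node_edge E_props(2) by (auto simp: adj_def)
qed

definition code :: "'v \<Rightarrow> nat list" where "code = inv_into W node"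

lemma code_simps: "w \<in> W \<Longrightarrow> code (node w) = w" "x \<in> V \<Longrightarrow> code x \<in> W" "x \<in> V \<Longrightarrow> node (code x) = x"
  using node_inj node_image by (auto simp: code_def inv_into_into f_inv_into_f)

lemma node_V: "w \<in> W \<Longrightarrow> node w \<in> V" using node_image by auto

end

text \<open>The automorphisms of the rooted \<open>q\<close>-ary tree, seen on its boundary as the
  bijections that preserve the length of common prefixes.\<close>

definition isometries :: "nat \<Rightarrow> (nat word \<Rightarrow> nat word) set" where
  "isometries q = {\<kappa>. bij_betw \<kappa> (seqs q) (seqs q) \<and>
     (\<forall>y\<in>seqs q. \<forall>z\<in>seqs q. \<forall>k. prefix k y = prefix k z \<longleftrightarrow> prefix k (\<kappa> y) = prefix k (\<kappa> z))}"

lemma isometriesI: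
  "bij_betw \<kappa> (seqs q) (seqs q) \<Longrightarrow> (\<And>y z k. y \<in> seqs q \<Longrightarrow> z \<in> seqs q \<Longrightarrow>
     prefix k y = prefix k z \<longleftrightarrow> prefix k (\<kappa> y) = prefix k (\<kappa> z)) \<Longrightarrow> \<kappa> \<in> isometries q"
  by (simp add: isometries_def)

lemma isometriesD:
  assumes "\<kappa> \<in> isometries q"
  shows "bij_betw \<kappa> (seqs q) (seqs q)"
    "y \<in> seqs q \<Longrightarrow> z \<in> seqs q \<Longrightarrow> prefix k y = prefix k z \<longleftrightarrow> prefix k (\<kappa> y) = prefix k (\<kappa> z)"
  using assms unfolding isometries_def by blast+

lemma prefix_build: "prefix (Suc k) (i ## y) = i # prefix k y"
  using prefix_conc_snd[of "[i]" "Suc k" y] by simp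

lemma word_eqI: "(\<And>k. prefix k x = prefix k y) \<Longrightarrow> x = y"
  by (metis ext lessI prefix_eq_iff)

lemma isometries_self_similar:
  assumes "q \<ge> 2" "r \<ge> 1"
  shows "self_similar q r (isometries q)"
proof
  have mem: "\<kappa> y \<in> seqs q" if "\<kappa> \<in> isometries q" "y \<in> seqs q" for \<kappa> y
    using bij_betwE[OF isometriesD(1)[OF that(1)]] that(2) by blast
  show "q \<ge> 2" "r \<ge> 1" by (rule assms)+
  show "id \<in> isometries q" by (rule isometriesI) simp_all
  show "\<kappa> \<circ> \<kappa>' \<in> isometries q" if k: "\<kappa> \<in> isometries q" "\<kappa>' \<in> isometries q" for \<kappa> \<kappa>'
  proof -
    have "bij_betw (\<kappa> \<circ> \<kappa>') (seqs q) (seqs q)"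
      by (rule bij_betw_trans[OF isometriesD(1)[OF k(2)] isometriesD(1)[OF k(1)]])
    moreover have "prefix k y = prefix k z \<longleftrightarrow> prefix k ((\<kappa> \<circ> \<kappa>') y) = prefix k ((\<kappa> \<circ> \<kappa>') z)"
      if "y \<in> seqs q" "z \<in> seqs q" for y z k
    proof -
      have "prefix k y = prefix k z \<longleftrightarrow> prefix k (\<kappa>' y) = prefix k (\<kappa>' z)"
        by (rule isometriesD(2)[OF k(2) that])
      also have "\<dots> \<longleftrightarrow> prefix k (\<kappa> (\<kappa>' y)) = prefix k (\<kappa> (\<kappa>' z))"
        by (rule isometriesD(2)[OF k(1) mem[OF k(2) that(1)] mem[OF k(2) that(2)]])
      finally show ?thesis by simp
    qed
    ultimately show ?thesis by (rule isometriesI)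
  qed
  show "\<exists>\<kappa>'\<in>isometries q. \<forall>y\<in>seqs q. \<kappa>' (\<kappa> y) = y \<and> \<kappa> (\<kappa>' y) = y" if k: "\<kappa> \<in> isometries q" for \<kappa>
  proof -
    define \<kappa>' where "\<kappa>' = inv_into (seqs q) \<kappa>"
    note b = isometriesD(1)[OF k]
    have e: "\<kappa>' (\<kappa> y) = y" "\<kappa> (\<kappa>' y) = y" "\<kappa>' y \<in> seqs q" if "y \<in> seqs q" for y
      using b that by (auto simp: \<kappa>'_def bij_betw_def f_inv_into_f inv_into_into)
    have "bij_betw \<kappa>' (seqs q) (seqs q)" unfolding \<kappa>'_def by (rule bij_betw_inv_into[OF b])
    moreover have "prefix k y = prefix k z \<longleftrightarrow> prefix k (\<kappa>' y) = prefix k (\<kappa>' z)"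
      if "y \<in> seqs q" "z \<in> seqs q" for y z k
      using isometriesD(2)[OF k e(3) e(3), OF that, of k] e(2)[OF that(1)] e(2)[OF that(2)] by simp
    ultimately have "\<kappa>' \<in> isometries q" by (rule isometriesI)
    thus ?thesis using e by blast
  qed
  show "\<exists>j<q. \<exists>\<kappa>'\<in>isometries q. \<forall>y\<in>seqs q. \<kappa> (i ## y) = j ## \<kappa>' y"
    if k: "\<kappa> \<in> isometries q" and i: "i < q" for \<kappa> i
  proof -
    note b = isometriesD(1)[OF k]
    note iso = isometriesD(2)[OF k]
    have z0: "(\<lambda>_. 0) \<in> seqs q" using assms by (simp add: seqs_def)
    \<comment> \<open>The first letter of the image depends only on the first letter of the
      argument, so it can be read off at a single sequence.\<close>
    define j where "j = \<kappa> (i ## (\<lambda>_. 0)) 0"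
    have iy: "i ## y \<in> seqs q" if "y \<in> seqs q" for y using that i by (simp add: seqs_build)
    have first: "x 0 = i \<longleftrightarrow> \<kappa> x 0 = j" if "x \<in> seqs q" for x
      using iso[OF that iy[OF z0], of "Suc 0"] by (simp add: j_def)
    define \<kappa>' where "\<kappa>' y = suffix (Suc 0) (\<kappa> (i ## y))" for y
    have e: "\<kappa> (i ## y) = j ## \<kappa>' y" if "y \<in> seqs q" for y
    proof -
      have "\<kappa> (i ## y) 0 = j" using first[OF iy[OF that]] by simp
      thus ?thesis unfolding \<kappa>'_def by (rule build_suffix[symmetric])
    qed
    have j: "j < q" using mem[OF k iy[OF z0]] by (simp add: seqs_def j_def)
    have m: "\<kappa>' y \<in> seqs q" if "y \<in> seqs q" for y
      using mem[OF k iy[OF that]] by (simp add: e[OF that] seqs_build)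
    have "bij_betw \<kappa>' (seqs q) (seqs q)"
      unfolding bij_betw_def
    proof
      show "inj_on \<kappa>' (seqs q)"
      proof (rule inj_onI)
        fix y z assume yz: "y \<in> seqs q" "z \<in> seqs q" "\<kappa>' y = \<kappa>' z"
        hence "\<kappa> (i ## y) = \<kappa> (i ## z)" by (simp add: e)
        thus "y = z" using b iy[OF yz(1)] iy[OF yz(2)] by (auto simp: bij_betw_def dest: inj_onD)
      qed
      have "w \<in> \<kappa>' ` seqs q" if w: "w \<in> seqs q" for w
      proof -
        have "j ## w \<in> \<kappa> ` seqs q" using w j b by (simp add: seqs_build bij_betw_def)
        then obtain x where x: "x \<in> seqs q" "\<kappa> x = j ## w" by auto
        hence "x 0 = i" using first[OF x(1)] by simp
        hence "i ## suffix (Suc 0) x = x" by (rule build_suffix)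
        hence "\<kappa>' (suffix (Suc 0) x) = w" using x(2) by (simp add: \<kappa>'_def suffix_build)
        thus ?thesis using suffix_seqs[OF x(1)] by blast
      qed
      thus "\<kappa>' ` seqs q = seqs q" using m by blast
    qed
    moreover have "prefix k y = prefix k z \<longleftrightarrow> prefix k (\<kappa>' y) = prefix k (\<kappa>' z)" if "y \<in> seqs q" "z \<in> seqs q" for y z k
      using iso[OF iy[OF that(1)] iy[OF that(2)], of "Suc k"]
      by (simp add: e that prefix_build del: subseq_to_Suc)
    ultimately have "\<kappa>' \<in> isometries q" by (rule isometriesI)
    thus ?thesis using j e by blast
  qed
qed (drule isometriesD(1), drule bij_betwE, drule (1) bspec)

section \<open>Almost automorphisms of the word tree and their boundary maps\<close>

context neretin
begin

sublocale self_similar q "Suc q" "isometries q"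
  by (rule isometries_self_similar) (use q2 in auto)

definition waut :: "(nat list \<Rightarrow> nat list) \<Rightarrow> bool" where
  "waut F \<longleftrightarrow> bij_betw F W W \<and> finite {(u, v). u \<in> W \<and> v \<in> W \<and> adj u v \<noteq> adj (F u) (F v)}"

text \<open>\<open>g\<close> is the extension of \<open>F\<close> to the boundary. The condition on
  the lengths makes the images of prefixes exhaust \<open>g x\<close>, so that \<open>F\<close>
  determines \<open>g\<close> on \<open>\<Omega>\<close>.\<close>

definition induces :: "(nat list \<Rightarrow> nat list) \<Rightarrow> (nat word \<Rightarrow> nat word) \<Rightarrow> bool" where
  "induces F g \<longleftrightarrow> (\<exists>n. \<forall>x\<in>\<Omega>. \<forall>N\<ge>n. F (prefix N x) = prefix (length (F (prefix N x))) (g x) \<and>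
     length (F (prefix (Suc N) x)) = Suc (length (F (prefix N x))))"

definition descends :: "(nat list \<Rightarrow> nat list) \<Rightarrow> nat \<Rightarrow> bool" where
  "descends F n \<longleftrightarrow> n > 0 \<and> (\<forall>w\<in>W. length w \<ge> n \<longrightarrow> F w \<noteq> []) \<and>
     (\<forall>w i. w @ [i] \<in> W \<longrightarrow> length w \<ge> n \<longrightarrow> (\<exists>j. F (w @ [i]) = F w @ [j]))"

lemma descendsD:
  "descends F n \<Longrightarrow> n > 0"
  "descends F n \<Longrightarrow> w \<in> W \<Longrightarrow> length w \<ge> n \<Longrightarrow> F w \<noteq> []"
  "descends F n \<Longrightarrow> w @ [i] \<in> W \<Longrightarrow> length w \<ge> n \<Longrightarrow> \<exists>j. F (w @ [i]) = F w @ [j]"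
  unfolding descends_def by blast+

text \<open>Beyond the finitely many bad pairs each edge of a descending path is sent to an edge,
  traversed up or down. Once a step goes down, injectivity forbids turning back; steps going up are
  limited by the depth at which they start.\<close>

lemma waut_deep:
  assumes "waut F"
  obtains n where "descends F n"
proof -
  have b: "bij_betw F W W" using assms by (simp add: waut_def)
  define B where "B = {(u, v). u \<in> W \<and> v \<in> W \<and> adj u v \<noteq> adj (F u) (F v)}"
  have "finite (length ` fst ` B)" using assms by (simp add: waut_def B_def)
  \<comment> \<open>From depth \<open>n0\<close> of the first vertex on, adjacency is preserved
    exactly.\<close>
  then obtain n0 where n0: "\<And>u v. (u, v) \<in> B \<Longrightarrow> length u < n0"
    unfolding finite_nat_set_iff_bounded by force
  have adjF: "adj u v \<longleftrightarrow> adj (F u) (F v)" if "u \<in> W" "v \<in> W" "length u \<ge> n0" for u v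
    using n0[of u v] that by (auto simp: B_def)
  define good where "good w \<longleftrightarrow> (\<forall>i. w @ [i] \<in> W \<longrightarrow> (\<exists>j. F (w @ [i]) = F w @ [j]))" for w
  have step: "good (p @ [i])" if p: "p @ [i] \<in> W" "length p \<ge> n0" and j: "F (p @ [i]) = F p @ [j]" for p i j
    unfolding good_def
  proof (intro allI impI)
    fix k assume k: "(p @ [i]) @ [k] \<in> W"
    have "adj (p @ [i]) ((p @ [i]) @ [k])" by (auto simp: adj_def)
    hence "adj (F (p @ [i])) (F ((p @ [i]) @ [k]))" using adjF[OF p(1) k] p(2) by simp
    thus "\<exists>l. F ((p @ [i]) @ [k]) = F (p @ [i]) @ [l]"
    proof (cases rule: disjE[OF \<open>adj (F (p @ [i])) (F ((p @ [i]) @ [k]))\<close>[unfolded adj_def]])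
      case 2
      then obtain l where "F p @ [j] = F ((p @ [i]) @ [k]) @ [l]" using j by auto
      hence "F p = F ((p @ [i]) @ [k])" by simp
      moreover have "p \<in> W" using p(1) words_snoc by simp
      ultimately have "p = (p @ [i]) @ [k]" using b k by (auto simp: bij_betw_def dest: inj_onD)
      thus ?thesis by simp
    qed auto
  qed
  have "finite (length ` F ` {w \<in> W. length w = n0})" using finite_tree_words by blast
  then obtain M where M: "\<And>w. w \<in> W \<Longrightarrow> length w = n0 \<Longrightarrow> length (F w) \<le> M"
    unfolding finite_nat_set_iff_bounded_le by auto
  \<comment> \<open>While the images keep climbing, every step costs one of at most \<open>M\<close>
    available levels.\<close>
  have depth: "good w \<or> length (F w) + k \<le> M" if "w \<in> W" "length w = n0 + k" for w k
    using that
  proof (induction k arbitrary: w)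
    case 0
    thus ?case using M by simp
  next
    case (Suc k)
    then obtain p i where w: "w = p @ [i]" by (cases w rule: rev_cases) auto
    have p: "p \<in> W" "length p = n0 + k" using Suc.prems words_snoc by (auto simp: w)
    have "adj p w" by (auto simp: adj_def w)
    hence "adj (F p) (F w)" using adjF[OF p(1) Suc.prems(1)] p(2) by simp
    hence "(\<exists>j. F w = F p @ [j]) \<or> (\<exists>j. F p = F w @ [j])" by (simp add: adj_def)
    thus ?case
    proof
      assume "\<exists>j. F w = F p @ [j]"
      thus ?thesis using step[of p i] Suc.prems(1) p(2) by (auto simp: w)
    next
      assume a: "\<exists>j. F p = F w @ [j]"
      show ?thesis
      proof (cases "good p")
        case True
        then obtain j where "F w = F p @ [j]" using Suc.prems(1) by (auto simp: good_def w)
        thus ?thesis using a by auto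
      next
        case False
        hence "length (F p) + k \<le> M" using Suc.IH[OF p] by simp
        thus ?thesis using a by auto
      qed
    qed
  qed
  \<comment> \<open>The one word sent to the root is kept above depth \<open>n\<close>, so that
    images of deep words are cells.\<close>
  define w0 where "w0 = inv_into W F []"
  have w0: "w = w0" if "w \<in> W" "F w = []" for w
    using that b inv_into_f_f[of F W w] by (simp add: w0_def bij_betw_def)
  define n where "n = Suc (n0 + M + length w0)"
  have "good w" if "w \<in> W" "length w \<ge> n" for w
    using depth[of w "length w - n0"] that by (auto simp: n_def)
  hence "\<exists>j. F (w @ [i]) = F w @ [j]" if "w @ [i] \<in> W" "length w \<ge> n" for w i
    using that words_snoc unfolding good_def by blast
  moreover have "F w \<noteq> []" if "w \<in> W" "length w \<ge> n" for w using w0[OF that(1)] that(2) by (auto simp: n_def)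
  moreover have "n > 0" by (simp add: n_def)
  ultimately show ?thesis using that[of n] unfolding descends_def by blast
qed

lemma induces_length:
  assumes "induces F g"
  obtains n where "\<And>x N. x \<in> \<Omega> \<Longrightarrow> N \<ge> n \<Longrightarrow> F (prefix N x) = prefix (length (F (prefix N x))) (g x)"
    "\<And>x k. x \<in> \<Omega> \<Longrightarrow> length (F (prefix (n + k) x)) = length (F (prefix n x)) + k"
proof -
  obtain n where n: "\<And>x N. x \<in> \<Omega> \<Longrightarrow> N \<ge> n \<Longrightarrow> F (prefix N x) = prefix (length (F (prefix N x))) (g x) \<and>
     length (F (prefix (Suc N) x)) = Suc (length (F (prefix N x)))"
    using assms unfolding induces_def by blast
  have "length (F (prefix (n + k) x)) = length (F (prefix n x)) + k" if "x \<in> \<Omega>" for x k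
  proof (induction k)
    case (Suc k)
    have "length (F (prefix (Suc (n + k)) x)) = Suc (length (F (prefix (n + k) x)))"
      using n[OF that, of "n + k"] by (simp del: subseq_to_Suc)
    thus ?case using Suc by (simp del: subseq_to_Suc)
  qed simp
  thus ?thesis using that[of n] n by blast
qed

lemma induces_unique:
  assumes "induces F g" "induces F' g'" "\<And>w. w \<in> W \<Longrightarrow> F w = F' w" "x \<in> \<Omega>"
  shows "g x = g' x"
proof
  fix i
  obtain n where n: "\<And>x N. x \<in> \<Omega> \<Longrightarrow> N \<ge> n \<Longrightarrow> F (prefix N x) = prefix (length (F (prefix N x))) (g x)"
    "\<And>x k. x \<in> \<Omega> \<Longrightarrow> length (F (prefix (n + k) x)) = length (F (prefix n x)) + k"
    using induces_length[OF assms(1)] by blast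
  obtain m where m: "\<And>x N. x \<in> \<Omega> \<Longrightarrow> N \<ge> m \<Longrightarrow> F' (prefix N x) = prefix (length (F' (prefix N x))) (g' x)"
    "\<And>x k. x \<in> \<Omega> \<Longrightarrow> length (F' (prefix (m + k) x)) = length (F' (prefix m x)) + k"
    using induces_length[OF assms(2)] by blast
  define N where "N = n + (m + Suc i)"
  define L where "L = length (F (prefix N x))"
  have L: "i < L" unfolding L_def N_def n(2)[OF assms(4)] by simp
  have "prefix L (g x) = F (prefix N x)" using n(1)[OF assms(4), of N] by (simp add: L_def N_def del: subseq_to_Suc)
  also have "\<dots> = F' (prefix N x)" using assms(3) prefix_points[OF assms(4)] by simp
  also have "\<dots> = prefix L (g' x)"
    using m(1)[OF assms(4), of N] assms(3)[OF prefix_points[OF assms(4)], of N] by (simp add: L_def N_def del: subseq_to_Suc)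
  finally show "g x i = g' x i" using L unfolding prefix_eq_iff by blast
qed

lemma induces_comp:
  assumes "induces F g" "induces F' g'" "\<And>x. x \<in> \<Omega> \<Longrightarrow> g' x \<in> \<Omega>"
  shows "induces (F \<circ> F') (g \<circ> g')"
proof -
  obtain n where n: "\<And>x N. x \<in> \<Omega> \<Longrightarrow> N \<ge> n \<Longrightarrow> F (prefix N x) = prefix (length (F (prefix N x))) (g x) \<and>
     length (F (prefix (Suc N) x)) = Suc (length (F (prefix N x)))"
    using assms(1) unfolding induces_def by blast
  obtain m where m: "\<And>x N. x \<in> \<Omega> \<Longrightarrow> N \<ge> m \<Longrightarrow> F' (prefix N x) = prefix (length (F' (prefix N x))) (g' x)"
    "\<And>x k. x \<in> \<Omega> \<Longrightarrow> length (F' (prefix (m + k) x)) = length (F' (prefix m x)) + k"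
    using induces_length[OF assms(2)] by blast
  show ?thesis
    unfolding induces_def
  proof (intro exI[of _ "m + n"] ballI allI impI)
    fix x N assume x: "x \<in> \<Omega>" and N: "m + n \<le> N"
    define L where "L = length (F' (prefix N x))"
    define k where "k = N - m"
    have k: "N = m + k" "k \<ge> n" "Suc N = m + Suc k" using N by (auto simp: k_def)
    have L: "L \<ge> n" "length (F' (prefix (Suc N) x)) = Suc L"
      unfolding L_def k(3) unfolding k(1) m(2)[OF x] using k(2) by auto
    have e: "F' (prefix N x) = prefix L (g' x)" using m(1)[OF x, of N] N by (simp add: L_def)
    have e': "F' (prefix (Suc N) x) = prefix (Suc L) (g' x)"
      using m(1)[OF x, of "Suc N"] N L(2) by (simp del: subseq_to_Suc)
    show "(F \<circ> F') (prefix N x) = prefix (length ((F \<circ> F') (prefix N x))) ((g \<circ> g') x) \<and>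
      length ((F \<circ> F') (prefix (Suc N) x)) = Suc (length ((F \<circ> F') (prefix N x)))"
      using n[OF assms(3)[OF x] L(1)] unfolding comp_apply e e' .
  qed
qed

text \<open>Only long words matter; this is why changes on finitely many vertices do not affect the
  boundary map.\<close>

lemma induces_cong: "induces F g \<Longrightarrow> (\<And>w. w \<in> W \<Longrightarrow> length w \<ge> m \<Longrightarrow> F w = F' w) \<Longrightarrow> induces F' g"
  unfolding induces_def
proof (elim exE)
  fix n assume F: "\<And>w. w \<in> W \<Longrightarrow> length w \<ge> m \<Longrightarrow> F w = F' w"
    and n: "\<forall>x\<in>\<Omega>. \<forall>N\<ge>n. F (prefix N x) = prefix (length (F (prefix N x))) (g x) \<and>
     length (F (prefix (Suc N) x)) = Suc (length (F (prefix N x)))"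
  have e: "F' (prefix N x) = F (prefix N x)" if "x \<in> \<Omega>" "N \<ge> m" for x N
    using F[OF prefix_points[OF that(1)], of N] that(2) by simp
  show "\<exists>n. \<forall>x\<in>\<Omega>. \<forall>N\<ge>n. F' (prefix N x) = prefix (length (F' (prefix N x))) (g x) \<and>
     length (F' (prefix (Suc N) x)) = Suc (length (F' (prefix N x)))"
  proof (intro exI[of _ "n + m"] ballI allI impI)
    fix x N assume x: "x \<in> \<Omega>" "n + m \<le> N"
    have e': "F' (prefix N x) = F (prefix N x)" "F' (prefix (Suc N) x) = F (prefix (Suc N) x)"
      using e[OF x(1), of N] e[OF x(1), of "Suc N"] x(2) by (simp_all del: subseq_to_Suc)
    show "F' (prefix N x) = prefix (length (F' (prefix N x))) (g x) \<and>
     length (F' (prefix (Suc N) x)) = Suc (length (F' (prefix N x)))"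
      unfolding e' using n x by simp
  qed
qed

lemma induces_id: "induces id id"
  unfolding induces_def by simp

text \<open>Along a ray the images of long prefixes are ever longer extensions of each other, and
  \<open>g x\<close> is their limit.\<close>

lemma waut_induces:
  assumes F: "waut F"
  shows "\<exists>g. induces F g \<and> (\<forall>x\<in>\<Omega>. g x \<in> \<Omega>) \<and> supp_in \<Omega> g"
proof -
  obtain n where "descends F n" using waut_deep[OF F] .
  note n = descendsD[OF this]
  have child: "\<exists>j. F (prefix (Suc N) x) = F (prefix N x) @ [j]" if "x \<in> \<Omega>" "N \<ge> n" for x N
    using n(3)[of "prefix N x" "x N"] prefix_points[OF that(1), of "Suc N"] that(2) by simp
  have len: "length (F (prefix (Suc N) x)) = Suc (length (F (prefix N x)))" if "x \<in> \<Omega>" "N \<ge> n" for x N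
    using child[OF that] by (auto simp del: subseq_to_Suc)
  have len': "length (F (prefix (n + k) x)) \<ge> k" if "x \<in> \<Omega>" for x k
  proof (induction k)
    case (Suc k)
    thus ?case using len[OF that, of "n + k"] by (simp del: subseq_to_Suc)
  qed simp
  have tk: "take (length (F (prefix N x))) (F (prefix (N + k) x)) = F (prefix N x)" if xN: "x \<in> \<Omega>" "N \<ge> n" for x N k
  proof (induction k)
    case (Suc k)
    obtain j where j: "F (prefix (Suc (N + k)) x) = F (prefix (N + k) x) @ [j]"
      using child[OF xN(1), of "N + k"] xN(2) by auto
    have "length (F (prefix N x)) \<le> length (F (prefix (N + k) x))"
      using arg_cong[OF Suc, of length] by (simp del: subseq_to_Suc)
    thus ?case using Suc j by (simp del: subseq_to_Suc)
  qed simp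
  \<comment> \<open>The image of the prefix of length \<open>n + i + 1\<close> has at least
    \<open>i + 1\<close> letters, so it has an \<open>i\<close>-th one.\<close>
  define g where "g x = (if x \<in> \<Omega> then \<lambda>i. F (prefix (n + Suc i) x) ! i else x)" for x
  have gi: "F (prefix N x) ! i = g x i" if x: "x \<in> \<Omega>" and N: "N \<ge> n" and i: "i < length (F (prefix N x))" for x N i
  proof (cases "N \<le> n + Suc i")
    case True
    define k where "k = n + Suc i - N"
    have "N + k = n + Suc i" using True by (simp add: k_def)
    hence "take (length (F (prefix N x))) (F (prefix (n + Suc i) x)) = F (prefix N x)" using tk[OF x N, of k] by (simp del: subseq_to_Suc)
    hence "F (prefix N x) ! i = F (prefix (n + Suc i) x) ! i" using i by (metis nth_take)
    thus ?thesis using x by (simp add: g_def del: subseq_to_Suc)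
  next
    case False
    define k where "k = N - (n + Suc i)"
    define m where "m = n + Suc i"
    have "m + k = N" "m \<ge> n" using False by (simp_all add: k_def m_def)
    hence "take (length (F (prefix m x))) (F (prefix N x)) = F (prefix m x)" using tk[OF x, of m k] by simp
    moreover have "i < length (F (prefix m x))" using len'[OF x, of "Suc i"] by (simp add: m_def del: subseq_to_Suc)
    ultimately have "F (prefix N x) ! i = F (prefix m x) ! i" by (metis nth_take)
    thus ?thesis using x by (simp add: g_def m_def del: subseq_to_Suc)
  qed
  have gp: "F (prefix N x) = prefix (length (F (prefix N x))) (g x)" if "x \<in> \<Omega>" "N \<ge> n" for x N
    using gi[OF that] by (intro nth_equalityI) simp_all
  have "g x \<in> \<Omega>" if x: "x \<in> \<Omega>" for x
  proof -
    have "g x i < (if i = 0 then Suc q else q)" for i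
    proof -
      have w: "F (prefix (n + Suc i) x) \<in> W"
        using F prefix_points[OF x, of "n + Suc i"] by (auto simp: waut_def bij_betw_def simp del: subseq_to_Suc)
      have "i < length (F (prefix (n + Suc i) x))" using len'[OF x, of "Suc i"] by (simp del: subseq_to_Suc)
      thus ?thesis using w x unfolding tree_words_def g_def by (simp del: subseq_to_Suc)
    qed
    from this[of 0] this[of "Suc i" for i] show ?thesis by (simp add: points_def)
  qed
  moreover have "induces F g" unfolding induces_def using gp len by blast
  moreover have "supp_in \<Omega> g" by (simp add: supp_in_def g_def)
  ultimately show ?thesis by blast
qed

text \<open>Below depth \<open>d\<close> the map \<open>F\<close> sends the subtree at
  \<open>u\<close> isomorphically onto the subtree at \<open>v\<close>; the action on the ends of
  this subtree is the isometry of the piece.\<close>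

lemma induced_locally_similar:
  assumes F: "waut F" and g: "induces F g" "\<And>x. x \<in> \<Omega> \<Longrightarrow> g x \<in> \<Omega>"
  shows "locally_similar g"
proof -
  have inj: "inj_on F W" and FW: "w \<in> W \<Longrightarrow> F w \<in> W" for w using F by (auto simp: waut_def bij_betw_def)
  obtain n where "descends F n" using waut_deep[OF F] .
  note n = descendsD[OF this]
  obtain m where m: "\<And>x N. x \<in> \<Omega> \<Longrightarrow> N \<ge> m \<Longrightarrow> F (prefix N x) = prefix (length (F (prefix N x))) (g x)"
    "\<And>x k. x \<in> \<Omega> \<Longrightarrow> length (F (prefix (m + k) x)) = length (F (prefix m x)) + k"
    using induces_length[OF g(1)] by blast
  define d where "d = n + m"
  show ?thesis
    unfolding locally_similar_def
  proof (intro exI[of _ d] conjI ballI impI)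
    show "d > 0" using n by (simp add: d_def)
    fix u assume u: "u \<in> cells" "length u = d"
    define v where "v = F u"
    have v: "v \<in> cells" using u n(2)[of u] FW by (simp add: v_def d_def)
    have uy: "u \<frown> y \<in> \<Omega>" if "y \<in> seqs q" for y using u that by (auto intro: points_conc)
    have Fu: "F (u @ prefix k y) = prefix (length v + k) (g (u \<frown> y))" if y: "y \<in> seqs q" for y k
    proof -
      have p: "prefix (m + (n + k)) (u \<frown> y) = u @ prefix k y" using u(2) prefix_conc_snd[of u "m + (n + k)" y] by (simp add: d_def)
      have p0: "prefix (m + n) (u \<frown> y) = u" using u(2) prefix_conc_snd[of u "m + n" y] by (simp add: d_def)
      have "length (F (u @ prefix k y)) = length v + k"
        using m(2)[OF uy[OF y], of "n + k"] m(2)[OF uy[OF y], of n] unfolding p p0 v_def by simp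
      thus ?thesis using m(1)[OF uy[OF y], of "m + (n + k)"] unfolding p by simp
    qed
    define \<kappa> where "\<kappa> y = suffix (length v) (g (u \<frown> y))" for y
    have gk: "g (u \<frown> y) = v \<frown> \<kappa> y" if "y \<in> seqs q" for y
      using Fu[OF that, of 0] unfolding \<kappa>_def v_def by (simp, metis prefix_suffix)
    have km: "\<kappa> y \<in> seqs q" if "y \<in> seqs q" for y
      unfolding \<kappa>_def by (rule suffix_points[OF g(2)[OF uy[OF that]]]) (use v in simp)
    have Fk: "F (u @ prefix k y) = v @ prefix k (\<kappa> y)" if "y \<in> seqs q" for y k
      using Fu[OF that, of k] prefix_conc_snd[of v "length v + k" "\<kappa> y"] by (simp add: gk[OF that])
    have uW: "u @ s \<in> W \<longleftrightarrow> set s \<subseteq> {..<q}" for s using cells_append[OF u(1), of s] u(1) by auto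
    have iso: "prefix k y = prefix k z \<longleftrightarrow> prefix k (\<kappa> y) = prefix k (\<kappa> z)" if "y \<in> seqs q" "z \<in> seqs q" for y z k
    proof
      assume "prefix k y = prefix k z"
      thus "prefix k (\<kappa> y) = prefix k (\<kappa> z)" using Fk[OF that(1), of k] Fk[OF that(2), of k] by simp
    next
      assume "prefix k (\<kappa> y) = prefix k (\<kappa> z)"
      hence "F (u @ prefix k y) = F (u @ prefix k z)" using Fk that by simp
      moreover have "u @ prefix k y \<in> W" "u @ prefix k z \<in> W" using uW prefix_seqs that by metis+
      ultimately show "prefix k y = prefix k z" using inj by (auto dest: inj_onD)
    qed
    \<comment> \<open>Each vertex on either side has exactly \<open>q\<close> children, so the
      injection between the children is onto.\<close>
    have ext: "\<exists>i<q. F (u @ s @ [i]) = F (u @ s) @ [j]" if s: "set s \<subseteq> {..<q}" and j: "j < q" for s j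
    proof -
      have us: "u @ s @ [i] \<in> W" if "i < q" for i using uW[of "s @ [i]"] s that by simp
      have "\<forall>i\<in>{..<q}. \<exists>j. F (u @ s @ [i]) = F (u @ s) @ [j]"
        using n(3)[of "u @ s"] us u(2) by (simp add: d_def)
      then obtain c where c: "\<And>i. i < q \<Longrightarrow> F (u @ s @ [i]) = F (u @ s) @ [c i]" by (metis lessThan_iff)
      have "F (u @ s) \<noteq> []" using n(2)[of "u @ s"] uW s u(2) by (simp add: d_def)
      hence "c i < q" if "i < q" for i
        using FW[OF us[OF that]] tree_words_append[of "F (u @ s)" "[c i]" q "Suc q"] c[OF that] by simp
      moreover have "inj_on c {..<q}"
      proof (rule inj_onI)
        fix a b assume "a \<in> {..<q}" "b \<in> {..<q}" "c a = c b"
        hence "F (u @ s @ [a]) = F (u @ s @ [b])" "u @ s @ [a] \<in> W" "u @ s @ [b] \<in> W" using c us by auto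
        thus "a = b" using inj by (auto dest: inj_onD)
      qed
      ultimately have "c ` {..<q} = {..<q}" by (intro endo_inj_surj) auto
      then obtain i where "i < q" "c i = j" using j by (metis imageE lessThan_iff)
      thus ?thesis using c by auto
    qed
    have surj: "z \<in> \<kappa> ` seqs q" if z: "z \<in> seqs q" for z
    proof -
      \<comment> \<open>Choosing preimages letter by letter, each depending on the word found so
        far, builds a sequence that \<kappa> sends to \<open>z\<close>.\<close>
      have "\<forall>k. \<forall>s. set s \<subseteq> {..<q} \<longrightarrow> (\<exists>i<q. F (u @ s @ [i]) = F (u @ s) @ [z k])"
        using ext z by (simp add: seqs_def)
      then obtain i where i: "\<And>k s. set s \<subseteq> {..<q} \<Longrightarrow> i k s < q \<and> F (u @ s @ [i k s]) = F (u @ s) @ [z k]"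
        by metis
      define S where "S = rec_nat [] (\<lambda>k s. s @ [i k s])"
      have S: "S 0 = []" "S (Suc k) = S k @ [i k (S k)]" for k by (simp_all add: S_def)
      have Sq: "set (S k) \<subseteq> {..<q} \<and> length (S k) = k \<and> F (u @ S k) = v @ prefix k z" for k
        by (induction k) (use i in \<open>auto simp: S v_def\<close>)
      define y where "y k = i k (S k)" for k
      have "y \<in> seqs q" using i Sq by (simp add: seqs_def y_def)
      moreover have "prefix k y = S k" for k by (induction k) (auto simp: S y_def)
      hence "v @ prefix k (\<kappa> y) = v @ prefix k z" for k using Fk[OF \<open>y \<in> seqs q\<close>, of k] Sq[of k] by simp
      hence "\<kappa> y = z" by (intro word_eqI) simp
      ultimately show ?thesis by blast
    qed
    have "inj_on \<kappa> (seqs q)"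
    proof (rule inj_onI)
      fix y z assume yz: "y \<in> seqs q" "z \<in> seqs q" "\<kappa> y = \<kappa> z"
      have "prefix k y = prefix k z" for k using iso[OF yz(1,2), of k] yz(3) by simp
      thus "y = z" by (rule word_eqI)
    qed
    hence "bij_betw \<kappa> (seqs q) (seqs q)" using km surj by (auto simp: bij_betw_def)
    hence "\<kappa> \<in> isometries q" using iso by (rule isometriesI)
    hence "piece g u v" using gk by (auto simp: piece_def)
    thus "\<exists>v\<in>cells. piece g u v" using v by blast
  qed
qed

end

section \<open>The homomorphism to the homeomorphism group, its kernel and its image\<close>

context neretin
begin

definition wmap :: "('v \<Rightarrow> 'v) \<Rightarrow> nat list \<Rightarrow> nat list" where
  "wmap f w = code (f (node w))"

text \<open>Being induced determines the map on \<open>\<Omega>\<close>, the support condition off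
  \<open>\<Omega>\<close>; so the choice is unique.\<close>

definition end_map :: "('v \<Rightarrow> 'v) \<Rightarrow> nat word \<Rightarrow> nat word" where
  "end_map f = (SOME g. induces (wmap f) g \<and> (\<forall>x\<in>\<Omega>. g x \<in> \<Omega>) \<and> supp_in \<Omega> g)"

lemma node_bij: "bij_betw node W V"
  using node_inj node_image by (simp add: bij_betw_def)

lemma code_bij: "bij_betw code V W"
  unfolding code_def by (rule bij_betw_inv_into[OF node_bij])

lemma almost_auts_V: "f \<in> almost_auts V E \<Longrightarrow> x \<in> V \<Longrightarrow> f x \<in> V"
  by (auto simp: almost_auts_def intro: Bij_memD)

lemma waut_wmap:
  assumes f: "f \<in> almost_auts V E"
  shows "waut (wmap f)"
  unfolding waut_def
proof
  have b: "bij_betw f V V" using f by (simp add: almost_auts_def Bij_def)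
  have "bij_betw (code \<circ> (f \<circ> node)) W W"
    by (rule bij_betw_trans[OF bij_betw_trans[OF node_bij b] code_bij])
  moreover have "code \<circ> (f \<circ> node) = wmap f" by (simp add: fun_eq_iff wmap_def)
  ultimately show "bij_betw (wmap f) W W" by simp
  let ?B = "{(x, y). x \<in> V \<and> y \<in> V \<and> ((x, y) \<in> E) \<noteq> ((f x, f y) \<in> E)}"
  have "{(u, v). u \<in> W \<and> v \<in> W \<and> adj u v \<noteq> adj (wmap f u) (wmap f v)} \<subseteq> map_prod code code ` ?B"
  proof (clarify)
    fix u v assume uv: "u \<in> W" "v \<in> W" "adj u v \<noteq> adj (wmap f u) (wmap f v)"
    have fV: "f (node u) \<in> V" "f (node v) \<in> V" using uv node_V almost_auts_V[OF f] by auto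
    have "adj (wmap f u) (wmap f v) \<longleftrightarrow> (f (node u), f (node v)) \<in> E"
      using adj_iff[OF code_simps(2)[OF fV(1)] code_simps(2)[OF fV(2)]] fV by (simp add: wmap_def code_simps)
    hence "(node u, node v) \<in> ?B" using uv adj_iff[OF uv(1,2)] node_V by auto
    moreover have "(u, v) = map_prod code code (node u, node v)" using uv by (simp add: code_simps)
    ultimately show "(u, v) \<in> map_prod code code ` ?B" by (rule image_eqI[rotated])
  qed
  moreover have "finite ?B" using f by (simp add: almost_auts_def)
  ultimately show "finite {(u, v). u \<in> W \<and> v \<in> W \<and> adj u v \<noteq> adj (wmap f u) (wmap f v)}"
    using finite_subset by blast
qed

lemma end_map:
  assumes "f \<in> almost_auts V E"
  shows "induces (wmap f) (end_map f)" "x \<in> \<Omega> \<Longrightarrow> end_map f x \<in> \<Omega>" "supp_in \<Omega> (end_map f)"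
  using someI_ex[OF waut_induces[OF waut_wmap[OF assms]]] unfolding end_map_def by blast+

lemma end_map_eqI:
  assumes f: "f \<in> almost_auts V E" and g: "induces F g" "supp_in \<Omega> g" "\<And>w. w \<in> W \<Longrightarrow> wmap f w = F w"
  shows "end_map f = g"
proof
  fix x show "end_map f x = g x"
    using induces_unique[OF end_map(1)[OF f] g(1,3), of x] end_map(3)[OF f] g(2)
    by (cases "x \<in> \<Omega>") (auto simp: supp_in_def)
qed

lemma wmap_compose:
  "f' \<in> almost_auts V E \<Longrightarrow> w \<in> W \<Longrightarrow> wmap (compose V f f') w = (wmap f \<circ> wmap f') w"
  using node_V almost_auts_V by (simp add: wmap_def compose_def code_simps)

lemma end_map_compose:
  assumes "f \<in> almost_auts V E" "f' \<in> almost_auts V E"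
  shows "end_map (compose V f f') = end_map f \<circ> end_map f'"
  by (rule end_map_eqI[OF almost_auts_compose[OF assms]
      induces_comp[OF end_map(1)[OF assms(1)] end_map(1,2)[OF assms(2)]]
      supp_in_comp[OF end_map(3)[OF assms(1)] end_map(3)[OF assms(2)]] wmap_compose[OF assms(2)]])

lemma one_almost_aut: "(\<lambda>x\<in>V. x) \<in> almost_auts V E"
  using monoid.one_closed[OF group.is_monoid[OF group_almost_aut_group[of V E]]] 
  by (simp add: almost_aut_group_simps)

lemma end_map_id: "end_map (\<lambda>x\<in>V. x) = id"
  by (rule end_map_eqI[OF one_almost_aut induces_id]) (simp_all add: wmap_def node_V code_simps)

lemma end_map_homeo:
  assumes f: "f \<in> almost_auts V E"
  shows "end_map f \<in> homeos"
proof -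
  let ?P = "almost_aut_group V E"
  interpret P: group ?P by (rule group_almost_aut_group)
  note s = almost_aut_group_simps
  define f' where "f' = inv\<^bsub>?P\<^esub> f"
  have f': "f' \<in> almost_auts V E" using P.inv_closed[of f] f by (simp add: s(1) f'_def)
  have "f \<otimes>\<^bsub>?P\<^esub> f' = \<one>\<^bsub>?P\<^esub>" "f' \<otimes>\<^bsub>?P\<^esub> f = \<one>\<^bsub>?P\<^esub>"
    using P.r_inv[of f] P.l_inv[of f] f by (simp_all only: f'_def s(1))
  hence "compose V f f' = (\<lambda>x\<in>V. x)" "compose V f' f = (\<lambda>x\<in>V. x)"
    by (simp_all only: s(2)[OF f f'] s(2)[OF f' f] s(4))
  hence "end_map f \<circ> end_map f' = id" "end_map f' \<circ> end_map f = id"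
    using end_map_compose[OF f f'] end_map_compose[OF f' f] end_map_id by simp_all
  hence "bij (end_map f)" by (intro o_bij)
  moreover have "locally_similar (end_map f)"
    by (rule induced_locally_similar[OF waut_wmap[OF f] end_map(1)[OF f] end_map(2)[OF f]])
  ultimately show ?thesis using end_map(3)[OF f] by (simp add: homeos_def)
qed

lemma finite_short_words: "finite {w \<in> W. length w < n}"
proof -
  have "{w \<in> W. length w < n} = (\<Union>k<n. {w \<in> W. length w = k})" by auto
  thus ?thesis using finite_tree_words by simp
qed

text \<open>A long word \<open>w\<close> is tested on two points that continue it by
  \<open>0\<close> and by \<open>1\<close>. Its image is a prefix of both, hence not longer than
  \<open>w\<close>; if it were shorter, the two children of \<open>w\<close> would have the same
  image.\<close>

lemma induces_id_fixes:
  assumes F: "inj_on F W" and i: "induces F id"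
  shows "finite {w \<in> W. F w \<noteq> w}"
proof -
  obtain n where n: "\<And>x N. x \<in> \<Omega> \<Longrightarrow> N \<ge> n \<Longrightarrow> F (prefix N x) = prefix (length (F (prefix N x))) (id x) \<and>
     length (F (prefix (Suc N) x)) = Suc (length (F (prefix N x)))"
    using i unfolding induces_def by blast
  have long: "F w = w" if w: "w \<in> W" "length w \<ge> Suc n" for w
  proof -
    define N where "N = length w"
    define L where "L = length (F w)"
    have N: "N \<ge> n" "N > 0" using w(2) unfolding N_def by linarith+
    have wc: "w \<in> cells" using w(1) N(2) by (simp add: N_def)
    define x where "x a = (w @ [a]) \<frown> (\<lambda>_. 0)" for a :: nat
    have wa: "w @ [a] \<in> cells" if "a < q" for a using cells_append[OF wc, of "[a]"] that by simp
    have z: "(\<lambda>_. 0) \<in> seqs q" using q2 by (simp add: seqs_def)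
    have xO: "x a \<in> \<Omega>" if "a < q" for a
      unfolding x_def using wa[OF that] z by (intro points_conc) auto
    have pN: "prefix N (x a) = w" for a unfolding x_def N_def using prefix_conc_fst[of "length w" "w @ [a]"] by (simp del: build_append)
    have pS: "prefix (Suc N) (x a) = w @ [a]" for a unfolding x_def N_def using prefix_conc_length[of "w @ [a]"] by (simp del: build_append)
    have F1: "F w = prefix L (x a)" if "a < q" for a
      using n[OF xO[OF that] N(1)] by (simp add: pN L_def)
    have F2: "F (w @ [a]) = prefix (Suc L) (x a)" if "a < q" for a
    proof -
      have "length (F (w @ [a])) = Suc L" using n[OF xO[OF that] N(1)] unfolding pN pS L_def by simp
      thus ?thesis using n[OF xO[OF that], of "Suc N"] N(1) unfolding pS by (simp del: subseq_to_Suc)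
    qed
    have q01: "0 < q" "1 < q" using q2 by auto
    have "\<not> L < N"
    proof
      assume "L < N"
      have e: "prefix N (x 0) = prefix N (x 1)" by (simp only: pN)
      have "prefix (Suc L) (x 0) = prefix (Suc L) (x 1)"
        by (rule prefix_eq_le[OF e]) (use \<open>L < N\<close> in simp)
      hence "F (w @ [0]) = F (w @ [1])" using F2 q01 by simp
      thus False using F wa q01 by (auto dest!: inj_onD)
    qed
    moreover have "\<not> N < L"
    proof
      assume "N < L"
      have "prefix L (x 0) = prefix L (x 1)" using F1[OF q01(1)] F1[OF q01(2)] by simp
      hence "prefix (Suc N) (x 0) = prefix (Suc N) (x 1)" by (rule prefix_eq_le) (use \<open>N < L\<close> in simp)
      thus False by (simp only: pS) simp
    qed
    ultimately have "L = N" by simp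
    thus ?thesis using F1[OF q01(1)] pN by simp
  qed
  have "{w \<in> W. F w \<noteq> w} \<subseteq> {w \<in> W. length w < Suc n}"
  proof
    fix w assume "w \<in> {w \<in> W. F w \<noteq> w}"
    thus "w \<in> {w \<in> W. length w < Suc n}" using long[of w] by (cases "length w \<ge> Suc n") simp_all
  qed
  thus ?thesis using finite_short_words finite_subset by blast
qed

lemma end_map_kernel:
  assumes f: "f \<in> almost_auts V E"
  shows "end_map f = id \<longleftrightarrow> f \<in> finitary_auts V E"
proof -
  have im: "{x \<in> V. f x \<noteq> x} = node ` {w \<in> W. wmap f w \<noteq> w}"
  proof (intro Set.set_eqI iffI)
    fix x assume "x \<in> {x \<in> V. f x \<noteq> x}"
    hence x: "x \<in> V" "f x \<noteq> x" by auto
    have "node (wmap f (code x)) \<noteq> node (code x)" using x almost_auts_V[OF f] by (simp add: wmap_def code_simps)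
    thus "x \<in> node ` {w \<in> W. wmap f w \<noteq> w}" using x code_simps by (intro image_eqI[of _ _ "code x"]) auto
  next
    fix x assume "x \<in> node ` {w \<in> W. wmap f w \<noteq> w}"
    then obtain w where w: "w \<in> W" "wmap f w \<noteq> w" "x = node w" by auto
    have "f x \<noteq> x" using w by (auto simp: wmap_def code_simps)
    thus "x \<in> {x \<in> V. f x \<noteq> x}" using w node_V by auto
  qed
  have inj: "inj_on node {w \<in> W. wmap f w \<noteq> w}" by (rule inj_on_subset[OF node_inj]) auto
  have "finite {x \<in> V. f x \<noteq> x} \<longleftrightarrow> finite {w \<in> W. wmap f w \<noteq> w}"
    unfolding im using finite_image_iff[OF inj] .
  moreover have "finite {w \<in> W. wmap f w \<noteq> w} \<longleftrightarrow> end_map f = id"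
  proof
    assume "end_map f = id"
    thus "finite {w \<in> W. wmap f w \<noteq> w}"
      using induces_id_fixes[of "wmap f"] end_map(1)[OF f] waut_wmap[OF f] by (simp add: waut_def bij_betw_def)
  next
    assume "finite {w \<in> W. wmap f w \<noteq> w}"
    hence "finite (length ` {w \<in> W. wmap f w \<noteq> w})" by simp
    then obtain m where m: "\<And>w. w \<in> W \<Longrightarrow> wmap f w \<noteq> w \<Longrightarrow> length w < m"
      unfolding finite_nat_set_iff_bounded by auto
    have "induces (wmap f) id"
      by (rule induces_cong[OF induces_id, of m]) (use m in fastforce)
    thus "end_map f = id" by (intro end_map_eqI[OF f]) auto
  qed
  ultimately show ?thesis using f by (simp add: finitary_auts_def)
qed

text \<open>A finite complete prefix code with set of inner nodes \<open>I\<close> and set of leaves \<open>L\<close>.\<close>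

lemma card_leaves:
  assumes I: "finite I" "I \<subseteq> W" "[] \<in> I" "\<And>w i. w @ [i] \<in> I \<Longrightarrow> w \<in> I"
    and L: "finite L" "L \<subseteq> W" "I \<inter> L = {}" "\<And>w i. w \<in> I \<Longrightarrow> w @ [i] \<in> W \<Longrightarrow> w @ [i] \<in> I \<union> L"
      "\<And>l. l \<in> L \<Longrightarrow> \<exists>w\<in>I. \<exists>i. l = w @ [i]"
  shows "card I + card L = Suc (Suc (q * card I))"
proof -
  define C where "C w = (\<lambda>i. w @ [i]) ` {..<arity w}" for w :: "nat list"
  have cC: "card (C w) = arity w" for w by (simp add: C_def card_image inj_on_def)
  \<comment> \<open>The nodes are counted twice: as inner nodes and leaves, and as the root together
    with all children of inner nodes.\<close>
  have "I \<union> L = insert [] (\<Union>w\<in>I. C w)"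
  proof
    show "I \<union> L \<subseteq> insert [] (\<Union>w\<in>I. C w)"
    proof
      fix v assume v: "v \<in> I \<union> L"
      show "v \<in> insert [] (\<Union>w\<in>I. C w)"
      proof (cases v rule: rev_cases)
        case (snoc w i)
        have "w \<in> I" using v I(4) L(5) snoc by auto
        moreover have "i < arity w" using v I(2) L(2) words_snoc snoc by auto
        ultimately show ?thesis using snoc by (auto simp: C_def)
      qed simp
    qed
    show "insert [] (\<Union>w\<in>I. C w) \<subseteq> I \<union> L"
      using I(2,3) L(4) words_snoc by (auto simp: C_def)
  qed
  moreover have "card (I \<union> L) = card I + card L" by (rule card_Un_disjoint[OF I(1) L(1,3)])
  moreover have "card (insert [] (\<Union>w\<in>I. C w)) = Suc (\<Sum>w\<in>I. arity w)"
  proof -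
    have "card (\<Union>w\<in>I. C w) = (\<Sum>w\<in>I. card (C w))"
      using I(1) by (intro card_UN_disjoint) (auto simp: C_def)
    moreover have "[] \<notin> (\<Union>w\<in>I. C w)" "finite (\<Union>w\<in>I. C w)" using I(1) by (auto simp: C_def)
    ultimately show ?thesis using cC by simp
  qed
  \<comment> \<open>The extra \<open>1\<close> comes from the root, which has \<open>q + 1\<close>
    children instead of \<open>q\<close>.\<close>
  moreover have "(\<Sum>w\<in>I. arity w) = Suc (q * card I)"
  proof -
    have "(\<Sum>w\<in>I. arity w) = arity [] + (\<Sum>w\<in>I - {[]}. arity w)" using I(1,3) by (rule sum.remove)
    also have "(\<Sum>w\<in>I - {[]}. arity w) = (\<Sum>w\<in>I - {[]}. q)" by (intro sum.cong) (auto simp: arity_def)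
    also have "\<dots> = q * card (I - {[]})" by simp
    finally show ?thesis using card_Suc_Diff1[OF I(1,3)] by (simp add: arity_def) (metis mult_Suc_right)
  qed
  ultimately show ?thesis by simp
qed

text \<open>The pieces of \<open>g\<close> prescribe images for all words of length at least
  \<open>n\<close>, and these images are the words that extend some \<open>t u\<close>. The words
  \<open>I1\<close> and \<open>I2\<close> left over on the two sides are finite in number and
  equally many; any bijection between them completes the map.\<close>

lemma end_map_surj:
  assumes g: "g \<in> homeos"
  shows "\<exists>f\<in>almost_auts V E. end_map f = g"
proof -
  have bg: "bij g" and ls: "locally_similar g" and sg: "supp_in \<Omega> g" using g by (auto simp: homeos_def)
  have gO: "g x \<in> \<Omega> \<longleftrightarrow> x \<in> \<Omega>" for x by (rule homeos_points[OF g])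
  obtain n where n: "n > 0" "\<And>u. u \<in> cells \<Longrightarrow> length u = n \<Longrightarrow> \<exists>v\<in>cells. piece g u v"
    using ls by (auto simp: locally_similar_def)
  define U where "U = {u \<in> W. length u = n}"
  have Uc: "u \<in> cells" "length u = n" if "u \<in> U" for u using that n(1) by (auto simp: U_def)
  have "\<forall>u\<in>U. \<exists>v \<kappa>. v \<in> cells \<and> \<kappa> \<in> isometries q \<and> (\<forall>y\<in>seqs q. g (u \<frown> y) = v \<frown> \<kappa> y)"
    using n(2) Uc unfolding piece_def by blast
  then obtain t \<kappa> where tk: "\<And>u. u \<in> U \<Longrightarrow> t u \<in> cells \<and> \<kappa> u \<in> isometries q \<and> (\<forall>y\<in>seqs q. g (u \<frown> y) = t u \<frown> \<kappa> u y)"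
    by metis
  have t: "t u \<in> cells" and gt: "y \<in> seqs q \<Longrightarrow> g (u \<frown> y) = t u \<frown> \<kappa> u y" if "u \<in> U" for u y
    using tk[OF that] by auto
  have kb: "bij_betw (\<kappa> u) (seqs q) (seqs q)"
    and iso: "y \<in> seqs q \<Longrightarrow> z \<in> seqs q \<Longrightarrow> prefix k y = prefix k z \<longleftrightarrow> prefix k (\<kappa> u y) = prefix k (\<kappa> u z)"
    if "u \<in> U" for u y z k
    using tk[OF that] isometriesD by blast+
  have kq: "\<kappa> u y \<in> seqs q" if "u \<in> U" "y \<in> seqs q" for u y using kb[OF that(1)] that(2) by (auto simp: bij_betw_def)
  have zq: "(\<lambda>_. 0) \<in> seqs q" using q2 by (simp add: seqs_def)
  have sz: "s \<frown> (\<lambda>_. 0) \<in> seqs q" if "set s \<subseteq> {..<q}" for s using that zq by (simp add: seqs_conc)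
  \<comment> \<open>The action of the isometry on finite words; by preservation of prefixes the
    padding with zeros does not influence the result.\<close>
  define sub where "sub u s = prefix (length s) (\<kappa> u (s \<frown> (\<lambda>_. 0)))" for u s
  have sub: "sub u (prefix k y) = prefix k (\<kappa> u y)" if "u \<in> U" "y \<in> seqs q" for u y k
  proof -
    have "prefix k (prefix k y \<frown> (\<lambda>_. 0)) = prefix k y" by simp
    thus ?thesis using iso[OF that(1) sz[OF prefix_seqs[OF that(2)]] that(2), where k = k]
      by (simp only: sub_def subsequence_length diff_zero)
  qed
  have sub_seq: "\<exists>y\<in>seqs q. s = prefix (length s) y" if "set s \<subseteq> {..<q}" for s
    using sz[OF that] by (intro bexI[of _ "s \<frown> (\<lambda>_. 0)"]) auto
  have sub_q: "set (sub u s) \<subseteq> {..<q}" if "u \<in> U" "set s \<subseteq> {..<q}" for u s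
    unfolding sub_def by (rule prefix_seqs[OF kq[OF that(1) sz[OF that(2)]]])
  define G where "G w = t (take n w) @ sub (take n w) (drop n w)" for w
  define J where "J = {w \<in> W. length w \<ge> n}"
  have Jsplit: "take n w \<in> U" "set (drop n w) \<subseteq> {..<q}" if "w \<in> J" for w
  proof -
    have "w \<in> cells" "n \<le> length w" using that n(1) by (auto simp: J_def)
    thus "take n w \<in> U" "set (drop n w) \<subseteq> {..<q}" using cells_split[OF _ n(1), of w] by (auto simp: U_def)
  qed
  have Jmem: "u @ s \<in> J" if "u \<in> U" "set s \<subseteq> {..<q}" for u s
    using cells_append[OF Uc(1)[OF that(1)], of s] that Uc[OF that(1)] by (auto simp: J_def)
  have Gus: "G (u @ s) = t u @ sub u s" if "u \<in> U" for u s
    using Uc(2)[OF that] by (simp add: G_def)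
  have Gpre: "G (u @ prefix k y) = prefix (length (t u) + k) (g (u \<frown> y))" if "u \<in> U" "y \<in> seqs q" for u y k
    using Gus[OF that(1)] sub[OF that] gt[OF that] by simp
  have code: "u = u' \<and> y = y'" if u: "u \<in> U" "u' \<in> U" and y: "y \<in> seqs q" "y' \<in> seqs q"
    and e: "t u \<frown> \<kappa> u y = t u' \<frown> \<kappa> u' y'" for u u' y y'
  proof -
    have "g (u \<frown> y) = g (u' \<frown> y')" using gt u y e by simp
    hence "u \<frown> y = u' \<frown> y'" using bg by (metis inv_apply(1))
    thus ?thesis using concat_eq[of u u' y y'] Uc(2) u by simp
  qed
  \<comment> \<open>The words \<open>t u\<close> form a prefix code: a common extension, padded with
    zeros, would be the image under \<open>g\<close> of points in two different cones.\<close>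
  have disjoint: "u = u'" if u: "u \<in> U" "u' \<in> U" and e: "t u @ a = t u' @ a'" and a: "set a \<subseteq> {..<q}" "set a' \<subseteq> {..<q}" for u u' a a'
  proof -
    obtain y where y: "a \<frown> (\<lambda>_. 0) = \<kappa> u y" "y \<in> seqs q"
      using kb[OF u(1)] sz[OF a(1)] unfolding bij_betw_def by (metis imageE)
    obtain y' where y': "a' \<frown> (\<lambda>_. 0) = \<kappa> u' y'" "y' \<in> seqs q"
      using kb[OF u(2)] sz[OF a(2)] unfolding bij_betw_def by (metis imageE)
    have "t u \<frown> \<kappa> u y = t u' \<frown> \<kappa> u' y'" using e unfolding y(1)[symmetric] y'(1)[symmetric] by simp
    thus ?thesis using code[OF u y(2) y'(2)] by simp
  qed
  have Ginj: "inj_on G J"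
  proof (rule inj_onI)
    fix w w' assume w: "w \<in> J" "w' \<in> J" and e: "G w = G w'"
    define u s u' s' where us: "u = take n w" "s = drop n w" "u' = take n w'" "s' = drop n w'"
    have U: "u \<in> U" "u' \<in> U" and s: "set s \<subseteq> {..<q}" "set s' \<subseteq> {..<q}" using Jsplit w by (auto simp: us)
    have ww: "w = u @ s" "w' = u' @ s'" by (simp_all add: us)
    have e': "t u @ sub u s = t u' @ sub u' s'" using e Gus U by (simp add: ww)
    have uu: "u = u'" by (rule disjoint[OF U e' sub_q[OF U(1) s(1)] sub_q[OF U(2) s(2)]])
    hence ss: "sub u s = sub u s'" using e' by simp
    hence l: "length s = length s'" by (metis diff_zero sub_def subsequence_length)
    have "prefix (length s) (\<kappa> u (s \<frown> (\<lambda>_. 0))) = prefix (length s) (\<kappa> u (s' \<frown> (\<lambda>_. 0)))"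
      using ss l by (simp add: sub_def)
    hence pe: "prefix (length s) (s \<frown> (\<lambda>_. 0)) = prefix (length s) (s' \<frown> (\<lambda>_. 0))"
      by (rule iffD2[OF iso[OF U(1) sz[OF s(1)] sz[OF s(2)]]])
    have "s = prefix (length s) (s \<frown> (\<lambda>_. 0))" by (rule prefix_conc_length[symmetric])
    also have "\<dots> = prefix (length s') (s' \<frown> (\<lambda>_. 0))" unfolding l[symmetric] by (rule pe)
    also have "\<dots> = s'" by (rule prefix_conc_length)
    finally have "s = s'" .
    thus "w = w'" using uu ww by simp
  qed
  \<comment> \<open>The inner nodes of the prefix code formed by the words
    \<open>t u\<close>.\<close>
  define I2 where "I2 = {w \<in> W. \<forall>u\<in>U. \<forall>a. w \<noteq> t u @ a}"
  have GW: "G ` J = W - I2"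
  proof
    show "G ` J \<subseteq> W - I2"
    proof
      fix v assume "v \<in> G ` J"
      then obtain w where w: "w \<in> J" "v = G w" by auto
      have v: "v = t (take n w) @ sub (take n w) (drop n w)" using w(2) by (simp add: G_def)
      have "v \<in> W" unfolding v
        using cells_append[OF t[OF Jsplit(1)[OF w(1)]]] sub_q[OF Jsplit(1)[OF w(1)] Jsplit(2)[OF w(1)]] by blast
      moreover have "v \<notin> I2" using v Jsplit(1)[OF w(1)] by (auto simp: I2_def)
      ultimately show "v \<in> W - I2" by simp
    qed
    show "W - I2 \<subseteq> G ` J"
    proof
      fix v assume "v \<in> W - I2"
      then obtain u a where u: "u \<in> U" and v: "v = t u @ a" "v \<in> W" by (auto simp: I2_def)
      have a: "set a \<subseteq> {..<q}" using cells_append[OF t[OF u], of a] v t[OF u] by auto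
      have "a \<frown> (\<lambda>_. 0) \<in> \<kappa> u ` seqs q" using kb[OF u] sz[OF a] by (auto simp: bij_betw_def)
      then obtain y where y: "y \<in> seqs q" "\<kappa> u y = a \<frown> (\<lambda>_. 0)" by (metis imageE)
      define s where "s = prefix (length a) y"
      have "G (u @ s) = v" using Gus[OF u, of s] sub[OF u y(1), of "length a"] y(2) by (simp add: s_def v)
      moreover have "u @ s \<in> J" by (rule Jmem[OF u]) (use prefix_seqs[OF y(1)] in \<open>simp only: s_def\<close>)
      ultimately show "v \<in> G ` J" by blast
    qed
  qed
  have Gsnoc: "\<exists>j. G (w @ [i]) = G w @ [j]" if w: "w \<in> J" "w @ [i] \<in> W" for w i
  proof -
    have wi: "w @ [i] \<in> J" using w by (auto simp: J_def)
    have l: "n \<le> length w" using w by (simp add: J_def)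
    have d: "drop n (w @ [i]) = drop n w @ [i]" "take n (w @ [i]) = take n w" using l by simp_all
    obtain y where y: "y \<in> seqs q" "drop n w @ [i] = prefix (length (drop n w @ [i])) y"
      using sub_seq[OF Jsplit(2)[OF wi, unfolded d]] by auto
    define k where "k = length (drop n w)"
    have p: "drop n w @ [i] = prefix (Suc k) y" using y(2) by (simp add: k_def)
    hence p': "drop n w = prefix k y" by simp
    have U: "take n w \<in> U" by (rule Jsplit(1)[OF w(1)])
    have "G (w @ [i]) = t (take n w) @ prefix (Suc k) (\<kappa> (take n w) y)"
      unfolding G_def d p sub[OF U y(1)] ..
    moreover have "G w = t (take n w) @ prefix k (\<kappa> (take n w) y)"
      unfolding G_def p' sub[OF U y(1)] ..
    ultimately show ?thesis by simp
  qed
  define I1 where "I1 = {w \<in> W. length w < n}"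
  have fI1: "finite I1" unfolding I1_def by (rule finite_short_words)
  have fU: "finite U" unfolding U_def by (rule finite_tree_words)
  \<comment> \<open>The code is complete: the point through a long \<open>w\<close> is
    \<open>g x\<close> for some \<open>x\<close>, so the word \<open>t u\<close> belonging to
    \<open>x\<close>, being no longer than \<open>w\<close>, is a prefix of it.\<close>
  have fI2: "finite I2"
  proof -
    obtain M where M: "\<And>u. u \<in> U \<Longrightarrow> length (t u) \<le> M"
      using fU finite_nat_set_iff_bounded_le[of "(\<lambda>u. length (t u)) ` U"] by auto
    have "length w < Suc M" if w: "w \<in> I2" for w
    proof (rule ccontr)
      assume "\<not> length w < Suc M"
      hence l: "length w > M" by simp
      hence wc: "w \<in> cells" using w by (auto simp: I2_def)
      define x where "x = pinv g (w \<frown> (\<lambda>_. 0))"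
      have wO: "w \<frown> (\<lambda>_. 0) \<in> \<Omega>" using wc zq by (auto intro: points_conc)
      have gx: "g x = w \<frown> (\<lambda>_. 0)" using bg by (simp add: x_def inv_apply)
      hence xO: "x \<in> \<Omega>" using gO[of x] wO by simp
      define u where "u = prefix n x"
      have u: "u \<in> U" using cells_prefix[OF xO n(1)] by (auto simp: u_def U_def)
      have "g x = t u \<frown> \<kappa> u (suffix n x)"
        using gt[OF u suffix_points[OF xO n(1)]] by (simp add: u_def)
      hence "prefix (length (t u)) (w \<frown> (\<lambda>_. 0)) = t u" using gx by simp
      hence "take (length (t u)) w = t u" using M[OF u] l by simp
      hence "w = t u @ drop (length (t u)) w" by (metis append_take_drop_id)
      thus False using w u by (auto simp: I2_def)
    qed
    hence "I2 \<subseteq> {w \<in> W. length w < Suc M}" by (auto simp: I2_def)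
    thus ?thesis using finite_short_words finite_subset by blast
  qed
  have tinj: "inj_on t U"
    by (rule inj_onI, rule disjoint[where a = "[]" and a' = "[]"]) auto
  have c1: "card I1 + card U = Suc (Suc (q * card I1))"
  proof (rule card_leaves[OF fI1 _ _ _ fU])
    show "[] \<in> I1" using n(1) by (simp add: I1_def)
    show "\<exists>w\<in>I1. \<exists>i. l = w @ [i]" if "l \<in> U" for l
    proof (cases l rule: rev_cases)
      case Nil
      thus ?thesis using that n(1) by (simp add: U_def)
    next
      case (snoc w i)
      thus ?thesis using that words_snoc by (auto simp: U_def I1_def)
    qed
  qed (auto simp: I1_def U_def words_snoc)
  have c2: "card I2 + card (t ` U) = Suc (Suc (q * card I2))"
  proof (rule card_leaves[OF fI2 _ _ _ finite_imageI[OF fU]])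
    show "I2 \<subseteq> W" by (auto simp: I2_def)
    show "[] \<in> I2" using t by (auto simp: I2_def)
    show "w \<in> I2" if "w @ [i] \<in> I2" for w i
      using that words_snoc unfolding I2_def by (auto simp del: append_assoc) (metis append_assoc)
    show "t ` U \<subseteq> W" using t by auto
    show "I2 \<inter> t ` U = {}" unfolding I2_def by auto
    show "w @ [i] \<in> I2 \<union> t ` U" if wi: "w \<in> I2" "w @ [i] \<in> W" for w i
    proof (cases "w @ [i] \<in> I2")
      case False
      then obtain u a where u: "u \<in> U" "w @ [i] = t u @ a" using wi(2) by (auto simp: I2_def)
      have "a = []"
      proof (cases a rule: rev_cases)
        case (snoc b j)
        hence "w = t u @ b" using u(2) by simp
        thus ?thesis using wi(1) u(1) by (auto simp: I2_def)
      qed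
      thus ?thesis using u by auto
    qed simp
    show "\<exists>w\<in>I2. \<exists>i. l = w @ [i]" if l: "l \<in> t ` U" for l
    proof -
      obtain u where u: "u \<in> U" "l = t u" using l by auto
      have "l \<noteq> []" using t[OF u(1)] u(2) by simp
      then obtain w i where w: "l = w @ [i]" by (metis append_butlast_last_id)
      have lW: "l \<in> W" using t u by auto
      have "w \<noteq> t u' @ a" if u': "u' \<in> U" for u' a
      proof
        assume wa: "w = t u' @ a"
        hence e: "t u @ [] = t u' @ (a @ [i])" using u w by simp
        have "set (a @ [i]) \<subseteq> {..<q}" using cells_append[OF t[OF u'], of "a @ [i]"] e t[OF u(1)] by simp
        hence "u = u'" using disjoint[OF u(1) u' e] by simp
        thus False using e by simp
      qed
      moreover have "w \<in> W" using lW words_snoc by (simp add: w)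
      ultimately show ?thesis using w by (auto simp: I2_def)
    qed
  qed
  have "card I1 = card I2"
  proof -
    have c: "card (t ` U) = card U" by (rule card_image[OF tinj])
    \<comment> \<open>Both counts say that the number of leaves is \<open>q - 1\<close> times the
      number of inner nodes plus two, and \<open>q - 1\<close> is positive.\<close>
    obtain p where p: "q = Suc (Suc p)" using q2 by (metis Suc_le_D numeral_2_eq_2 Suc_le_mono)
    have "card U = Suc (Suc (Suc p * card I1))" "card U = Suc (Suc (Suc p * card I2))"
      using c1 c2 c by (simp_all add: p)
    hence "Suc p * card I1 = Suc p * card I2" by simp
    thus ?thesis by (simp only: mult_cancel1) simp
  qed
  \<comment> \<open>Adjacency is ignored here: only finitely many vertices are concerned and the
    tree is locally finite, so only finitely many pairs are spoiled.\<close>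
  then obtain \<beta> where \<beta>: "bij_betw \<beta> I1 I2" using finite_same_card_bij[OF fI1 fI2] by auto
  define F where "F w = (if w \<in> J then G w else \<beta> w)" for w
  have WJ: "W = I1 \<union> J" "I1 \<inter> J = {}" by (auto simp: I1_def J_def)
  have FJ: "F w = G w" if "w \<in> J" for w using that by (simp add: F_def)
  have FI: "F w = \<beta> w" if "w \<in> I1" for w using that WJ(2) by (auto simp: F_def)
  have FW: "bij_betw F W W"
  proof -
    have "bij_betw F I1 I2" using \<beta> FI by (subst bij_betw_cong[of I1 F \<beta>]) auto
    moreover have "bij_betw F J (W - I2)" 
      using Ginj GW FJ by (subst bij_betw_cong[of J F G]) (auto simp: bij_betw_def)
    ultimately have "bij_betw F (I1 \<union> J) (I2 \<union> (W - I2))" by (rule bij_betw_combine) auto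
    moreover have "I2 \<union> (W - I2) = W" by (auto simp: I2_def)
    ultimately show ?thesis using WJ(1) by simp
  qed
  define nb where "nb w = {v \<in> W. adj w v}" for w
  have fnb: "finite (nb w)" if "w \<in> W" for w
  proof -
    have "nb w \<subseteq> insert (butlast w) ((\<lambda>i. w @ [i]) ` {..<arity w})"
      using words_snoc by (auto simp: nb_def adj_def)
    thus ?thesis using finite_subset by blast
  qed
  \<comment> \<open>The converse of \<open>Gsnoc\<close>. Both images extend the same
    \<open>t u\<close>, so \<open>a\<close> and \<open>b\<close> lie below the same
    \<open>u\<close>; dropping the last letter of \<open>b\<close> gives a word with the image of
    \<open>a\<close>, and \<open>G\<close> is injective.\<close>
  have child_iff: "\<exists>i. b = a @ [i]" if ab: "a \<in> J" "b \<in> J" "F b = F a @ [j]" for a b j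
  proof -
    have ac: "a \<in> cells" using ab n(1) by (auto simp: J_def)
    define u s where us: "u = take n a" "s = drop n a"
    have u: "u \<in> U" and s: "set s \<subseteq> {..<q}" and a: "a = u @ s" using Jsplit[OF ab(1)] by (auto simp: us)
    have Fa: "F a = t u @ sub u s" using FJ[OF ab(1)] Gus[OF u] a by simp
    have Fb: "F b = t u @ (sub u s @ [j])" using ab(3) Fa by simp
    define u' s' where us': "u' = take n b" "s' = drop n b"
    have u': "u' \<in> U" and s': "set s' \<subseteq> {..<q}" and b: "b = u' @ s'" using Jsplit[OF ab(2)] by (auto simp: us')
    have Fb': "F b = t u' @ sub u' s'" using FJ[OF ab(2)] Gus[OF u'] b by simp
    have "F b \<in> W" using FW ab(2) WJ(1) by (auto simp: bij_betw_def)
    hence "set (sub u s @ [j]) \<subseteq> {..<q}" using cells_append[OF t[OF u], of "sub u s @ [j]"] t[OF u] unfolding Fb by auto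
    hence uu: "u = u'" using disjoint[OF u u', of "sub u s @ [j]" "sub u' s'"] sub_q[OF u' s'] Fb Fb' by simp
    hence ss: "sub u s' = sub u s @ [j]" using Fb Fb' by simp
    have l: "length s' = Suc (length s)" using arg_cong[OF ss, of length] by (simp add: sub_def)
    obtain y where y: "y \<in> seqs q" "s' = prefix (Suc (length s)) y" using sub_seq[OF s'] l by auto
    define s0 where "s0 = prefix (length s) y"
    have s0: "s' = s0 @ [y (length s)]" using y(2) by (simp add: s0_def)
    have "sub u s' = prefix (Suc (length s)) (\<kappa> u y)" unfolding y(2) by (rule sub[OF u y(1)])
    moreover have "sub u s0 = prefix (length s) (\<kappa> u y)" unfolding s0_def by (rule sub[OF u y(1)])
    ultimately have "sub u s0 = sub u s" using ss by simp
    moreover have s0q: "set s0 \<subseteq> {..<q}" unfolding s0_def by (rule prefix_seqs[OF y(1)])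
    ultimately have "G (u @ s0) = G (u @ s)" using Gus[OF u] by simp
    hence "u @ s0 = u @ s" using Ginj Jmem[OF u s0q] Jmem[OF u s] by (auto dest: inj_onD)
    thus ?thesis using s0 a b uu by simp
  qed
  have waut: "waut F"
    unfolding waut_def
  proof (rule conjI[OF FW])
    define FI where "FI w = inv_into W F w" for w
    define B where "B = {(u, v). u \<in> W \<and> v \<in> W \<and> adj u v \<noteq> adj (F u) (F v)}"
    have FIF: "FI (F v) = v" if "v \<in> W" for v using FW that by (simp add: FI_def bij_betw_def)
    have FWm: "F v \<in> W" if "v \<in> W" for v using FW that by (auto simp: bij_betw_def)
    have sym: "adj u v \<longleftrightarrow> adj v u" for u v by (auto simp: adj_def)
    \<comment> \<open>All possible partners of \<open>a\<close> in a bad pair: its neighbours and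
      the preimages of the neighbours of its image.\<close>
    define S where "S a = nb a \<union> FI ` nb (F a)" for a
    have S: "b \<in> S a" if "a \<in> W" "b \<in> W" "adj a b \<noteq> adj (F a) (F b)" for a b
    proof (cases "adj a b")
      case False
      hence "F b \<in> nb (F a)" using that FWm by (simp add: nb_def)
      thus ?thesis using FIF[OF that(2)] by (auto simp: S_def intro: image_eqI[of _ _ "F b"])
    qed (use that in \<open>simp add: S_def nb_def\<close>)
    have short: "a \<in> I1 \<or> b \<in> I1" if "a \<in> W" "b \<in> W" "adj a b \<noteq> adj (F a) (F b)" for a b
    proof (rule ccontr)
      assume "\<not> (a \<in> I1 \<or> b \<in> I1)"
      hence J: "a \<in> J" "b \<in> J" using that WJ(1) by auto
      have one: "(\<exists>i. b = a @ [i]) \<longleftrightarrow> (\<exists>j. F b = F a @ [j])" if "a \<in> J" "b \<in> J" for a b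
        using child_iff[OF that] Gsnoc[OF that(1)] that FJ[OF that(1)] FJ[OF that(2)] by (auto simp: J_def)
      have "adj a b \<longleftrightarrow> adj (F a) (F b)" using one[OF J] one[OF J(2,1)] by (simp add: adj_def)
      thus False using that(3) by simp
    qed
    have "B \<subseteq> (\<Union>a\<in>I1. {a} \<times> S a) \<union> (\<Union>a\<in>I1. S a \<times> {a})"
    proof
      fix p assume "p \<in> B"
      then obtain a b where p: "p = (a, b)" "a \<in> W" "b \<in> W" "adj a b \<noteq> adj (F a) (F b)" by (auto simp: B_def)
      have "b \<in> S a" "a \<in> S b" using S[OF p(2,3,4)] S[OF p(3,2)] p(4) sym by blast+
      thus "p \<in> (\<Union>a\<in>I1. {a} \<times> S a) \<union> (\<Union>a\<in>I1. S a \<times> {a})" using short[OF p(2,3,4)] p(1) by auto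
    qed
    moreover have "finite (S a)" if "a \<in> I1" for a
      using fnb that FWm WJ(1) by (simp add: S_def)
    hence "finite ((\<Union>a\<in>I1. {a} \<times> S a) \<union> (\<Union>a\<in>I1. S a \<times> {a}))" using fI1 by simp
    ultimately have "finite B" by (rule finite_subset)
    thus "finite {(u, v). u \<in> W \<and> v \<in> W \<and> adj u v \<noteq> adj (F u) (F v)}" by (simp add: B_def)
  qed
  have ind: "induces F g"
    unfolding induces_def
  proof (intro exI[of _ n] ballI allI impI)
    fix x N assume x: "x \<in> \<Omega>" and N: "n \<le> N"
    define u y where uy: "u = prefix n x" "y = suffix n x"
    have u: "u \<in> U" using cells_prefix[OF x n(1)] by (auto simp: uy U_def)
    have y: "y \<in> seqs q" unfolding uy by (rule suffix_points[OF x n(1)])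
    have xe: "x = u \<frown> y" by (simp add: uy)
    have F: "F (prefix M x) = prefix (length (t u) + (M - n)) (g x)" if M: "n \<le> M" for M
    proof -
      have p: "prefix M x = u @ prefix (M - n) y" using prefix_conc_snd[of u M y] Uc(2)[OF u] M unfolding xe by simp
      have "u @ prefix (M - n) y \<in> J" by (rule Jmem[OF u prefix_seqs[OF y]])
      thus ?thesis using Gpre[OF u y, of "M - n"] FJ unfolding p by (simp only: xe)
    qed
    have "Suc N - n = Suc (N - n)" using N by simp
    thus "F (prefix N x) = prefix (length (F (prefix N x))) (g x) \<and>
       length (F (prefix (Suc N) x)) = Suc (length (F (prefix N x)))"
      using F[of N] F[of "Suc N"] N by (simp del: subseq_to_Suc)
  qed
  define f where "f = (\<lambda>x\<in>V. node (F (code x)))"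
  have wf: "wmap f w = F w" if "w \<in> W" for w
    using that bij_betwE[OF FW] node_V by (simp add: wmap_def f_def code_simps)
  have fb: "bij_betw f V V"
  proof -
    have "bij_betw (node \<circ> (F \<circ> code)) V V"
      by (rule bij_betw_trans[OF bij_betw_trans[OF code_bij FW] node_bij])
    thus ?thesis by (subst bij_betw_cong[of V f "node \<circ> (F \<circ> code)"]) (auto simp: f_def)
  qed
  have "f \<in> almost_auts V E"
  proof -
    let ?B = "{(u, v). u \<in> W \<and> v \<in> W \<and> adj u v \<noteq> adj (F u) (F v)}"
    have "{(x, y). x \<in> V \<and> y \<in> V \<and> ((x, y) \<in> E) \<noteq> ((f x, f y) \<in> E)} \<subseteq> map_prod node node ` ?B"
    proof (clarify)
      fix x y assume xy: "x \<in> V" "y \<in> V" "((x, y) \<in> E) \<noteq> ((f x, f y) \<in> E)"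
      have c: "code x \<in> W" "code y \<in> W" "F (code x) \<in> W" "F (code y) \<in> W"
        using code_simps(2) xy FW by (auto simp: bij_betw_def)
      have "(x, y) \<in> E \<longleftrightarrow> adj (code x) (code y)" using adj_iff[OF c(1,2)] xy by (simp add: code_simps)
      moreover have "(f x, f y) \<in> E \<longleftrightarrow> adj (F (code x)) (F (code y))"
        using adj_iff[OF c(3,4)] xy by (simp add: f_def)
      ultimately have "(code x, code y) \<in> ?B" using c xy by auto
      moreover have "(x, y) = map_prod node node (code x, code y)" using xy by (simp add: code_simps)
      ultimately show "(x, y) \<in> map_prod node node ` ?B" by (rule image_eqI[rotated])
    qed
    moreover have "finite ?B" using waut by (simp add: waut_def)
    ultimately have "finite {(x, y). x \<in> V \<and> y \<in> V \<and> ((x, y) \<in> E) \<noteq> ((f x, f y) \<in> E)}"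
      using finite_subset by blast
    thus ?thesis using fb by (simp add: almost_auts_def Bij_def f_def)
  qed
  moreover from this have "end_map f = g" by (rule end_map_eqI[OF _ ind sg wf])
  ultimately show ?thesis by blast
qed

lemma end_map_group_hom: "group_hom (almost_aut_group V E) homeos.perm_group end_map"
  using group_almost_aut_group homeos.group_perm_group
  by (auto simp: group_hom_def group_hom_axioms_def hom_def almost_aut_group_simps end_map_homeo
    end_map_compose simp del: o_apply)

theorem AAut_uniformly_simple:
  "uniformly_simple 9 (commutator_subgroup (AAut V E)) \<and>
   commutator_width (commutator_subgroup (AAut V E)) \<le> 3"
proof -
  let ?P = "almost_aut_group V E"
  interpret h: group_hom ?P homeos.perm_group end_map by (rule end_map_group_hom)
  have ker: "kernel ?P homeos.perm_group end_map = finitary_auts V E"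
    using end_map_kernel by (auto simp: kernel_def almost_aut_group_simps finitary_auts_def)
  have surj: "end_map ` carrier ?P = carrier homeos.perm_group"
    using end_map_surj end_map_homeo by (force simp: almost_aut_group_simps)
  \<comment> \<open>The first isomorphism theorem; the transfer of the bounds uses the inverse of
    this isomorphism.\<close>
  have "(\<lambda>A. the_elem (end_map ` A)) \<in> iso (AAut V E) homeos.perm_group"
    using h.FactGroup_iso_set[OF surj] unfolding AAut_def ker .
  hence "inv_into (carrier (AAut V E)) (\<lambda>A. the_elem (end_map ` A)) \<in> iso homeos.perm_group (AAut V E)"
    by (rule group.iso_set_sym[OF group_AAut])
  thus ?thesis by (rule homeos.uniformly_simple_iso[OF group_AAut])
qed

end

theorem theorem1p2:
  shows "(\<forall>q>1. \<forall>(V :: 'v set) E. regular_tree (q + 1) V E \<longrightarrow>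
            uniformly_simple 9 (commutator_subgroup (AAut V E)) \<and>
            commutator_width (commutator_subgroup (AAut V E)) \<le> 3) \<and>
         (\<forall>q r. q > r \<and> r \<ge> 1 \<longrightarrow>
            uniformly_simple 9 (commutator_subgroup (Higman_Thompson q r)) \<and>
            commutator_width (commutator_subgroup (Higman_Thompson q r)) \<le> 3)"
proof (rule conjI; intro allI impI)
  fix q :: nat and V :: "'v set" and E
  assume "q > 1" "regular_tree (q + 1) V E"
  hence "neretin q V E" by (simp add: neretin_def)
  thus "uniformly_simple 9 (commutator_subgroup (AAut V E)) \<and>
      commutator_width (commutator_subgroup (AAut V E)) \<le> 3"
    by (rule neretin.AAut_uniformly_simple)
next
  fix q r :: nat assume "q > r \<and> r \<ge> 1"
  hence "higman_thompson q r" by (simp add: higman_thompson_def)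
  thus "uniformly_simple 9 (commutator_subgroup (Higman_Thompson q r)) \<and>
      commutator_width (commutator_subgroup (Higman_Thompson q r)) \<le> 3"
    by (rule higman_thompson.Higman_Thompson_uniformly_simple)
qed

end
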